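(* Let $(M,g)$ be a semi-Riemannian manifold of dimension $n$, let $\gamma:[a,b]\to M$ be a geodesic, and let $\mathcal P\subset M$ be a smooth connected submanifold with $\gamma(a)\in\mathcal P$, $\dot\gamma(a)\in T_{\gamma(a)}\mathcal P^\perp$, and such that $g$ restricted to $T_{\gamma(a)}\mathcal P$ is nondegenerate. Let $\ell:[a,b]\to\Lambda$ be the curve of Lagrangians associated with $\gamma$ and let $L_0$, $L_{\mathcal P}$ be the Lagrangians associated with $\{\gamma(a)\}$ and $\mathcal P$ (see context). Then, for any interval $[\alpha,\beta]\subset[a,b]$, $$\Big|\mu_{L_0}\big(\ell|_{[\alpha,\beta]}\big)-\mu_{L_{\mathcal P}}\big(\ell|_{[\alpha,\beta]}\big)\Big|\le\dim(\mathcal P).$$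
   Context: Maslov index. Let $(V,\omega)$ be a $2n$-dimensional real symplectic space and $\Lambda$ the set of its Lagrangian subspaces. For $L_1\in\Lambda$, $\Lambda^0(L_1)$ is the set of Lagrangians transverse to $L_1$. If $L_0,L_1$ are transverse Lagrangians, $\varphi_{L_0,L_1}:\Lambda^0(L_1)\to\mathrm{B}_{\mathrm{sym}}(L_0)$ (symmetric bilinear forms on $L_0$) is $\varphi_{L_0,L_1}(L)=\omega(T\cdot,\cdot)|_{L_0\times L_0}$, where $T:L_0\to L_1$ is the linear map whose graph is $L$. For a symmetric bilinear form $B$, $n_-(B)$ is the maximal dimension of a subspace on which $B$ is negative definite and $n_+(B)=n_-(-B)$. For a continuous path $\ell:[a,b]\to\Lambda$ and $L_0\in\Lambda$, $\mu_{L_0}(\ell)\in\mathbb Z$ is characterized by: fixed-endpoint homotopy invariance; additivity under concatenation; and, if $\ell([a,b])\subset\Lambda^0(L_1)$ for some $L_1$ transverse to $L_0$, $\mu_{L_0}(\ell)=n_+[\varphi_{L_0,L_1}(\ell(b))]-n_+[\varphi_{L_0,L_1}(\ell(a))]$. Geometric setting. $\perp$ denotes $g$-orthogonality. Jacobi fields along $\gamma$ are solutions of $\frac{\mathrm D^2}{\mathrm dt^2}J-R(\dot\gamma,J)\dot\gamma=0$, with $R(X,Y)=[\nabla_X,\nabla_Y]-\nabla_{[X,Y]}$. Let $V=T_{\gamma(a)}M\oplus T_{\gamma(a)}M$ with symplectic form $\omega\big((v_1,w_1),(v_2,w_2)\big)=g(v_2,w_1)-g(v_1,w_2)$. For $(v,w)\in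 V$ let $J_{v,w}$ be the Jacobi field along $\gamma$ with $J(a)=v$, $\frac{\mathrm D}{\mathrm dt}J(a)=w$. The smooth curve $\ell:[a,b]\to\Lambda$ is $\ell(t)=\{(v,w)\in V: J_{v,w}(t)=0\}$. Set $L_0=\{0\}\oplus T_{\gamma(a)}M=\ell(a)$. Let $S:T_{\gamma(a)}\mathcal P\to T_{\gamma(a)}\mathcal P$ be the $g$-symmetric operator representing the second fundamental form of $\mathcal P$ at $\gamma(a)$ in the normal direction $\dot\gamma(a)$, i.e. $g(S(v),v')=g(\nabla_vV',\dot\gamma(a))$ for any local extension $V'$ of $v'$ to a field tangent to $\mathcal P$. Set $L_{\mathcal P}=\{(v,w)\in V: v\in T_{\gamma(a)}\mathcal P,\ w+S(v)\in T_{\gamma(a)}\mathcal P^\perp\}$, a Lagrangian subspace. *)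

theory Defs
  imports "HOL-Analysis.Analysis"
begin

section \<open>Symmetric forms, Lagrangians and the Maslov index\<close>

definition neg_index :: "'v::euclidean_space set \<Rightarrow> ('v \<Rightarrow> 'v \<Rightarrow> real) \<Rightarrow> nat" where
  "neg_index W B = Max {dim U |U. subspace U \<and> U \<subseteq> W \<and> (\<forall>x\<in>U. x \<noteq> 0 \<longrightarrow> B x x < 0)}"

definition pos_index :: "'v::euclidean_space set \<Rightarrow> ('v \<Rightarrow> 'v \<Rightarrow> real) \<Rightarrow> nat" where
  "pos_index W B = neg_index W (\<lambda>x y. - B x y)"

definition lagrangian :: "('v::euclidean_space \<Rightarrow> 'v \<Rightarrow> real) \<Rightarrow> 'v set \<Rightarrow> bool" where
  "lagrangian \<omega> L \<longleftrightarrow> subspace L \<and> (\<forall>x\<in>L. \<forall>y\<in>L. \<omega> x y = 0) \<and> 2 * dim L = DIM('v)"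

definition transverse :: "'v::euclidean_space set \<Rightarrow> 'v set \<Rightarrow> bool" where
  "transverse L L' \<longleftrightarrow> L \<inter> L' = {0}"

text \<open>For \<open>L\<close> transverse to \<open>L\<^sub>1\<close>, and \<open>x \<in> L\<^sub>0\<close>, the vector \<open>graph_map L\<^sub>1 L x\<close> is \<open>T x\<close>, where
  \<open>T : L\<^sub>0 \<rightarrow> L\<^sub>1\<close> is the linear map whose graph \<open>{x + T x | x \<in> L\<^sub>0}\<close> is \<open>L\<close>.\<close>

definition graph_map :: "'v::euclidean_space set \<Rightarrow> 'v set \<Rightarrow> 'v \<Rightarrow> 'v" where
  "graph_map L1 L x = (THE y. y \<in> L1 \<and> x + y \<in> L)"

text \<open>The form \<open>\<phi>\<close> of \<open>L\<close> relative to \<open>(L\<^sub>0, L\<^sub>1)\<close>; it is meaningful on \<open>L\<^sub>0\<close> only.\<close>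

definition lag_form ::
    "('v::euclidean_space \<Rightarrow> 'v \<Rightarrow> real) \<Rightarrow> 'v set \<Rightarrow> 'v set \<Rightarrow> 'v \<Rightarrow> 'v \<Rightarrow> real" where
  "lag_form \<omega> L1 L x y = \<omega> (graph_map L1 L x) y"

text \<open>The Lagrangian Grassmannian carries the topology obtained by identifying a subspace with
  the orthogonal projection onto it, which is \<open>closest_point L\<close>.  The auxiliary inner product of
  the Euclidean space does not affect this topology, which is the usual manifold topology.\<close>

definition lag_continuous_on ::
    "('v::euclidean_space \<Rightarrow> 'v \<Rightarrow> real) \<Rightarrow> 'p::topological_space set \<Rightarrow> ('p \<Rightarrow> 'v set) \<Rightarrow> bool" where
  "lag_continuous_on \<omega> S l \<longleftrightarrow>
     (\<forall>s\<in>S. lagrangian \<omega> (l s)) \<and> (\<forall>x. continuous_on S (\<lambda>s. closest_point (l s) x))"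

definition lag_homotopic ::
    "('v::euclidean_space \<Rightarrow> 'v \<Rightarrow> real) \<Rightarrow> real \<Rightarrow> real \<Rightarrow> (real \<Rightarrow> 'v set) \<Rightarrow> (real \<Rightarrow> 'v set) \<Rightarrow> bool" where
  "lag_homotopic \<omega> a b l l' \<longleftrightarrow>
     (\<exists>H. lag_continuous_on \<omega> ({a..b} \<times> {0..1::real}) H \<and>
          (\<forall>t\<in>{a..b}. H (t, 0) = l t \<and> H (t, 1) = l' t) \<and>
          (\<forall>s\<in>{0..1}. H (a, s) = l a \<and> H (b, s) = l b))"

text \<open>\<open>\<mu> a b l\<close> is the index, relative to \<open>L\<^sub>0\<close>, of the restriction of \<open>l\<close> to \<open>[a,b]\<close>.  The three
  clauses determine it for every continuous path of Lagrangians, and say nothing about other \<open>l\<close>.\<close>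

definition is_maslov_index ::
    "('v::euclidean_space \<Rightarrow> 'v \<Rightarrow> real) \<Rightarrow> 'v set \<Rightarrow> (real \<Rightarrow> real \<Rightarrow> (real \<Rightarrow> 'v set) \<Rightarrow> int) \<Rightarrow> bool" where
  "is_maslov_index \<omega> L0 \<mu> \<longleftrightarrow>
     (\<forall>a b l l'. a \<le> b \<longrightarrow> lag_homotopic \<omega> a b l l' \<longrightarrow> \<mu> a b l = \<mu> a b l') \<and>
     (\<forall>a c b l. a \<le> c \<longrightarrow> c \<le> b \<longrightarrow> lag_continuous_on \<omega> {a..b} l \<longrightarrow>
        \<mu> a b l = \<mu> a c l + \<mu> c b l) \<and>
     (\<forall>a b l L1. a \<le> b \<longrightarrow> lag_continuous_on \<omega> {a..b} l \<longrightarrow>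
        lagrangian \<omega> L1 \<longrightarrow> transverse L0 L1 \<longrightarrow> (\<forall>t\<in>{a..b}. transverse (l t) L1) \<longrightarrow>
        \<mu> a b l = int (pos_index L0 (lag_form \<omega> L1 (l b))) - int (pos_index L0 (lag_form \<omega> L1 (l a))))"


section \<open>Smooth manifolds\<close>

primrec Ck_on :: "nat \<Rightarrow> ('a::real_normed_vector \<Rightarrow> 'b::real_normed_vector) \<Rightarrow> 'a set \<Rightarrow> bool" where
  "Ck_on 0 f S \<longleftrightarrow> continuous_on S f"
| "Ck_on (Suc k) f S \<longleftrightarrow>
     (\<forall>x\<in>S. f differentiable (at x)) \<and> (\<forall>v. Ck_on k (\<lambda>x. frechet_derivative f (at x) v) S)"

text \<open>Only used on open sets.\<close>

definition smooth_on :: "('a::real_normed_vector \<Rightarrow> 'b::real_normed_vector) \<Rightarrow> 'a set \<Rightarrow> bool" where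
  "smooth_on f S \<longleftrightarrow> (\<forall>k. Ck_on k f S)"

text \<open>A chart is a domain together with a coordinate map, whose values outside the domain are
  irrelevant.  The dimension of the manifold is that of the model space \<open>'a\<close>.\<close>

type_synonym ('m, 'a) chart = "'m set \<times> ('m \<Rightarrow> 'a)"

abbreviation cdom :: "('m, 'a) chart \<Rightarrow> 'm set" where "cdom c \<equiv> fst c"
abbreviation cmap :: "('m, 'a) chart \<Rightarrow> 'm \<Rightarrow> 'a" where "cmap c \<equiv> snd c"
abbreviation cimg :: "('m, 'a) chart \<Rightarrow> 'a set" where "cimg c \<equiv> cmap c ` cdom c"

definition is_chart :: "('m::topological_space, 'a::euclidean_space) chart \<Rightarrow> bool" where
  "is_chart c \<longleftrightarrow> open (cdom c) \<and> open (cimg c) \<and>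
     homeomorphism (cdom c) (cimg c) (cmap c) (inv_into (cdom c) (cmap c))"

definition transition :: "('m, 'a) chart \<Rightarrow> ('m, 'a) chart \<Rightarrow> 'a \<Rightarrow> 'a" where
  "transition c c' = cmap c' \<circ> inv_into (cdom c) (cmap c)"

definition smooth_compatible ::
    "('m, 'a::euclidean_space) chart \<Rightarrow> ('m, 'a) chart \<Rightarrow> bool" where
  "smooth_compatible c c' \<longleftrightarrow>
     smooth_on (transition c c') (cmap c ` (cdom c \<inter> cdom c')) \<and>
     smooth_on (transition c' c) (cmap c' ` (cdom c \<inter> cdom c'))"

text \<open>\<open>A\<close> is a maximal smooth atlas on \<open>M\<close>.\<close>

definition smooth_manifold ::
    "'m::{t2_space, second_countable_topology} set \<Rightarrow> ('m, 'a::euclidean_space) chart set \<Rightarrow> bool" where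
  "smooth_manifold M A \<longleftrightarrow>
     (\<forall>c\<in>A. is_chart c) \<and> (\<Union>c\<in>A. cdom c) = M \<and>
     (\<forall>c\<in>A. \<forall>c'\<in>A. smooth_compatible c c') \<and>
     (\<forall>c. is_chart c \<and> cdom c \<subseteq> M \<and> (\<forall>c'\<in>A. smooth_compatible c c') \<longrightarrow> c \<in> A)"

text \<open>A chart \<open>c\<close> around \<open>p\<close> identifies the tangent space at \<open>p\<close> with the model space \<open>'a\<close>.  Tangent
  vectors are given by their components in charts, and \<open>tangent_change c c' p\<close> turns components
  in \<open>c\<close> into components in \<open>c'\<close>.\<close>

definition tangent_change ::
    "('m, 'a::euclidean_space) chart \<Rightarrow> ('m, 'a) chart \<Rightarrow> 'm \<Rightarrow> 'a \<Rightarrow> 'a" where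
  "tangent_change c c' p = frechet_derivative (transition c c') (at (cmap c p))"

text \<open>Embedded submanifolds of dimension \<open>k\<close>, through slice charts.\<close>

definition submanifold ::
    "'m::topological_space set \<Rightarrow> ('m, 'a::euclidean_space) chart set \<Rightarrow> 'm set \<Rightarrow> nat \<Rightarrow> bool" where
  "submanifold M A P k \<longleftrightarrow> P \<subseteq> M \<and>
     (\<forall>p\<in>P. \<exists>c\<in>A. p \<in> cdom c \<and>
        (\<exists>S. subspace S \<and> dim S = k \<and>
             cmap c ` (P \<inter> cdom c) = cimg c \<inter> (\<lambda>s. cmap c p + s) ` S))"

text \<open>The tangent space of \<open>P\<close> at \<open>p\<close>, as a set of components in the chart \<open>c\<close>.\<close>

definition tangent_space ::
    "('m, 'a::euclidean_space) chart \<Rightarrow> 'm set \<Rightarrow> 'm \<Rightarrow> 'a set" where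
  "tangent_space c P p =
     {v. \<exists>\<sigma> \<epsilon>. \<epsilon> > 0 \<and> \<sigma> ` {-\<epsilon><..<\<epsilon>} \<subseteq> P \<inter> cdom c \<and> \<sigma> 0 = p \<and>
          smooth_on (cmap c \<circ> \<sigma>) {-\<epsilon><..<\<epsilon>} \<and>
          ((cmap c \<circ> \<sigma>) has_vector_derivative v) (at (0::real))}"


section \<open>Semi-Riemannian metrics\<close>

text \<open>\<open>g c x u v\<close> is the metric at the point with coordinates \<open>x\<close> in the chart \<open>c\<close>, applied to the
  tangent vectors with components \<open>u\<close> and \<open>v\<close> in \<open>c\<close>.\<close>

type_synonym 'a local_metric = "'a \<Rightarrow> 'a \<Rightarrow> 'a \<Rightarrow> real"

definition nondegenerate_on :: "'a::euclidean_space set \<Rightarrow> ('a \<Rightarrow> 'a \<Rightarrow> real) \<Rightarrow> bool" where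
  "nondegenerate_on W B \<longleftrightarrow> (\<forall>u\<in>W. (\<forall>v\<in>W. B u v = 0) \<longrightarrow> u = 0)"

definition semi_riemannian_manifold ::
    "'m::{t2_space, second_countable_topology} set \<Rightarrow> ('m, 'a::euclidean_space) chart set \<Rightarrow>
     (('m, 'a) chart \<Rightarrow> 'a local_metric) \<Rightarrow> bool" where
  "semi_riemannian_manifold M A g \<longleftrightarrow> smooth_manifold M A \<and>
     (\<forall>c\<in>A. \<forall>x\<in>cimg c. bilinear (g c x) \<and> (\<forall>u v. g c x u v = g c x v u) \<and>
                          nondegenerate_on UNIV (g c x)) \<and>
     (\<forall>c\<in>A. \<forall>u v. smooth_on (\<lambda>x. g c x u v) (cimg c)) \<and>
     (\<forall>c\<in>A. \<forall>c'\<in>A. \<forall>p\<in>cdom c \<inter> cdom c'. \<forall>u v.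
        g c (cmap c p) u v =
        g c' (cmap c' p) (tangent_change c c' p u) (tangent_change c c' p v)) \<and>
     (\<exists>\<nu>. \<forall>c\<in>A. \<forall>x\<in>cimg c. neg_index UNIV (g c x) = \<nu>)"

text \<open>The Christoffel map \<open>\<Gamma>\<^sub>x(u,v)\<close> of the Levi-Civita connection, from the Koszul formula for
  fields with constant components.\<close>

definition christoffel :: "'a::euclidean_space local_metric \<Rightarrow> 'a \<Rightarrow> 'a \<Rightarrow> 'a \<Rightarrow> 'a" where
  "christoffel G x u v = (THE z. \<forall>w. G x z w =
     (frechet_derivative (\<lambda>y. G y v w) (at x) u + frechet_derivative (\<lambda>y. G y u w) (at x) v
      - frechet_derivative (\<lambda>y. G y u v) (at x) w) / 2)"

definition nabla :: "'a::euclidean_space local_metric \<Rightarrow> ('a \<Rightarrow> 'a) \<Rightarrow> ('a \<Rightarrow> 'a) \<Rightarrow> 'a \<Rightarrow> 'a" where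
  "nabla G X Y x = frechet_derivative Y (at x) (X x) + christoffel G x (X x) (Y x)"

definition lie_bracket :: "('a::euclidean_space \<Rightarrow> 'a) \<Rightarrow> ('a \<Rightarrow> 'a) \<Rightarrow> 'a \<Rightarrow> 'a" where
  "lie_bracket X Y x = frechet_derivative Y (at x) (X x) - frechet_derivative X (at x) (Y x)"

text \<open>\<open>R(u,v)w\<close> with \<open>R(X,Y) = [\<nabla>\<^sub>X, \<nabla>\<^sub>Y] - \<nabla>\<^bsub>[X,Y]\<^esub>\<close>; by tensoriality any extensions of \<open>u\<close>, \<open>v\<close>, \<open>w\<close>
  may be used, and those with constant components are chosen.\<close>

definition curvature :: "'a::euclidean_space local_metric \<Rightarrow> 'a \<Rightarrow> 'a \<Rightarrow> 'a \<Rightarrow> 'a \<Rightarrow> 'a" where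
  "curvature G x u v w =
     (let X = (\<lambda>_. u); Y = (\<lambda>_. v); Z = (\<lambda>_. w)
      in nabla G X (nabla G Y Z) x - nabla G Y (nabla G X Z) x - nabla G (lie_bracket X Y) Z x)"


section \<open>Geodesics and Jacobi fields\<close>

text \<open>Curves and fields along them are parametrised by \<open>[a,b]\<close>, with one-sided derivatives at the
  end points.  The values below are meaningful at those \<open>t\<close> for which \<open>\<gamma> t\<close> lies in the domain
  of \<open>c\<close>.\<close>

definition velocity ::
    "real \<Rightarrow> real \<Rightarrow> (real \<Rightarrow> 'm) \<Rightarrow> ('m, 'a::euclidean_space) chart \<Rightarrow> real \<Rightarrow> 'a" where
  "velocity a b \<gamma> c t = vector_derivative (cmap c \<circ> \<gamma>) (at t within {a..b})"

definition cov_deriv ::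
    "(('m, 'a::euclidean_space) chart \<Rightarrow> 'a local_metric) \<Rightarrow> real \<Rightarrow> real \<Rightarrow> (real \<Rightarrow> 'm) \<Rightarrow>
     (('m, 'a) chart \<Rightarrow> real \<Rightarrow> 'a) \<Rightarrow> ('m, 'a) chart \<Rightarrow> real \<Rightarrow> 'a" where
  "cov_deriv g a b \<gamma> X c t =
     vector_derivative (X c) (at t within {a..b})
     + christoffel (g c) (cmap c (\<gamma> t)) (velocity a b \<gamma> c t) (X c t)"

definition geodesic ::
    "'m::topological_space set \<Rightarrow> ('m, 'a::euclidean_space) chart set \<Rightarrow>
     (('m, 'a) chart \<Rightarrow> 'a local_metric) \<Rightarrow> real \<Rightarrow> real \<Rightarrow> (real \<Rightarrow> 'm) \<Rightarrow> bool" where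
  "geodesic M A g a b \<gamma> \<longleftrightarrow>
     continuous_on {a..b} \<gamma> \<and> \<gamma> ` {a..b} \<subseteq> M \<and>
     (\<forall>c\<in>A. \<forall>t\<in>{a..b}. \<gamma> t \<in> cdom c \<longrightarrow>
        (cmap c \<circ> \<gamma>) differentiable (at t within {a..b}) \<and>
        velocity a b \<gamma> c differentiable (at t within {a..b}) \<and>
        cov_deriv g a b \<gamma> (velocity a b \<gamma>) c t = 0)"

definition field_along ::
    "('m, 'a::euclidean_space) chart set \<Rightarrow> real \<Rightarrow> real \<Rightarrow> (real \<Rightarrow> 'm) \<Rightarrow>
     (('m, 'a) chart \<Rightarrow> real \<Rightarrow> 'a) \<Rightarrow> bool" where
  "field_along A a b \<gamma> J \<longleftrightarrow>
     (\<forall>c\<in>A. \<forall>c'\<in>A. \<forall>t\<in>{a..b}. \<gamma> t \<in> cdom c \<inter> cdom c' \<longrightarrow>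
        J c' t = tangent_change c c' (\<gamma> t) (J c t))"

definition jacobi_field ::
    "('m, 'a::euclidean_space) chart set \<Rightarrow> (('m, 'a) chart \<Rightarrow> 'a local_metric) \<Rightarrow>
     real \<Rightarrow> real \<Rightarrow> (real \<Rightarrow> 'm) \<Rightarrow> (('m, 'a) chart \<Rightarrow> real \<Rightarrow> 'a) \<Rightarrow> bool" where
  "jacobi_field A g a b \<gamma> J \<longleftrightarrow> field_along A a b \<gamma> J \<and>
     (\<forall>c\<in>A. \<forall>t\<in>{a..b}. \<gamma> t \<in> cdom c \<longrightarrow>
        J c differentiable (at t within {a..b}) \<and>
        cov_deriv g a b \<gamma> J c differentiable (at t within {a..b}) \<and>
        cov_deriv g a b \<gamma> (cov_deriv g a b \<gamma> J) c t
        - curvature (g c) (cmap c (\<gamma> t)) (velocity a b \<gamma> c t) (J c t) (velocity a b \<gamma> c t) = 0)"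


section \<open>The Lagrangians associated with a geodesic and a submanifold\<close>

text \<open>From here on \<open>c\<close> is a chart around \<open>\<gamma> a\<close>, and the tangent space at \<open>\<gamma> a\<close> is identified with
  \<open>'a\<close> through it, so that the symplectic space is \<open>'a \<times> 'a\<close>.\<close>

definition symp_form :: "('a \<Rightarrow> 'a \<Rightarrow> real) \<Rightarrow> 'a \<times> 'a \<Rightarrow> 'a \<times> 'a \<Rightarrow> real" where
  "symp_form B = (\<lambda>(v1, w1) (v2, w2). B v2 w1 - B v1 w2)"

definition geodesic_lagrangian ::
    "('m, 'a::euclidean_space) chart set \<Rightarrow> (('m, 'a) chart \<Rightarrow> 'a local_metric) \<Rightarrow>
     real \<Rightarrow> real \<Rightarrow> (real \<Rightarrow> 'm) \<Rightarrow> ('m, 'a) chart \<Rightarrow> real \<Rightarrow> ('a \<times> 'a) set" where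
  "geodesic_lagrangian A g a b \<gamma> c t =
     {(v, w). \<exists>J. jacobi_field A g a b \<gamma> J \<and> J c a = v \<and> cov_deriv g a b \<gamma> J c a = w \<and>
                  (\<forall>c'\<in>A. \<gamma> t \<in> cdom c' \<longrightarrow> J c' t = 0)}"

definition initial_lagrangian :: "('a::euclidean_space \<times> 'a) set" where
  "initial_lagrangian = {0} \<times> UNIV"

text \<open>\<open>V\<close> is the component representation in \<open>c\<close> of a smooth vector field on a neighbourhood of \<open>p\<close> in
  \<open>M\<close> which is tangent to \<open>P\<close> at the points of \<open>P\<close>.\<close>

definition tangent_field_near ::
    "('m, 'a::euclidean_space) chart \<Rightarrow> 'm set \<Rightarrow> 'm \<Rightarrow> ('a \<Rightarrow> 'a) \<Rightarrow> bool" where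
  "tangent_field_near c P p V \<longleftrightarrow>
     (\<exists>W. open W \<and> cmap c p \<in> W \<and> W \<subseteq> cimg c \<and> smooth_on V W \<and>
          (\<forall>q\<in>P \<inter> cdom c. cmap c q \<in> W \<longrightarrow> V (cmap c q) \<in> tangent_space c P q))"

text \<open>The operator \<open>S\<close> on the tangent space of \<open>P\<close> at \<open>p\<close> representing the second fundamental form in
  the normal direction \<open>N\<close>.\<close>

definition shape_operator ::
    "(('m, 'a::euclidean_space) chart \<Rightarrow> 'a local_metric) \<Rightarrow> ('m, 'a) chart \<Rightarrow> 'm set \<Rightarrow> 'm \<Rightarrow> 'a \<Rightarrow>
     'a \<Rightarrow> 'a" where
  "shape_operator g c P p N v =
     (THE s. s \<in> tangent_space c P p \<and>
        (\<forall>V. tangent_field_near c P p V \<longrightarrow>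
           g c (cmap c p) s (V (cmap c p)) =
           g c (cmap c p) (nabla (g c) (\<lambda>_. v) V (cmap c p)) N))"

definition submanifold_lagrangian ::
    "(('m, 'a::euclidean_space) chart \<Rightarrow> 'a local_metric) \<Rightarrow> ('m, 'a) chart \<Rightarrow> 'm set \<Rightarrow> 'm \<Rightarrow> 'a \<Rightarrow>
     ('a \<times> 'a) set" where
  "submanifold_lagrangian g c P p N =
     {(v, w). v \<in> tangent_space c P p \<and>
        (\<forall>u\<in>tangent_space c P p. g c (cmap c p) (w + shape_operator g c P p N v) u = 0)}"

end

theory Submission
  imports Defs
begin

text \<open>
For a Lagrangian \<open>M\<close> transverse to \<open>L0\<close>, \<open>L1\<close> and \<open>L\<close>, write \<open>B\<close> and \<open>C\<close> for the forms of \<open>L\<close> and \<open>L1\<close>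
relative to \<open>(L0, M)\<close>; the form of \<open>L\<close> relative to \<open>(L1, M)\<close> is then \<open>B - C\<close>. Diagonalising
Kashiwara's form on \<open>L0 \<times> L1 \<times> L\<close> shows that \<open>n\<^sub>+(B) - n\<^sub>+(B - C) + n\<^sub>-(C)\<close> does not depend on \<open>M\<close>, and
subadditivity of the index puts it between \<open>0\<close> and \<open>rank C = dim L0 - dim (L0 \<inter> L1)\<close>. The difference
of the two Maslov indices of a path is the difference of the values of this function at the end
points. For \<open>L0\<close> and \<open>L\<^sub>P\<close> the rank is at most \<open>dim P\<close>.

What remains is that the path is a continuous path of Lagrangians and that \<open>L\<^sub>P\<close> is Lagrangian. The former
follows from existence of Jacobi fields with given initial data and constancy of their Wronskian,
which also yields uniqueness; the latter from the symmetry of the second fundamental form.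
\<close>

section \<open>Indices of symmetric bilinear forms\<close>

text \<open>No single \<open>M\<close> need be transverse to every Lagrangian of a path, so the
  difference of the indices is read off on short subintervals, each with its own \<open>M\<close>.
  There \<open>n_-(C)\<close> depends on \<open>M\<close> but not on the point of the path, and it
  cancels between the end points; what is left does not depend on \<open>M\<close>, which is what
  allows the contributions of neighbouring subintervals to be added. Two more obstacles shape the
  proof. The geodesic need not stay in one chart: fields along it are families of components, every
  notion has to be shown compatible with changes of charts, and Jacobi fields found on short
  intervals inside one chart have to be glued. The Christoffel map is given as the solution of a
  linear equation rather than through an inverse matrix, so its smoothness is extracted from that
  equation. The transformation laws and the symmetries of the curvature both rest on the symmetry of
  second derivatives.\<close>

lemma neg_index_attained:
  fixes W :: "'v::euclidean_space set"
  assumes "subspace W"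
  obtains U where "subspace U" "U \<subseteq> W" "\<And>x. x \<in> U \<Longrightarrow> x \<noteq> 0 \<Longrightarrow> B x x < 0" "dim U = neg_index W B"
proof -
  let ?S = "{dim U |U. subspace U \<and> U \<subseteq> W \<and> (\<forall>x\<in>U. x \<noteq> 0 \<longrightarrow> B x x < 0)}"
  have "finite ?S"
    by (rule finite_subset[of _ "{..DIM('v)}"]) (auto simp: dim_subset_UNIV)
  moreover have "?S \<noteq> {}"
  proof -
    have "dim {0::'v} \<in> ?S"
      using assms by (intro CollectI exI[of _ "{0}"]) (auto simp: subspace_0)
    then show ?thesis by blast
  qed
  ultimately have "Max ?S \<in> ?S" by (rule Max_in)
  then show thesis using that by (auto simp: neg_index_def)
qed

lemma neg_index_ge:
  fixes W :: "'v::euclidean_space set"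
  assumes "subspace U" "U \<subseteq> W" "\<And>x. x \<in> U \<Longrightarrow> x \<noteq> 0 \<Longrightarrow> B x x < 0"
  shows "dim U \<le> neg_index W B"
  unfolding neg_index_def
proof (rule Max_ge)
  show "finite {dim U |U. subspace U \<and> U \<subseteq> W \<and> (\<forall>x\<in>U. x \<noteq> 0 \<longrightarrow> B x x < 0)}"
    by (rule finite_subset[of _ "{..DIM('v)}"]) (auto simp: dim_subset_UNIV)
qed (use assms in blast)

lemma dim_Int_ge:
  fixes S T :: "'v::euclidean_space set"
  assumes "subspace S" "subspace T" "subspace W" "S \<subseteq> W" "T \<subseteq> W"
  shows "dim S + dim T \<le> dim (S \<inter> T) + dim W"
proof -
  have "dim {x + y |x y. x \<in> S \<and> y \<in> T} + dim (S \<inter> T) = dim S + dim T"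
    using assms by (intro dim_sums_Int)
  moreover have "dim {x + y |x y. x \<in> S \<and> y \<in> T} \<le> dim W"
    using assms by (intro dim_subset) (auto intro: subspace_add)
  ultimately show ?thesis by linarith
qed

lemma dim_sum_le_if_Int_trivial:
  fixes S T :: "'v::euclidean_space set"
  assumes "subspace S" "subspace T" "subspace W" "S \<subseteq> W" "T \<subseteq> W" "S \<inter> T \<subseteq> {0}"
  shows "dim S + dim T \<le> dim W"
proof -
  have "dim (S \<inter> T) = 0" using assms(6) by (simp only: dim_eq_0)
  then show ?thesis using dim_Int_ge[OF assms(1-5)] by linarith
qed

lemma subspace_bilinear_orthogonal:
  assumes "bilinear B" "subspace W"
  shows "subspace {x\<in>W. \<forall>y\<in>U. B x y = 0}"
  using assms by (auto simp: subspace_def bilinear_ladd bilinear_lmul bilinear_lzero)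

text \<open>The matrix \<open>M\<close> of \<open>B\<close> turns \<open>B\<close>-orthogonality to
  \<open>U\<close> into Euclidean orthogonality to the image of \<open>U\<close> under
  \<open>M\<close>, whose dimension is at most that of \<open>U\<close>. The inequality is stated
  for arbitrary bilinear forms because it is also used for a form that is not symmetric.\<close>

lemma dim_bilinear_orthogonal_ge:
  fixes B :: "'v::euclidean_space \<Rightarrow> 'v \<Rightarrow> real"
  assumes "bilinear B" "subspace W" "subspace U"
  shows "dim W \<le> dim {x\<in>W. \<forall>y\<in>U. B x y = 0} + dim U"
proof -
  define M where "M y = (\<Sum>b\<in>Basis. B b y *\<^sub>R b)" for y
  have linM: "linear M"
    using assms(1) unfolding M_def
    by (intro linearI) (simp_all add: bilinear_radd bilinear_rmul algebra_simps sum.distrib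
        scaleR_sum_right)
  have M: "B x y = inner (M y) x" for x y
  proof -
    have "B x y = B (\<Sum>b\<in>Basis. inner x b *\<^sub>R b) y" by (simp add: euclidean_representation)
    also have "\<dots> = (\<Sum>b\<in>Basis. inner x b * B b y)"
    proof -
      have "linear (\<lambda>x. B x y)" using assms(1) by (simp add: bilinear_def)
      have "B (\<Sum>b\<in>Basis. inner x b *\<^sub>R b) y = (\<Sum>b\<in>Basis. B (inner x b *\<^sub>R b) y)"
        by (rule linear_sum[OF \<open>linear (\<lambda>x. B x y)\<close>])
      then show ?thesis using assms(1) by (simp only: bilinear_lmul real_scaleR_def)
    qed
    finally show ?thesis by (simp add: M_def inner_sum_left inner_sum_right inner_commute mult.commute)
  qed
  let ?Z = "{z \<in> UNIV. \<forall>x\<in>M ` U. orthogonal x z}"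
  have "dim ?Z + dim (M ` U) = DIM('v)"
    using dim_subspace_orthogonal_to_vectors[of "M ` U" UNIV] linM assms
    by (simp add: linear_subspace_image)
  moreover have "dim (M ` U) \<le> dim U" by (rule dim_image_le[OF linM])
  moreover have "dim W + dim ?Z \<le> dim (W \<inter> ?Z) + DIM('v)"
    using dim_Int_ge[OF assms(2) _ subspace_UNIV, of ?Z] subspace_orthogonal_to_vectors[of "M ` U"]
        by simp
  moreover have "W \<inter> ?Z = {x\<in>W. \<forall>y\<in>U. B x y = 0}"
    by (auto simp: orthogonal_def M)
  ultimately show ?thesis by simp
qed

text \<open>A subspace on which \<open>B\<close> is nonnegative meets a negative definite one only
  in 0. The upper bounds for indices below come from exhibiting such an \<open>N\<close>.\<close>

lemma neg_index_le:
  fixes W :: "'v::euclidean_space set"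
  assumes "subspace W" "subspace N" "N \<subseteq> W" "\<And>x. x \<in> N \<Longrightarrow> B x x \<ge> 0"
  shows "neg_index W B + dim N \<le> dim W"
proof -
  obtain U where U: "subspace U" "U \<subseteq> W" "\<And>x. x \<in> U \<Longrightarrow> x \<noteq> 0 \<Longrightarrow> B x x < 0" "dim U = neg_index W B"
    using neg_index_attained[OF assms(1)] by blast
  have "U \<inter> N \<subseteq> {0}" using U(3) assms(4) by force
  then show ?thesis
    using dim_sum_le_if_Int_trivial[of U N W] U assms by auto
qed

lemma bilinear_form_add:
  fixes B :: "'v::real_vector \<Rightarrow> 'v \<Rightarrow> real"
  assumes "bilinear B"
  shows "B (x + y) (x + y) = B x x + B x y + B y x + B y y"
  using assms by (simp add: bilinear_ladd bilinear_radd)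

text \<open>\<open>N\<close> is the \<open>B\<close>-orthogonal of a negative definite
  \<open>U\<close> of maximal dimension. A vector of \<open>N\<close> with negative square could be
  added to \<open>U\<close>, against maximality. The dimension of \<open>N\<close> is bounded below
  by the count for orthogonals and above by \<open>neg_index_le\<close>.\<close>

lemma neg_index_split:
  fixes W :: "'v::euclidean_space set"
  assumes B: "bilinear B" and W: "subspace W" and sym: "\<And>x y. x \<in> W \<Longrightarrow> y \<in> W \<Longrightarrow> B x y = B y x"
  obtains U N where "subspace U" "U \<subseteq> W" "\<And>x. x \<in> U \<Longrightarrow> x \<noteq> 0 \<Longrightarrow> B x x < 0"
    "dim U = neg_index W B" "subspace N" "N \<subseteq> W" "\<And>x. x \<in> N \<Longrightarrow> B x x \<ge> 0"
    "dim N + neg_index W B = dim W" "\<And>x y. x \<in> N \<Longrightarrow> y \<in> U \<Longrightarrow> B x y = 0"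
proof -
  obtain U where U: "subspace U" "U \<subseteq> W" "\<And>x. x \<in> U \<Longrightarrow> x \<noteq> 0 \<Longrightarrow> B x x < 0" "dim U = neg_index W B"
    using neg_index_attained[OF W] by blast
  define N where "N = {x\<in>W. \<forall>y\<in>U. B x y = 0}"
  have N: "subspace N" "N \<subseteq> W" unfolding N_def using subspace_bilinear_orthogonal[OF B W] by auto
  have pos: "B x x \<ge> 0" if "x \<in> N" for x
  proof (rule ccontr)
    assume neg: "\<not> B x x \<ge> 0"
    let ?U = "{u + v |u v. u \<in> U \<and> v \<in> span {x}}"
    have sx: "span {x} \<subseteq> W" using that N W span_minimal[of "{x}" W] by blast
    have x0: "x \<noteq> 0" using neg B by (auto simp: bilinear_lzero)
    have disj: "U \<inter> span {x} \<subseteq> {0}"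
    proof
      fix y assume y: "y \<in> U \<inter> span {x}"
      then obtain k where k: "y = k *\<^sub>R x" by (auto simp: span_singleton)
      have "B x y = 0" using y that by (auto simp: N_def)
      then have "k * B x x = 0" using B by (simp add: k bilinear_rmul)
      then show "y \<in> {0}" using neg k by auto
    qed
    have "subspace ?U" using U(1) subspace_span by (rule subspace_sums)
    moreover have "?U \<subseteq> W" using U(2) sx W by (auto intro: subspace_add)
    moreover have "B z z < 0" if z: "z \<in> ?U" "z \<noteq> 0" for z
    proof -
      obtain u k where uk: "z = u + k *\<^sub>R x" "u \<in> U" using z by (auto simp: span_singleton)
      have "B x u = 0" using uk \<open>x \<in> N\<close> by (auto simp: N_def)
      moreover have "B u x = 0" using sym[of u x] \<open>x \<in> N\<close> uk U(2) calculation N by auto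
      \<comment> \<open>The mixed terms vanish because \<open>x\<close> is
        \<open>B\<close>-orthogonal to \<open>U\<close>; symmetry on \<open>W\<close> gives this on
        both sides.\<close>
      ultimately have "B z z = B u u + k * k * B x x"
        unfolding uk(1) bilinear_form_add[OF B] using B by (simp add: bilinear_lmul bilinear_rmul)
      moreover have "u \<noteq> 0 \<or> k \<noteq> 0" using uk z by auto
      moreover have "B u u \<le> 0" using U(3)[OF uk(2)] B by (cases "u = 0") (auto simp: bilinear_lzero)
      moreover have "k * k * B x x \<le> 0" using neg by (intro mult_nonneg_nonpos) auto
      moreover have "k * k * B x x < 0" if "k \<noteq> 0" using neg that
          by (intro mult_pos_neg) (auto simp: not_le zero_less_mult_iff)
      ultimately show ?thesis using U(3)[OF uk(2)] by fastforce
    qed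
    ultimately have "dim ?U \<le> neg_index W B" by (rule neg_index_ge)
    moreover have "dim ?U + dim (U \<inter> span {x}) = dim U + dim (span {x})"
      using U(1) subspace_span by (rule dim_sums_Int)
    moreover have "dim (U \<inter> span {x}) = 0" using disj by (simp add: dim_eq_0)
    moreover have "dim (span {x}) = 1" using x0 by (simp add: dim_insert)
    ultimately show False using U(4) by simp
  qed
  have "dim W \<le> dim N + dim U" unfolding N_def using B W U(1) by (rule dim_bilinear_orthogonal_ge)
  moreover have "neg_index W B + dim N \<le> dim W" using neg_index_le[OF W N pos] .
  ultimately have "dim N + neg_index W B = dim W" using U(4) by linarith
  moreover have "B x y = 0" if "x \<in> N" "y \<in> U" for x y using that by (auto simp: N_def)
  ultimately show thesis using that[OF U N pos] by blast
qed

lemma nonneg_complement: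
  fixes W :: "'v::euclidean_space set"
  assumes "bilinear B" "subspace W" "\<And>x y. x \<in> W \<Longrightarrow> y \<in> W \<Longrightarrow> B x y = B y x"
  obtains N where "subspace N" "N \<subseteq> W" "\<And>x. x \<in> N \<Longrightarrow> B x x \<ge> 0" "dim N + neg_index W B = dim W"
  by (rule neg_index_split[OF assms]) (assumption | rule that)+

text \<open>Only values on the diagonal are compared, since the index sees nothing but the quadratic
  form; this allows \<open>B'\<close> to be the Kashiwara form, which is written as a function of
  its first argument.\<close>

lemma neg_index_iso:
  fixes W :: "'v::euclidean_space set" and W' :: "'w::euclidean_space set"
  assumes f: "linear f" "inj_on f W" "f ` W = W'" and W: "subspace W"
    and B: "\<And>x. x \<in> W \<Longrightarrow> B' (f x) (f x) = B x x"
  shows "neg_index W' B' = neg_index W B"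
proof (rule antisym)
  have W': "subspace W'" using f W by (metis linear_subspace_image)
  obtain U where U: "subspace U" "U \<subseteq> W" "\<And>x. x \<in> U \<Longrightarrow> x \<noteq> 0 \<Longrightarrow> B x x < 0" "dim U = neg_index W B"
    using neg_index_attained[OF W] by blast
  have "dim (f ` U) \<le> neg_index W' B'"
  proof (rule neg_index_ge)
    show "subspace (f ` U)" using f U by (simp add: linear_subspace_image)
    show "f ` U \<subseteq> W'" using f U by auto
    fix x assume "x \<in> f ` U" "x \<noteq> 0"
    then obtain u where "u \<in> U" "x = f u" "u \<noteq> 0" using f linear_0 by blast
    then show "B' x x < 0" using U B by auto
  qed
  moreover have "inj_on f (span U)"
    unfolding span_eq_iff[THEN iffD2, OF U(1)] by (rule inj_on_subset[OF f(2) U(2)])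
  then have "dim (f ` U) = dim U" by (rule dim_image_eq[OF f(1)])
  ultimately show "neg_index W B \<le> neg_index W' B'" using U by simp
next
  have W': "subspace W'" using f W by (metis linear_subspace_image)
  obtain U where U: "subspace U" "U \<subseteq> W'" "\<And>x. x \<in> U \<Longrightarrow> x \<noteq> 0 \<Longrightarrow> B' x x < 0" "dim U = neg_index W' B'"
    using neg_index_attained[OF W'] by blast
  let ?U = "W \<inter> f -` U"
  have sub: "subspace ?U"
    using W linear_subspace_vimage[OF f(1) U(1)] by (rule subspace_inter)
  have im: "f ` ?U = U" using f U by auto
  have "dim ?U \<le> neg_index W B"
  proof (rule neg_index_ge[OF sub])
    fix x assume x: "x \<in> ?U" "x \<noteq> 0"
    then have "f x \<noteq> 0" using f W by (metis IntD1 inj_onD linear_0 subspace_0)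
    then show "B x x < 0" using x U(3)[of "f x"] B by auto
  qed auto
  moreover have "dim U \<le> dim ?U" using dim_image_le[OF f(1), of ?U] im by simp
  ultimately show "neg_index W' B' \<le> neg_index W B" using U by simp
qed

text \<open>Products of maximal negative definite subspaces give the lower bound, products of
  nonnegative complements the upper one.\<close>

lemma neg_index_Times:
  fixes W :: "'v::euclidean_space set" and W' :: "'w::euclidean_space set"
  assumes B: "bilinear B" "subspace W" "\<And>x y. x \<in> W \<Longrightarrow> y \<in> W \<Longrightarrow> B x y = B y x"
    and B': "bilinear B'" "subspace W'" "\<And>x y. x \<in> W' \<Longrightarrow> y \<in> W' \<Longrightarrow> B' x y = B' y x"
  shows "neg_index (W \<times> W') (\<lambda>(x, x') (y, y'). B x y + B' x' y') = neg_index W B + neg_index W' B'"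
    (is "neg_index ?W ?B = _")
proof (rule antisym)
  obtain N where N: "subspace N" "N \<subseteq> W" "\<And>x. x \<in> N \<Longrightarrow> B x x \<ge> 0" "dim N + neg_index W B = dim W"
    using nonneg_complement[OF B] by blast
  obtain N' where N': "subspace N'" "N' \<subseteq> W'" "\<And>x. x \<in> N' \<Longrightarrow> B' x x \<ge> 0"
      "dim N' + neg_index W' B' = dim W'"
    using nonneg_complement[OF B'] by blast
  have "neg_index ?W ?B + dim (N \<times> N') \<le> dim ?W"
    using B B' N N' by (intro neg_index_le) (auto intro: subspace_Times)
  then show "neg_index ?W ?B \<le> neg_index W B + neg_index W' B'"
    using N N' B B' by (simp add: dim_Times)
next
  obtain U where U: "subspace U" "U \<subseteq> W" "\<And>x. x \<in> U \<Longrightarrow> x \<noteq> 0 \<Longrightarrow> B x x < 0" "dim U = neg_index W B"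
    using neg_index_attained[OF B(2)] by blast
  obtain U' where U': "subspace U'" "U' \<subseteq> W'" "\<And>x. x \<in> U' \<Longrightarrow> x \<noteq> 0 \<Longrightarrow> B' x x < 0"
      "dim U' = neg_index W' B'"
    using neg_index_attained[OF B'(2)] by blast
  have "dim (U \<times> U') \<le> neg_index ?W ?B"
  proof (rule neg_index_ge)
    fix z assume "z \<in> U \<times> U'" "z \<noteq> 0"
    moreover have "B 0 0 = 0" "B' 0 0 = 0" using B B' by (simp_all add: bilinear_lzero)
    ultimately show "?B z z < 0"
      using U(3)[of "fst z"] U'(3)[of "snd z"]
      by (cases "fst z = 0"; cases "snd z = 0") (auto simp: prod_eq_iff split_beta)
  qed (use U U' in \<open>auto intro: subspace_Times\<close>)
  then show "neg_index W B + neg_index W' B' \<le> neg_index ?W ?B"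
    using U U' by (simp add: dim_Times)
qed

text \<open>Both forms are nonnegative on \<open>N \<inter> N'\<close>, whose codimension in
  \<open>W\<close> is at most the sum of the two indices.\<close>

lemma neg_index_add_le:
  fixes W :: "'v::euclidean_space set"
  assumes W: "subspace W" and B: "bilinear B" "\<And>x y. x \<in> W \<Longrightarrow> y \<in> W \<Longrightarrow> B x y = B y x"
    and B': "bilinear B'" "\<And>x y. x \<in> W \<Longrightarrow> y \<in> W \<Longrightarrow> B' x y = B' y x"
    and D: "\<And>x. x \<in> W \<Longrightarrow> D x x = B x x + B' x x"
  shows "neg_index W D \<le> neg_index W B + neg_index W B'"
proof -
  obtain N where N: "subspace N" "N \<subseteq> W" "\<And>x. x \<in> N \<Longrightarrow> B x x \<ge> 0" "dim N + neg_index W B = dim W"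
    using nonneg_complement[OF B(1) W B(2)] by blast
  obtain N' where N': "subspace N'" "N' \<subseteq> W" "\<And>x. x \<in> N' \<Longrightarrow> B' x x \<ge> 0" "dim N' + neg_index W B' = dim W"
    using nonneg_complement[OF B'(1) W B'(2)] by blast
  have "neg_index W D + dim (N \<inter> N') \<le> dim W"
  proof (rule neg_index_le[OF W])
    show "subspace (N \<inter> N')" using N N' by (simp add: subspace_inter)
    show "N \<inter> N' \<subseteq> W" using N by auto
    fix x assume "x \<in> N \<inter> N'"
    then show "D x x \<ge> 0" using D[of x] N N' by auto
  qed
  moreover have "dim N + dim N' \<le> dim (N \<inter> N') + dim W"
    using N N' W by (intro dim_Int_ge) auto
  ultimately show ?thesis using N N' by linarith
qed

lemma bilinear_uminus: "bilinear B \<Longrightarrow> bilinear (\<lambda>x y. - B x y :: real)"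
  unfolding bilinear_def by (auto intro: linear_compose_neg)

lemma pos_index_attained:
  fixes W :: "'v::euclidean_space set"
  assumes "subspace W"
  obtains U where "subspace U" "U \<subseteq> W" "\<And>x. x \<in> U \<Longrightarrow> x \<noteq> 0 \<Longrightarrow> B x x > 0" "dim U = pos_index W B"
  by (rule neg_index_attained[OF assms, of "\<lambda>x y. - B x y"]) (rule that, simp_all add: pos_index_def)

lemma nonpos_complement:
  fixes W :: "'v::euclidean_space set"
  assumes "bilinear B" "subspace W" "\<And>x y. x \<in> W \<Longrightarrow> y \<in> W \<Longrightarrow> B x y = B y x"
  obtains N where "subspace N" "N \<subseteq> W" "\<And>x. x \<in> N \<Longrightarrow> B x x \<le> 0" "dim N + pos_index W B = dim W"
proof (rule nonneg_complement[of "\<lambda>x y. - B x y" W])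
  show "bilinear (\<lambda>x y. - B x y)" using assms(1) by (rule bilinear_uminus)
qed (use assms that in \<open>auto simp: pos_index_def\<close>)

text \<open>An isotropic vector of a semidefinite form lies in its radical: otherwise the form along
  the line \<open>t x + y\<close> would be a nonconstant affine function of \<open>t\<close>, hence
  negative somewhere.\<close>

lemma bilinear_semidefinite_zero:
  fixes B :: "'v::real_vector \<Rightarrow> 'v \<Rightarrow> real"
  assumes B: "bilinear B" and "subspace N" and sym: "\<And>x y. x \<in> N \<Longrightarrow> y \<in> N \<Longrightarrow> B x y = B y x"
    and nn: "\<And>x. x \<in> N \<Longrightarrow> B x x \<ge> 0" and x: "x \<in> N" "B x x = 0" and y: "y \<in> N"
  shows "B x y = 0"
proof (rule ccontr)
  assume n: "B x y \<noteq> 0"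
  \<comment> \<open>Chosen so that \<open>2 t B(x,y) + B(y,y) = -1\<close>.\<close>
  define t where "t = - (B y y + 1) / (2 * B x y)"
  have "t *\<^sub>R x + y \<in> N" using assms by (auto simp: subspace_add subspace_scale)
  then have "0 \<le> B (t *\<^sub>R x + y) (t *\<^sub>R x + y)" by (rule nn)
  also have "\<dots> = 2 * t * B x y + B y y"
    unfolding bilinear_form_add[OF B] using B x sym[OF x(1) y] by (simp add: bilinear_lmul bilinear_rmul)
  also have "\<dots> = -1" using n by (simp add: t_def field_simps)
  finally show False by simp
qed

text \<open>For \<open>\<le>\<close>: the form is nonnegative on the sum of a maximal positive
  definite subspace and the radical. For \<open>\<ge>\<close>: \<open>W\<close> is the sum of a
  negative definite \<open>V\<close> and a nonnegative \<open>N\<close> orthogonal to it. On the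
  nonpositive complement \<open>N0\<close> inside \<open>N\<close> the form is both nonnegative and
  nonpositive, so \<open>N0\<close> lies in the radical.\<close>

lemma neg_index_sylvester:
  fixes W :: "'v::euclidean_space set"
  assumes W: "subspace W" and B: "bilinear B" and sym: "\<And>x y. x \<in> W \<Longrightarrow> y \<in> W \<Longrightarrow> B x y = B y x"
  shows "neg_index W B + pos_index W B + dim {x\<in>W. \<forall>y\<in>W. B x y = 0} = dim W"
proof (rule antisym)
  let ?R = "{x\<in>W. \<forall>y\<in>W. B x y = 0}"
  have R: "subspace ?R" using subspace_bilinear_orthogonal[OF B W] .
  obtain U where U: "subspace U" "U \<subseteq> W" "\<And>x. x \<in> U \<Longrightarrow> x \<noteq> 0 \<Longrightarrow> B x x > 0" "dim U = pos_index W B"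
    by (rule pos_index_attained[OF W, where B=B]) (assumption | rule that)+
  let ?N = "{u + v |u v. u \<in> U \<and> v \<in> ?R}"
  have N: "subspace ?N" using U(1) R by (rule subspace_sums)
  have "U \<inter> ?R \<subseteq> {0}" using U by force
  then have "dim (U \<inter> ?R) = 0" by (simp only: dim_eq_0)
  then have d: "dim ?N = dim U + dim ?R" using dim_sums_Int[OF U(1) R] by linarith
  have "neg_index W B + dim ?N \<le> dim W"
  proof (rule neg_index_le[OF W N])
    show "?N \<subseteq> W" using U W by (auto intro: subspace_add)
    fix x assume "x \<in> ?N"
    then obtain u v where uv: "x = u + v" "u \<in> U" "v \<in> ?R" by blast
    then have "B v u = 0" "B u v = 0" "B v v = 0" using sym[of u v] U by auto
    then have "B x x = B u u" using B uv by (simp add: bilinear_form_add)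
    then show "0 \<le> B x x" using U(3)[of u] uv B by (cases "u = 0") (auto simp: bilinear_lzero)
  qed
  then show "neg_index W B + pos_index W B + dim ?R \<le> dim W" using d U by simp
  obtain V N where V: "subspace V" "V \<subseteq> W" "\<And>x. x \<in> V \<Longrightarrow> x \<noteq> 0 \<Longrightarrow> B x x < 0" "dim V = neg_index W B"
    and N: "subspace N" "N \<subseteq> W" "\<And>x. x \<in> N \<Longrightarrow> B x x \<ge> 0" "dim N + neg_index W B = dim W"
    and VN: "\<And>x y. x \<in> N \<Longrightarrow> y \<in> V \<Longrightarrow> B x y = 0"
    by (rule neg_index_split[OF B W sym]) (assumption | rule that)+
  have symN: "B x y = B y x" if "x \<in> N" "y \<in> N" for x y using sym that N by auto
  obtain U0 where U0: "subspace U0" "U0 \<subseteq> N" "\<And>x. x \<in> U0 \<Longrightarrow> x \<noteq> 0 \<Longrightarrow> B x x > 0" "dim U0 = pos_index N B"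
    by (rule pos_index_attained[OF N(1), where B=B]) (assumption | rule that)+
  have dU0: "dim U0 \<le> pos_index W B"
    unfolding pos_index_def using U0 N by (intro neg_index_ge) auto
  obtain N0 where N0: "subspace N0" "N0 \<subseteq> N" "\<And>x. x \<in> N0 \<Longrightarrow> B x x \<le> 0" "dim N0 + pos_index N B = dim N"
    by (rule nonpos_complement[OF B N(1) symN]) (assumption | rule that)+
  let ?VN = "{u + v |u v. u \<in> V \<and> v \<in> N}"
  have "V \<inter> N \<subseteq> {0}" using V(3) N(3) by force
  then have "dim (V \<inter> N) = 0" by (simp only: dim_eq_0)
  then have "dim ?VN = dim V + dim N" using dim_sums_Int[OF V(1) N(1)] by linarith
  moreover have sub: "?VN \<subseteq> W" using V N W by (auto intro: subspace_add)
  ultimately have WVN: "?VN = W"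
    using V(4) N(4) W by (intro subspace_dim_equal) (auto intro: subspace_sums V N)
  have "N0 \<subseteq> ?R"
  proof
    fix x assume x: "x \<in> N0"
    then have "B x x = 0" using N0(2) N0(3)[OF x] N(3)[of x] by force
    then have xN: "B x y = 0" if "y \<in> N" for y
      using bilinear_semidefinite_zero[OF B N(1) _ N(3)] x N0 that symN by blast
    have "B x z = 0" if "z \<in> W" for z
    proof -
      obtain u v where "z = u + v" "u \<in> V" "v \<in> N" using \<open>z \<in> W\<close> WVN by blast
      then show ?thesis using xN VN[of x u] x N0 B by (auto simp: bilinear_radd)
    qed
    then show "x \<in> ?R" using x N0 N by auto
  qed
  then have "dim N0 \<le> dim ?R" by (rule dim_subset)
  then show "dim W \<le> neg_index W B + pos_index W B + dim ?R"
    using N(4) N0(4) U0(4) dU0 by linarith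
qed

section \<open>Lagrangians and the Hoermander index\<close>

lemma complementary_subspaces_sum:
  fixes S T :: "'v::euclidean_space set"
  assumes "subspace S" "subspace T" "S \<inter> T = {0}" "dim S + dim T = DIM('v)"
  obtains s t where "s \<in> S" "t \<in> T" "x = s + t"
proof -
  let ?V = "{s + t |s t. s \<in> S \<and> t \<in> T}"
  have "dim ?V + dim (S \<inter> T) = dim S + dim T" using assms(1,2) by (rule dim_sums_Int)
  moreover have "dim (S \<inter> T) = 0" using assms(3) by (simp only: dim_eq_0)
  ultimately have "dim ?V = DIM('v)" using assms(4) by linarith
  then have "span ?V = UNIV" by (simp only: dim_eq_full)
  moreover have "span ?V = ?V" by (rule span_eq_iff[THEN iffD2, OF subspace_sums[OF assms(1,2)]])
  ultimately have "x \<in> ?V" by blast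
  then show thesis using that by auto
qed

text \<open>A real vector space is not a finite union of proper subspaces. In the induction the line
  \<open>w + t v\<close> meets each old subspace at most once, as \<open>v\<close> lies in none of
  them; if \<open>v\<close> lies in the new subspace \<open>A\<close>, the line misses
  \<open>A\<close> altogether, and some \<open>t\<close> avoids the finitely many bad
  values.\<close>

lemma avoid_finite_subspaces:
  fixes X :: "'v::real_vector set"
  assumes "finite \<A>" "subspace X" "\<And>A. A \<in> \<A> \<Longrightarrow> subspace A" "\<And>A. A \<in> \<A> \<Longrightarrow> \<not> X \<subseteq> A"
  shows "\<exists>x\<in>X. \<forall>A\<in>\<A>. x \<notin> A"
  using assms(1,3,4)
proof (induction \<A> rule: finite_induct)
  case empty
  then show ?case using assms(2) subspace_0 by auto
next
  case (insert A \<A>)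
  then obtain v where v: "v \<in> X" "\<forall>A\<in>\<A>. v \<notin> A" by auto
  obtain w where w: "w \<in> X" "w \<notin> A" using insert.prems by auto
  have fin: "finite (\<Union>A'\<in>\<A>. {t. w + t *\<^sub>R v \<in> A'})"
  proof (intro finite_UN_I insert.hyps(1))
    fix A' assume A': "A' \<in> \<A>"
    have "s = t" if "w + s *\<^sub>R v \<in> A'" "w + t *\<^sub>R v \<in> A'" for s t
    proof (rule ccontr)
      assume "s \<noteq> t"
      have A's: "subspace A'" using A' insert.prems by auto
      have "(w + s *\<^sub>R v) - (w + t *\<^sub>R v) \<in> A'" using A's that by (rule subspace_diff)
      moreover have "(w + s *\<^sub>R v) - (w + t *\<^sub>R v) = (s - t) *\<^sub>R v" by (simp add: algebra_simps)
      ultimately have "inverse (s - t) *\<^sub>R ((s - t) *\<^sub>R v) \<in> A'" using A's by (metis subspace_scale)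
      then show False using v A' \<open>s \<noteq> t\<close> by simp
    qed
    then have "\<exists>t. {t. w + t *\<^sub>R v \<in> A'} \<subseteq> {t}" by blast
    then show "finite {t. w + t *\<^sub>R v \<in> A'}" using finite_subset by blast
  qed
  then obtain t where t: "t \<notin> (\<Union>A'\<in>\<A>. {t. w + t *\<^sub>R v \<in> A'})"
    using ex_new_if_finite[OF infinite_UNIV_char_0] by blast
  show ?case
  proof (cases "v \<in> A")
    case True
    then have "w + t *\<^sub>R v \<notin> A"
      using w insert.prems(1)[of A] by (metis add_diff_cancel_right' insertI1 subspace_diff
          subspace_scale)
    moreover have "w + t *\<^sub>R v \<in> X" using v w assms(2) by (simp add: subspace_add subspace_scale)
    ultimately show ?thesis using t by blast
  qed (use v in blast)
qed

section \<open>Symplectic linear algebra and common complements of Lagrangians\<close>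

locale symplectic =
  fixes \<omega> :: "'v::euclidean_space \<Rightarrow> 'v \<Rightarrow> real"
  assumes bilin: "bilinear \<omega>"
    and skew: "\<omega> x y = - \<omega> y x"
    and nondeg: "(\<And>y. \<omega> x y = 0) \<Longrightarrow> x = 0"
begin

lemma skew_self: "\<omega> x x = 0"
  using skew[of x x] by simp

lemmas omega_simps =
  bilinear_ladd[OF bilin] bilinear_radd[OF bilin] bilinear_lmul[OF bilin] bilinear_rmul[OF bilin]
  bilinear_lsub[OF bilin] bilinear_rsub[OF bilin] bilinear_lneg[OF bilin] bilinear_rneg[OF bilin]
  bilinear_lzero[OF bilin] bilinear_rzero[OF bilin]

definition orth :: "'v set \<Rightarrow> 'v set" where
  "orth U = {x. \<forall>y\<in>U. \<omega> x y = 0}"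

lemma orthD: "x \<in> orth U \<Longrightarrow> y \<in> U \<Longrightarrow> \<omega> x y = 0" "x \<in> orth U \<Longrightarrow> y \<in> U \<Longrightarrow> \<omega> y x = 0"
  using skew[of y x] by (auto simp: orth_def)

lemma subspace_orth: "subspace (orth U)"
  using subspace_bilinear_orthogonal[OF bilin subspace_UNIV] by (simp add: orth_def)

text \<open>Nondegeneracy enters in the upper bound. A vector of \<open>U\<close> that is
  symplectically orthogonal to a Euclidean complement \<open>?T\<close> of \<open>orth U\<close> is
  orthogonal to the whole space, hence 0; so \<open>dim U\<close> is at most
  \<open>dim ?T\<close>.\<close>

lemma dim_orth:
  assumes U: "subspace U"
  shows "dim (orth U) + dim U = DIM('v)"
proof (rule antisym)
  show "DIM('v) \<le> dim (orth U) + dim U"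
    using dim_bilinear_orthogonal_ge[OF bilin subspace_UNIV U] by (simp add: orth_def)
  let ?T = "{z. \<forall>x\<in>orth U. orthogonal x z}"
  have T: "subspace ?T" by (rule subspace_orthogonal_to_vectors)
  have dT: "dim ?T + dim (orth U) = DIM('v)"
    using dim_subspace_orthogonal_to_vectors[OF subspace_orth subspace_UNIV, of U] by simp
  have int: "orth U \<inter> ?T = {0}"
    using subspace_0[OF subspace_orth, of U] by (auto simp: orthogonal_def)
  have "{x\<in>U. \<forall>y\<in>?T. \<omega> x y = 0} \<subseteq> {0}"
  proof
    fix x assume x: "x \<in> {x\<in>U. \<forall>y\<in>?T. \<omega> x y = 0}"
    have "\<omega> x z = 0" for z
    proof -
      obtain s t where "s \<in> orth U" "t \<in> ?T" "z = s + t"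
        using complementary_subspaces_sum[OF subspace_orth T int, of z] dT by auto
      then show ?thesis using x orthD(2)[of s U x] by (auto simp: omega_simps)
    qed
    then show "x \<in> {0}" using nondeg by auto
  qed
  then have "dim {x\<in>U. \<forall>y\<in>?T. \<omega> x y = 0} = 0" by (simp only: dim_eq_0)
  then show "dim (orth U) + dim U \<le> DIM('v)"
    using dim_bilinear_orthogonal_ge[OF bilin U T] dT by linarith
qed

lemma dim_isotropic_le:
  assumes "subspace U" "\<And>x y. x \<in> U \<Longrightarrow> y \<in> U \<Longrightarrow> \<omega> x y = 0"
  shows "2 * dim U \<le> DIM('v)"
proof -
  have "dim U \<le> dim (orth U)" using assms(2) by (intro dim_subset) (auto simp: orth_def)
  then show ?thesis using dim_orth[OF assms(1)] by linarith
qed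

lemma orth_lagrangian:
  assumes "lagrangian \<omega> L"
  shows "orth L = L"
proof -
  have L: "subspace L" "L \<subseteq> orth L" "2 * dim L = DIM('v)" using assms
      by (auto simp: lagrangian_def orth_def)
  then have "dim (orth L) \<le> dim L" using dim_orth[OF L(1)] by linarith
  then show ?thesis using subspace_dim_equal[OF L(1) subspace_orth L(2)] by simp
qed

lemma lagrangianD:
  assumes "lagrangian \<omega> L"
  shows "subspace L" "x \<in> L \<Longrightarrow> y \<in> L \<Longrightarrow> \<omega> x y = 0" "2 * dim L = DIM('v)"
  using assms by (auto simp: lagrangian_def)

text \<open>An isotropic \<open>K\<close> meeting every \<open>L\<close> trivially is enlarged by
  one vector at a time. The new vector is taken in \<open>orth K\<close> outside finitely many
  isotropic subspaces. These have at most half the dimension of the space, whereas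
  \<open>orth K\<close> has more than half of it as long as \<open>K\<close> is not
  Lagrangian.\<close>

lemma exists_common_transverse:
  assumes "finite \<L>" "\<And>L. L \<in> \<L> \<Longrightarrow> lagrangian \<omega> L" "even DIM('v)"
  obtains M where "lagrangian \<omega> M" "\<And>L. L \<in> \<L> \<Longrightarrow> transverse L M"
proof -
  define iso where "iso K \<longleftrightarrow> subspace K \<and> (\<forall>x\<in>K. \<forall>y\<in>K. \<omega> x y = 0) \<and> (\<forall>L\<in>\<L>. L \<inter> K = {0})" for K
  have "\<exists>K. iso K \<and> dim K = m" if "2 * m \<le> DIM('v)" for m
    using that
  proof (induction m)
    case 0
    have "iso {0}" using assms(2) lagrangianD(1) by (auto simp: iso_def omega_simps subspace_0)
    then show ?case by (intro exI[of _ "{0}"]) (simp add: dim_eq_0)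
  next
    case (Suc m)
    then obtain K where K: "iso K" "dim K = m" by auto
    then have Ks: "subspace K" and Ki: "\<And>x y. x \<in> K \<Longrightarrow> y \<in> K \<Longrightarrow> \<omega> x y = 0" by (auto simp: iso_def)
    let ?X = "orth K"
    \<comment> \<open>Where the new vector \<open>v\<close> must not lie: if \<open>k + s v\<close>
      is in \<open>L\<close> with \<open>s \<noteq> 0\<close>, then, as it also lies in
      \<open>orth K\<close>, \<open>v\<close> belongs to the sum of \<open>K\<close> and
      \<open>L \<inter> orth K\<close>.\<close>
    let ?A = "\<lambda>L. {k + l |k l. k \<in> K \<and> l \<in> L \<inter> ?X}"
    have dX: "dim ?X + m = DIM('v)" using dim_orth[OF Ks] K by simp
    have "\<exists>x\<in>?X. \<forall>A\<in>insert K (?A ` \<L>). x \<notin> A"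
    proof (rule avoid_finite_subspaces)
      have sub: "subspace (?A L)" if "L \<in> \<L>" for L
        using that assms(2) Ks subspace_orth
            by (intro subspace_sums subspace_inter) (auto dest: lagrangianD)
      fix A assume A: "A \<in> insert K (?A ` \<L>)"
      then show sA: "subspace A" using Ks sub by auto
      have "2 * dim A \<le> DIM('v)"
      proof (rule dim_isotropic_le[OF sA])
        fix x y assume xy: "x \<in> A" "y \<in> A"
        from A consider "A = K" | L where "L \<in> \<L>" "A = ?A L" by auto
        then show "\<omega> x y = 0"
        proof cases
          case 1
          then show ?thesis using xy Ki by auto
        next
          case 2
          then obtain k l k' l' where *: "x = k + l" "y = k' + l'" "k \<in> K" "k' \<in> K" "l \<in> L" "l \<in> ?X"
              "l' \<in> L" "l' \<in> ?X"
            using xy by blast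
          moreover have "\<omega> l l' = 0" using assms(2)[OF 2(1)] * by (simp add: lagrangianD)
          ultimately show ?thesis using orthD[of l K k'] orthD[of l' K k] Ki by (simp add: omega_simps)
        qed
      qed
      moreover have "2 * m + 2 \<le> DIM('v)" using Suc.prems by simp
      ultimately have "dim A < dim ?X" using dX by linarith
      then show "\<not> ?X \<subseteq> A" using dim_subset[of ?X A] by auto
    next
      show "finite (insert K (?A ` \<L>))" using assms(1) by simp
    qed (rule subspace_orth)
    then obtain v where v0: "v \<in> ?X" "\<forall>A\<in>insert K (?A ` \<L>). v \<notin> A" by (rule bexE)
    have v: "v \<in> ?X" "v \<notin> K" using v0 by simp_all
    have vA: "v \<notin> ?A L" if "L \<in> \<L>" for L
      by (rule bspec[OF v0(2)]) (use that in \<open>intro insertI2 imageI\<close>)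
    let ?K = "{k + l |k l. k \<in> K \<and> l \<in> span {v}}"
    have "subspace ?K" using Ks subspace_span by (rule subspace_sums)
    moreover have "\<omega> x y = 0" if xy: "x \<in> ?K" "y \<in> ?K" for x y
    proof -
      obtain k k' s t where "x = k + s *\<^sub>R v" "y = k' + t *\<^sub>R v" "k \<in> K" "k' \<in> K"
        using xy by (auto simp: span_singleton)
      then show ?thesis using orthD[OF v(1)] Ki by (simp add: omega_simps skew_self)
    qed
    moreover have "L \<inter> ?K = {0}" if L: "L \<in> \<L>" for L
    proof -
      have Ls: "subspace L" using assms(2)[OF L] by (rule lagrangianD)
      have "x = 0" if xK: "x \<in> L" "x \<in> ?K" for x
      proof -
        obtain k s where x: "x = k + s *\<^sub>R v" "k \<in> K"
          using xK by (auto simp: span_singleton)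
        have "k \<in> ?X" using x Ki by (auto simp: orth_def)
        then have xX: "x \<in> ?X" unfolding x using v(1) subspace_orth
            by (intro subspace_add subspace_scale)
        have "s = 0"
        proof (rule ccontr)
          assume s: "s \<noteq> 0"
          have "v = (- inverse s) *\<^sub>R k + inverse s *\<^sub>R x" using s by (simp add: x algebra_simps)
          moreover have "(- inverse s) *\<^sub>R k \<in> K" using Ks x by (simp only: subspace_scale)
          moreover have "inverse s *\<^sub>R x \<in> L \<inter> ?X"
            using xX xK(1) Ls subspace_orth[of K] by (simp add: subspace_scale)
          ultimately have "v \<in> ?A L" by blast
          then show False using vA[OF L] by blast
        qed
        then show ?thesis using x xK(1) K(1) L by (auto simp: iso_def)
      qed
      moreover have "0 \<in> L \<inter> ?K" using Ls \<open>subspace ?K\<close> subspace_0 by blast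
      ultimately show ?thesis by blast
    qed
    ultimately have "iso ?K" unfolding iso_def by blast
    moreover have "dim ?K = Suc m"
    proof -
      have "K \<inter> span {v} \<subseteq> {0}"
      proof
        fix x assume "x \<in> K \<inter> span {v}"
        then obtain s where s: "x = s *\<^sub>R v" "x \<in> K" by (auto simp: span_singleton)
        then have "inverse s *\<^sub>R x \<in> K" using Ks by (simp only: subspace_scale)
        then show "x \<in> {0}" using s v(2) by (cases "s = 0") auto
      qed
      then have "dim (K \<inter> span {v}) = 0" by (simp only: dim_eq_0)
      moreover have "v \<noteq> 0" using v(2) Ks subspace_0 by auto
      then have "dim (span {v}) = 1" by (simp add: dim_insert)
      ultimately show ?thesis using dim_sums_Int[OF Ks subspace_span[of "{v}"]] K by linarith
    qed
    ultimately show ?case by blast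
  qed
  from this[of "DIM('v) div 2"] obtain M where M: "iso M" "dim M = DIM('v) div 2" by auto
  then show thesis using that[of M] assms(3) by (auto simp: iso_def lagrangian_def transverse_def)
qed

section \<open>Lagrangians as graphs over a complement, and the indices of their forms\<close>

lemma graph_map_ex1:
  assumes "lagrangian \<omega> L" "lagrangian \<omega> M" "transverse L M"
  shows "\<exists>!y. y \<in> M \<and> x + y \<in> L"
proof -
  have sub: "subspace L" "subspace M" "L \<inter> M = {0}" "dim L + dim M = DIM('v)"
    using assms lagrangianD(3)[of L] lagrangianD(3)[of M] by (auto simp: lagrangian_def transverse_def)
  obtain l m where lm: "l \<in> L" "m \<in> M" "x = l + m" by (rule complementary_subspaces_sum[OF sub])
  show ?thesis
  proof (rule ex1I[of _ "- m"])
    show "- m \<in> M \<and> x + - m \<in> L" using lm sub(2) by (simp add: subspace_neg)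
    fix y assume y: "y \<in> M \<and> x + y \<in> L"
    have "(x + y) - l \<in> L" using y lm sub by (intro subspace_diff) auto
    moreover have "(x + y) - l = y + m" by (simp add: lm)
    moreover have "y + m \<in> M" using y lm sub by (intro subspace_add) auto
    ultimately have "y + m \<in> L \<inter> M" by auto
    then show "y = - m" using sub(3) by (simp add: add_eq_0_iff2)
  qed
qed

text \<open>The whole space is the direct sum of \<open>L\<close> and \<open>M\<close>, and
  \<open>graph_map M L\<close> is minus the projection onto \<open>M\<close> along \<open>L\<close>.
  It is therefore defined everywhere, which is why \<open>L0\<close> does not occur in
  \<open>lag_form\<close>.\<close>

lemma graph_map:
  assumes "lagrangian \<omega> L" "lagrangian \<omega> M" "transverse L M"
  shows graph_map_in: "graph_map M L x \<in> M"
    and graph_map_add_in: "x + graph_map M L x \<in> L"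
    and graph_map_unique: "y \<in> M \<Longrightarrow> x + y \<in> L \<Longrightarrow> graph_map M L x = y"
  using theI'[OF graph_map_ex1[OF assms, of x]] the1_equality[OF graph_map_ex1[OF assms, of x], of y]
  unfolding graph_map_def by auto

lemma linear_graph_map:
  assumes "lagrangian \<omega> L" "lagrangian \<omega> M" "transverse L M"
  shows "linear (graph_map M L)"
proof (rule linearI)
  note L = lagrangianD(1)[OF assms(1)] and M = lagrangianD(1)[OF assms(2)]
  note g = graph_map_in[OF assms] graph_map_add_in[OF assms]
  fix x y c
  show "graph_map M L (x + y) = graph_map M L x + graph_map M L y"
  proof (rule graph_map_unique[OF assms])
    show "graph_map M L x + graph_map M L y \<in> M" using g M by (simp add: subspace_add)
    have "(x + graph_map M L x) + (y + graph_map M L y) \<in> L" by (rule subspace_add[OF L g(2) g(2)])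
    then show "x + y + (graph_map M L x + graph_map M L y) \<in> L" by (simp add: algebra_simps)
  qed
  show "graph_map M L (c *\<^sub>R x) = c *\<^sub>R graph_map M L x"
  proof (rule graph_map_unique[OF assms])
    show "c *\<^sub>R graph_map M L x \<in> M" using g M by (simp add: subspace_scale)
    have "c *\<^sub>R (x + graph_map M L x) \<in> L" using g L by (intro subspace_scale)
    then show "c *\<^sub>R x + c *\<^sub>R graph_map M L x \<in> L" by (simp add: algebra_simps)
  qed
qed

lemma bilinear_lag_form:
  assumes "lagrangian \<omega> L" "lagrangian \<omega> M" "transverse L M"
  shows "bilinear (lag_form \<omega> M L)"
  using linear_graph_map[OF assms] unfolding lag_form_def bilinear_def
  by (auto intro!: linearI simp: omega_simps linear_add linear_cmul)

lemma lag_form_sym: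
  assumes "lagrangian \<omega> L" "lagrangian \<omega> M" "transverse L M" "lagrangian \<omega> L0" "x \<in> L0" "y \<in> L0"
  shows "lag_form \<omega> M L x y = lag_form \<omega> M L y x"
proof -
  note g = graph_map_in[OF assms(1-3)] graph_map_add_in[OF assms(1-3)]
  have "\<omega> (x + graph_map M L x) (y + graph_map M L y) = 0" using g lagrangianD(2)[OF assms(1)] by blast
  moreover have "\<omega> (graph_map M L x) (graph_map M L y) = 0" using g lagrangianD(2)[OF assms(2)] by blast
  moreover have "\<omega> x y = 0" using lagrangianD(2)[OF assms(4)] assms by blast
  ultimately show ?thesis using skew[of x "graph_map M L y"] by (simp add: lag_form_def omega_simps)
qed

text \<open>The radical of the form on \<open>L0\<close> is \<open>L \<inter> L0\<close>: if
  \<open>T x\<close> is symplectically orthogonal to \<open>L0\<close>, it lies in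
  \<open>orth L0 = L0\<close> and in \<open>M\<close>, so it is 0 and \<open>x\<close> itself lies
  in \<open>L\<close>.\<close>

lemma lag_form_sylvester:
  assumes L: "lagrangian \<omega> L" and M: "lagrangian \<omega> M" and L0: "lagrangian \<omega> L0"
    and "transverse L M" "transverse L0 M"
  shows "neg_index L0 (lag_form \<omega> M L) + pos_index L0 (lag_form \<omega> M L) + dim (L \<inter> L0) = dim L0"
proof -
  note a = L M assms(4)
  have "{x\<in>L0. \<forall>y\<in>L0. lag_form \<omega> M L x y = 0} = L \<inter> L0"
  proof (intro equalityI subsetI)
    fix x assume x: "x \<in> {x\<in>L0. \<forall>y\<in>L0. lag_form \<omega> M L x y = 0}"
    then have "graph_map M L x \<in> orth L0" by (auto simp: orth_def lag_form_def)
    then have "graph_map M L x \<in> L0 \<inter> M" using orth_lagrangian[OF L0] graph_map_in[OF a] by auto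
    then have "graph_map M L x = 0" using assms(5) unfolding transverse_def by blast
    then show "x \<in> L \<inter> L0" using graph_map_add_in[OF a, of x] x by simp
  next
    fix x assume x: "x \<in> L \<inter> L0"
    then have "graph_map M L x = 0"
      using lagrangianD(1)[OF M] by (intro graph_map_unique[OF a]) (auto simp: subspace_0)
    then show "x \<in> {x\<in>L0. \<forall>y\<in>L0. lag_form \<omega> M L x y = 0}" using x
        by (auto simp: lag_form_def omega_simps)
  qed
  then show ?thesis
    using neg_index_sylvester[OF lagrangianD(1)[OF L0] bilinear_lag_form[OF a] lag_form_sym[OF a L0]]
        by simp
qed

text \<open>The quadratic form whose signature is the Kashiwara triple index; only its positive part
  is taken here. The second argument is ignored because the index depends on the quadratic form
  alone. No complement \<open>M\<close> occurs.\<close>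

definition kashiwara_index :: "'v set \<Rightarrow> 'v set \<Rightarrow> 'v set \<Rightarrow> nat" where
  "kashiwara_index L0 L1 L =
     pos_index (L0 \<times> L1 \<times> L) (\<lambda>(x0, x1, x2) _. \<omega> x0 x1 + \<omega> x1 x2 + \<omega> x2 x0)"

text \<open>In the notation of the overview this is \<open>n_+(B) - n_+(B - C) + n_-(C)\<close>: by
  \<open>kashiwara_index_eq\<close> the Kashiwara index is
  \<open>n_+(B) + n_-(C) + n_-(B - C)\<close>, and Sylvester's law on \<open>L1\<close> replaces
  \<open>n_-(B - C)\<close>. The difference of its values at two Lagrangians is an index of four
  Lagrangians of Hoermander's kind.\<close>

definition hormander_index :: "'v set \<Rightarrow> 'v set \<Rightarrow> 'v set \<Rightarrow> int" where
  "hormander_index L0 L1 L = int (kashiwara_index L0 L1 L) + int (dim (L \<inter> L1)) - int (dim L1)"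

text \<open>Moving along \<open>M\<close> identifies \<open>L0\<close> with \<open>L\<close>; the
  inverse is the same map with the roles of \<open>L0\<close> and \<open>L\<close>
  exchanged.\<close>

lemma graph_param:
  assumes "lagrangian \<omega> L" "lagrangian \<omega> M" "lagrangian \<omega> L0" "transverse L M" "transverse L0 M"
  shows "inj_on (\<lambda>u. u + graph_map M L u) L0" "(\<lambda>u. u + graph_map M L u) ` L0 = L"
proof -
  note a = assms(1,2,4) and a0 = assms(3,2,5)
  have inv: "(u + graph_map M L u) + graph_map M L0 (u + graph_map M L u) = u" if "u \<in> L0" for u
  proof -
    have "graph_map M L0 (u + graph_map M L u) = - graph_map M L u"
      using that graph_map_in[OF a, of u] lagrangianD(1)[OF assms(2)]
      by (intro graph_map_unique[OF a0]) (auto simp: subspace_neg)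
    then show ?thesis by simp
  qed
  show "inj_on (\<lambda>u. u + graph_map M L u) L0"
      by (rule inj_on_inverseI[where g = "\<lambda>x. x + graph_map M L0 x"]) (rule inv)
  show "(\<lambda>u. u + graph_map M L u) ` L0 = L"
  proof (intro equalityI subsetI)
    fix x assume x: "x \<in> L"
    let ?u = "x + graph_map M L0 x"
    have "graph_map M L ?u = - graph_map M L0 x"
      using x graph_map_in[OF a0, of x] lagrangianD(1)[OF assms(2)]
      by (intro graph_map_unique[OF a]) (auto simp: subspace_neg)
    then have "x = ?u + graph_map M L ?u" by simp
    then show "x \<in> (\<lambda>u. u + graph_map M L u) ` L0" using graph_map_add_in[OF a0] by blast
  qed (use graph_map_add_in[OF a] in auto)
qed

text \<open>Pulled back to \<open>L0\<close> along \<open>M\<close>, the form of \<open>L\<close> on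
  \<open>L1\<close> becomes the difference of the two forms on \<open>L0\<close>; the term that
  pairs two vectors of \<open>M\<close> vanishes.\<close>

lemma lag_form_change:
  assumes L: "lagrangian \<omega> L" and M: "lagrangian \<omega> M" and L0: "lagrangian \<omega> L0" and L1: "lagrangian \<omega> L1"
    and t: "transverse L M" "transverse L0 M" "transverse L1 M" and u: "u \<in> L0"
  shows "lag_form \<omega> M L (u + graph_map M L1 u) (u + graph_map M L1 u) = lag_form \<omega> M L u u - lag_form \<omega>
      M L1 u u"
proof -
  note a = L M t(1) and a1 = L1 M t(3)
  note Ms = lagrangianD(1)[OF M]
  have "graph_map M L (u + graph_map M L1 u) = graph_map M L u - graph_map M L1 u"
    using graph_map_in[OF a, of u] graph_map_in[OF a1, of u] graph_map_add_in[OF a, of u] Ms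
    by (intro graph_map_unique[OF a]) (auto simp: subspace_diff)
  moreover have "\<omega> (graph_map M L u - graph_map M L1 u) (graph_map M L1 u) = 0"
    using graph_map_in[OF a, of u] graph_map_in[OF a1, of u] Ms lagrangianD(2)[OF M]
        by (simp add: subspace_diff)
  ultimately show ?thesis by (simp add: lag_form_def omega_simps)
qed

lemma bilinear_Times_form:
  assumes "bilinear B" "bilinear B'"
  shows "bilinear (\<lambda>(x, x') (y, y'). B x y + B' x' y' :: real)"
  by (subst bilinear_def, intro conjI allI linearI)
    (auto simp: split_beta bilinear_ladd[OF assms(1)] bilinear_ladd[OF assms(2)] bilinear_radd[OF
        assms(1)]
      bilinear_radd[OF assms(2)] bilinear_lmul[OF assms(1)] bilinear_lmul[OF assms(2)]
      bilinear_rmul[OF assms(1)] bilinear_rmul[OF assms(2)] algebra_simps)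

lemma bilinear_diff: "bilinear B \<Longrightarrow> bilinear B' \<Longrightarrow> bilinear (\<lambda>x y. B x y - B' x y :: real)"
  unfolding bilinear_def by (auto intro: linear_compose_sub)

lemma linear_add_graph_map:
  assumes "lagrangian \<omega> L" "lagrangian \<omega> M" "transverse L M"
  shows "linear (\<lambda>u. u + graph_map M L u)"
  using linear_graph_map[OF assms] by (intro linear_compose_add) (auto simp: linear_id[unfolded id_def])

text \<open>On \<open>L0 \<times> L1 \<times> L\<close>, parametrised by \<open>L0\<close> along a common complement \<open>M\<close>, the substitution
  \<open>(X + Z, Y + Z, X + Y)\<close> diagonalises the Kashiwara form.\<close>

lemma kashiwara_index_eq:
  assumes L: "lagrangian \<omega> L" and M: "lagrangian \<omega> M" and L0: "lagrangian \<omega> L0" and L1: "lagrangian \<omega> L1"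
    and t: "transverse L M" "transverse L0 M" "transverse L1 M"
  shows "kashiwara_index L0 L1 L = pos_index L0 (lag_form \<omega> M L) + neg_index L0 (lag_form \<omega> M L1)
    + neg_index L0 (\<lambda>x y. lag_form \<omega> M L x y - lag_form \<omega> M L1 x y)"
proof -
  note a = L M t(1) and a1 = L1 M t(3)
  note s0 = lagrangianD(1)[OF L0] and s1 = lagrangianD(1)[OF L1] and s = lagrangianD(1)[OF L]
  let ?B = "lag_form \<omega> M L" and ?C = "lag_form \<omega> M L1"
  let ?D = "\<lambda>x y. ?B x y - ?C x y" and ?N = "\<lambda>x y. - ?B x y"
  let ?gL = "\<lambda>u. u + graph_map M L u" and ?g1 = "\<lambda>u. u + graph_map M L1 u"
  note B = bilinear_lag_form[OF a] lag_form_sym[OF a L0]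
  note C = bilinear_lag_form[OF a1] lag_form_sym[OF a1 L0]
  have D: "bilinear ?D" using B(1) C(1) by (rule bilinear_diff)
  define f where "f = (\<lambda>(X::'v, Y::'v, Z::'v). (X + Z, ?g1 (Y + Z), ?gL (X + Y)))"
  \<comment> \<open>The Kashiwara form pulls back to \<open>B(X,X) - (B - C)(Y,Y) - C(Z,Z)\<close>.
    Its negative is the block sum \<open>q\<close>, so the positive index sought is the negative
    index of \<open>q\<close>.\<close>
  define q where "q = (\<lambda>(x, x') (y, y'). ?N x y + (\<lambda>(x, x') (y, y'). ?D x y + ?C x' y') x' y')"
  have "neg_index (L0 \<times> L0 \<times> L0) q = neg_index L0 ?N + neg_index (L0 \<times> L0) (\<lambda>(x, x') (y, y'). ?D x y +
      ?C x' y')"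
    unfolding q_def
    by (rule neg_index_Times[OF bilinear_uminus[OF B(1)] s0 _ bilinear_Times_form[OF D C(1)]
        subspace_Times[OF s0 s0]])
       (auto simp: B(2) C(2))
  also have "neg_index (L0 \<times> L0) (\<lambda>(x, x') (y, y'). ?D x y + ?C x' y') = neg_index L0 ?D + neg_index L0
      ?C"
    by (rule neg_index_Times[OF D s0 _ C(1) s0]) (auto simp: B(2) C(2))
  finally have q: "neg_index (L0 \<times> L0 \<times> L0) q = pos_index L0 ?B + neg_index L0 ?D + neg_index L0 ?C"
    by (simp add: pos_index_def)
  have "neg_index (L0 \<times> L1 \<times> L) (\<lambda>z z'. - (\<lambda>(x0, x1, x2) _. \<omega> x0 x1 + \<omega> x1 x2 + \<omega> x2 x0) z z')
      = neg_index (L0 \<times> L0 \<times> L0) q"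
  proof (rule neg_index_iso[of f])
    have g: "linear ?gL" "linear ?g1" using a a1 linear_add_graph_map by auto
    show "linear f" unfolding f_def
      by (intro linearI) (auto simp: linear_add[OF linear_graph_map[OF a]] linear_add[OF
          linear_graph_map[OF a1]]
          linear_cmul[OF linear_graph_map[OF a]] linear_cmul[OF linear_graph_map[OF a1]] algebra_simps)
    note pL = graph_param[OF L M L0 t(1) t(2)] and p1 = graph_param[OF L1 M L0 t(3) t(2)]
    show "inj_on f (L0 \<times> L0 \<times> L0)"
    proof (rule inj_onI)
      fix z z' assume z: "z \<in> L0 \<times> L0 \<times> L0" "z' \<in> L0 \<times> L0 \<times> L0" "f z = f z'"
      obtain X Y Z where zz1: "z = (X, Y, Z)" by (rule prod_cases3)
      obtain X' Y' Z' where zz2: "z' = (X', Y', Z')" by (rule prod_cases3)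
      note zz = zz1 zz2
      have mem: "X \<in> L0" "Y \<in> L0" "Z \<in> L0" "X' \<in> L0" "Y' \<in> L0" "Z' \<in> L0" using z zz by auto
      have "X + Z = X' + Z'" using z(3) by (simp add: f_def zz)
      moreover have "Y + Z = Y' + Z'"
        by (rule inj_onD[OF p1(1)]) (use z(3) mem s0 in \<open>simp_all add: f_def zz subspace_add\<close>)
      moreover have "X + Y = X' + Y'"
        by (rule inj_onD[OF pL(1)]) (use z(3) mem s0 in \<open>simp_all add: f_def zz subspace_add\<close>)
      \<comment> \<open>The sums \<open>X + Z\<close>, \<open>Y + Z\<close> and \<open>X + Y\<close>
        determine \<open>2 X\<close>, \<open>2 Y\<close> and \<open>2 Z\<close>.\<close>
      ultimately have e: "(X + Z) - (Y + Z) + (X + Y) = (X' + Z') - (Y' + Z') + (X' + Y')"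
          "(Y + Z) - (X + Z) + (X + Y) = (Y' + Z') - (X' + Z') + (X' + Y')"
          "(X + Z) + (Y + Z) - (X + Y) = (X' + Z') + (Y' + Z') - (X' + Y')" by simp_all
      have "(X + Z) - (Y + Z) + (X + Y) = 2 *\<^sub>R X" "(Y + Z) - (X + Z) + (X + Y) = 2 *\<^sub>R Y"
          "(X + Z) + (Y + Z) - (X + Y) = 2 *\<^sub>R Z" for X Y Z :: 'v
        by (simp_all add: scaleR_2 algebra_simps)
      with e have "2 *\<^sub>R X = 2 *\<^sub>R X'" "2 *\<^sub>R Y = 2 *\<^sub>R Y'" "2 *\<^sub>R Z = 2 *\<^sub>R Z'" by metis+
      then show "z = z'" by (simp add: zz)
    qed
    show "f ` (L0 \<times> L0 \<times> L0) = L0 \<times> L1 \<times> L"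
    proof (intro equalityI subsetI)
      fix z assume "z \<in> f ` (L0 \<times> L0 \<times> L0)"
      then show "z \<in> L0 \<times> L1 \<times> L" using s0 graph_map_add_in[OF a] graph_map_add_in[OF a1]
        by (auto simp: f_def subspace_add)
    next
      fix z assume "z \<in> L0 \<times> L1 \<times> L"
      then obtain u v w where z: "z = (u, ?g1 v, ?gL w)" "u \<in> L0" "v \<in> L0" "w \<in> L0"
        using pL(2) p1(2) by blast
      \<comment> \<open>The solution of \<open>X + Z = u\<close>, \<open>Y + Z = v\<close>,
        \<open>X + Y = w\<close>.\<close>
      have "f ((1/2) *\<^sub>R (u - v + w), (1/2) *\<^sub>R (v + w - u), (1/2) *\<^sub>R (u + v - w)) = z"
      proof -
        have h: "(1/2) *\<^sub>R x + (1/2) *\<^sub>R y = z" if "x + y = z + z" for x y z :: 'v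
          using that by (metis scaleR_add_right scaleR_half_double)
        have "(1/2) *\<^sub>R (u - v + w) + (1/2) *\<^sub>R (u + v - w) = u"
            "(1/2) *\<^sub>R (v + w - u) + (1/2) *\<^sub>R (u + v - w) = v"
          "(1/2) *\<^sub>R (u - v + w) + (1/2) *\<^sub>R (v + w - u) = w"
          by (rule h, simp add: algebra_simps)+
        then show ?thesis unfolding f_def z(1) prod.case by simp
      qed
      moreover have "((1/2) *\<^sub>R (u - v + w), (1/2) *\<^sub>R (v + w - u), (1/2) *\<^sub>R (u + v - w)) \<in> L0 \<times> L0 \<times>
          L0"
        using z s0 by (auto intro!: subspace_scale subspace_add subspace_diff)
      ultimately show "z \<in> f ` (L0 \<times> L0 \<times> L0)" by blast
    qed
    show "subspace (L0 \<times> L0 \<times> L0)" using s0 by (intro subspace_Times)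
    fix z assume "z \<in> L0 \<times> L0 \<times> L0"
    then obtain X Y Z where z: "z = (X, Y, Z)" "X \<in> L0" "Y \<in> L0" "Z \<in> L0" by auto
    let ?b = "graph_map M L" and ?c = "graph_map M L1"
    note lin = linear_add[OF linear_graph_map[OF a]] linear_add[OF linear_graph_map[OF a1]]
    have M0: "\<omega> (?c x) (?b y) = 0" "\<omega> (?b x) (?c y) = 0" for x y
      using graph_map_in[OF a] graph_map_in[OF a1] lagrangianD(2)[OF M] by blast+
    have L00: "\<omega> x y = 0" if "x \<in> L0" "y \<in> L0" for x y using lagrangianD(2)[OF L0] that by blast
    have bs: "\<omega> (?b x) y = \<omega> (?b y) x" and cs: "\<omega> (?c x) y = \<omega> (?c y) x" if "x \<in> L0" "y \<in> L0" for x y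
      using that B(2) C(2) by (auto simp: lag_form_def)
    have sk: "\<omega> x (?b y) = - \<omega> (?b y) x" "\<omega> x (?c y) = - \<omega> (?c y) x" if "x \<in> L0" for x y
      by (rule skew)+
    have "\<omega> (X + Z) (?g1 (Y + Z)) + \<omega> (?g1 (Y + Z)) (?gL (X + Y)) + \<omega> (?gL (X + Y)) (X + Z)
        = ?B X X - ?C Z Z + ?C Y Y - ?B Y Y"
      using z bs[of X Y] bs[of X Z] bs[of Y Z] cs[of X Y] cs[of X Z] cs[of Y Z]
      by (simp add: omega_simps lin M0 L00 lag_form_def sk)
    then show "- (\<lambda>(x0, x1, x2) _. \<omega> x0 x1 + \<omega> x1 x2 + \<omega> x2 x0) (f z) (f z) = q z z"
      by (simp add: f_def q_def z)
  qed
  then show ?thesis using q unfolding kashiwara_index_def pos_index_def by simp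
qed

text \<open>The forms on \<open>L1\<close> are computed on \<open>L0\<close> as those of
  \<open>B - C\<close>. The two bounds are subadditivity of the index for
  \<open>B = (B - C) + C\<close> and for \<open>B - C = B + (-C)\<close>; the upper one uses that
  \<open>n_+(C) + n_-(C)\<close> is the rank of \<open>C\<close>. In the first equation the last
  term is the same for all \<open>L\<close>, which is what makes it useful along a path.\<close>

lemma pos_index_diff_eq:
  assumes L: "lagrangian \<omega> L" and M: "lagrangian \<omega> M" and L0: "lagrangian \<omega> L0" and L1: "lagrangian \<omega> L1"
    and t: "transverse L M" "transverse L0 M" "transverse L1 M"
  shows "int (pos_index L0 (lag_form \<omega> M L)) - int (pos_index L1 (lag_form \<omega> M L))
    = hormander_index L0 L1 L - int (neg_index L0 (lag_form \<omega> M L1))" (is ?thesis1)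
    and "0 \<le> hormander_index L0 L1 L" (is ?thesis2)
    and "hormander_index L0 L1 L \<le> int (dim L0) - int (dim (L0 \<inter> L1))" (is ?thesis3)
proof -
  note a = L M t(1) and a1 = L1 M t(3)
  note s0 = lagrangianD(1)[OF L0]
  let ?B = "lag_form \<omega> M L" and ?C = "lag_form \<omega> M L1"
  let ?D = "\<lambda>x y. ?B x y - ?C x y"
  note B = bilinear_lag_form[OF a] lag_form_sym[OF a L0]
  note C = bilinear_lag_form[OF a1] lag_form_sym[OF a1 L0]
  have D: "bilinear ?D" using B(1) C(1) by (rule bilinear_diff)
  note p1 = graph_param[OF L1 M L0 t(3) t(2)]
  have neg: "neg_index L1 ?B = neg_index L0 ?D"
    using linear_add_graph_map[OF a1] p1 s0
    by (rule neg_index_iso) (rule lag_form_change[OF L M L0 L1 t])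
  have pos: "pos_index L1 ?B = pos_index L0 ?D"
    unfolding pos_index_def using linear_add_graph_map[OF a1] p1 s0
    by (rule neg_index_iso) (simp add: lag_form_change[OF L M L0 L1 t])
  have syl: "neg_index L1 ?B + pos_index L1 ?B + dim (L \<inter> L1) = dim L1"
    by (rule lag_form_sylvester[OF L M L1 t(1) t(3)])
  have sylC: "neg_index L0 ?C + pos_index L0 ?C + dim (L1 \<inter> L0) = dim L0"
    by (rule lag_form_sylvester[OF L1 M L0 t(3) t(2)])
  note k = kashiwara_index_eq[OF assms]
  show ?thesis1 unfolding hormander_index_def using k syl neg by linarith
  have h: "hormander_index L0 L1 L = int (pos_index L0 ?B) + int (neg_index L0 ?C) - int (pos_index L0
      ?D)"
    unfolding hormander_index_def using k syl neg pos by linarith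
  have "pos_index L0 ?B \<le> pos_index L0 ?D + pos_index L0 ?C"
    unfolding pos_index_def using s0 bilinear_uminus[OF D] _ bilinear_uminus[OF C(1)]
    by (rule neg_index_add_le) (auto simp: B(2) C(2))
  then show ?thesis3 using h sylC by (simp add: Int_commute)
  have "pos_index L0 ?D \<le> pos_index L0 ?B + neg_index L0 ?C"
    unfolding pos_index_def using s0 bilinear_uminus[OF B(1)] _ C(1)
    by (rule neg_index_add_le) (auto simp: B(2) C(2))
  then show ?thesis2 using h by linarith
qed

end

section \<open>Comparison of Maslov indices\<close>

text \<open>Projections do not increase distances and fix \<open>m n\<close>, so \<open>m n\<close>
  and the projection of \<open>k\<close> onto \<open>l (y n)\<close> approach each other; in the
  limit \<open>k\<close> is its own projection onto \<open>l x\<close>.\<close>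

lemma lag_continuous_on_closed_graph:
  fixes l :: "'p::metric_space \<Rightarrow> 'v::euclidean_space set"
  assumes l: "lag_continuous_on \<omega> S l" and x: "x \<in> S" and y: "\<And>n. y n \<in> S" "y \<longlonglongrightarrow> x"
    and m: "\<And>n. m n \<in> l (y n)" "m \<longlonglongrightarrow> k"
  shows "k \<in> l x"
proof -
  have sub: "subspace (l s)" if "s \<in> S" for s using l that
      by (auto simp: lag_continuous_on_def lagrangian_def)
  have cl: "closed (l s)" "convex (l s)" "l s \<noteq> {}" if "s \<in> S" for s
    using sub[OF that] by (auto simp: closed_subspace subspace_imp_convex dest: subspace_0)
  have "continuous_on S (\<lambda>s. closest_point (l s) k)" using l by (simp add: lag_continuous_on_def)
  then have c: "(\<lambda>n. closest_point (l (y n)) k) \<longlonglongrightarrow> closest_point (l x) k"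
    using x y by (auto simp: continuous_on_sequentially comp_def)
  have d1: "(\<lambda>n. dist (m n) (closest_point (l (y n)) k)) \<longlonglongrightarrow> 0"
  proof (rule tendsto_sandwich[OF _ _ tendsto_const])
    show "\<forall>\<^sub>F n in sequentially. dist (m n) (closest_point (l (y n)) k) \<le> dist (m n) k"
    proof (intro always_eventually allI)
      fix n
      have "closest_point (l (y n)) (m n) = m n" using m(1) by (rule closest_point_self)
      then show "dist (m n) (closest_point (l (y n)) k) \<le> dist (m n) k"
        using closest_point_lipschitz[OF cl(2,1,3)[OF y(1)], of n "m n" k] by simp
    qed
    show "(\<lambda>n. dist (m n) k) \<longlonglongrightarrow> 0" by (rule tendsto_dist_iff[THEN iffD1, OF m(2)])
  qed simp
  have d2: "(\<lambda>n. dist (m n) (closest_point (l (y n)) k)) \<longlonglongrightarrow> dist k (closest_point (l x) k)"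
    using m(2) c by (rule tendsto_dist)
  have "dist k (closest_point (l x) k) = 0" by (rule LIMSEQ_unique[OF d2 d1])
  then show ?thesis using closest_point_in_set[OF cl(1,3)[OF x], of k] by simp
qed

text \<open>Otherwise there are unit vectors in \<open>l (y n) \<inter> M\<close> with
  \<open>y n\<close> tending to \<open>x\<close>. A limit point of them is a unit vector that lies
  in \<open>M\<close> and, by the closed graph, in \<open>l x\<close>.\<close>

lemma transverse_open:
  fixes l :: "'p::metric_space \<Rightarrow> 'v::euclidean_space set"
  assumes l: "lag_continuous_on \<omega> S l" and x: "x \<in> S" and M: "subspace M" and t: "transverse (l x) M"
  obtains d where "d > 0" "\<And>y. y \<in> S \<Longrightarrow> dist y x < d \<Longrightarrow> transverse (l y) M"
proof (rule ccontr)
  note obt = that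
  assume nt: "\<not> thesis"
  have no: "\<exists>y\<in>S. dist y x < d \<and> \<not> transverse (l y) M" if "d > 0" for d
    using obt[of d] that nt by blast
  have sub: "subspace (l s)" if "s \<in> S" for s using l that
      by (auto simp: lag_continuous_on_def lagrangian_def)
  have "\<exists>y m. y \<in> S \<and> dist y x < inverse (real (Suc n)) \<and> m \<in> l y \<inter> M \<and> norm m = 1" for n
  proof -
    obtain y where y: "y \<in> S" "dist y x < inverse (real (Suc n))" "\<not> transverse (l y) M"
      using no[of "inverse (real (Suc n))"] by auto
    have s: "subspace (l y \<inter> M)" using sub[OF y(1)] M by (rule subspace_inter)
    then obtain m where m: "m \<in> l y \<inter> M" "m \<noteq> 0" using y(3) subspace_0 unfolding transverse_def by blast
    have "inverse (norm m) *\<^sub>R m \<in> l y \<inter> M" using s m(1) by (rule subspace_scale)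
    moreover have "norm (inverse (norm m) *\<^sub>R m) = 1" using m(2) by simp
    ultimately show ?thesis using y by blast
  qed
  then obtain y m where ym: "\<And>n. y n \<in> S" "\<And>n. dist (y n) x < inverse (real (Suc n))"
      "\<And>n. m n \<in> l (y n) \<inter> M" "\<And>n. norm (m n) = 1"
    by metis
  have yx: "y \<longlonglongrightarrow> x"
    by (rule tendsto_dist_iff[THEN iffD2], rule tendsto_sandwich[OF _ _ tendsto_const
        LIMSEQ_inverse_real_of_nat])
      (use ym(2) in \<open>auto intro!: always_eventually less_imp_le\<close>)
  have "\<forall>n. m n \<in> sphere 0 1" using ym(4) by simp
  then obtain k r where k: "k \<in> sphere 0 1" "strict_mono r" "(m \<circ> r) \<longlonglongrightarrow> k"
    by (rule seq_compactE[OF compact_sphere[of "0::'v" 1, unfolded compact_eq_seq_compact_metric]])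
  have "k \<in> l x"
    by (rule lag_continuous_on_closed_graph[OF l x _ LIMSEQ_subseq_LIMSEQ[OF yx k(2)] _ k(3)])
      (use ym in auto)
  moreover have "k \<in> M"
    by (rule closed_sequentially[OF closed_subspace[OF M] _ k(3)]) (use ym in auto)
  ultimately have "k \<in> {0}" using t unfolding transverse_def by blast
  then show False using k(1) by simp
qed

lemma lag_continuous_on_subset: "lag_continuous_on \<omega> S l \<Longrightarrow> T \<subseteq> S \<Longrightarrow> lag_continuous_on \<omega> T l"
  unfolding lag_continuous_on_def by (auto intro: continuous_on_subset)

lemma is_maslov_index_concat:
  assumes "is_maslov_index \<omega> L \<mu>" "a \<le> c" "c \<le> b" "lag_continuous_on \<omega> {a..b} l"
  shows "\<mu> a b l = \<mu> a c l + \<mu> c b l"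
proof -
  note h = assms(1)[unfolded is_maslov_index_def, THEN conjunct2, THEN conjunct1,
    THEN spec[of _ a], THEN spec[of _ c], THEN spec[of _ b], THEN spec[of _ l]]
  show ?thesis by (rule h[THEN mp, OF assms(2), THEN mp, OF assms(3), THEN mp, OF assms(4)])
qed

lemma is_maslov_index_transverse:
  assumes "is_maslov_index \<omega> L0 \<mu>" "a \<le> b" "lag_continuous_on \<omega> {a..b} l"
    "lagrangian \<omega> L1" "transverse L0 L1" "\<forall>t\<in>{a..b}. transverse (l t) L1"
  shows "\<mu> a b l = int (pos_index L0 (lag_form \<omega> L1 (l b))) - int (pos_index L0 (lag_form \<omega> L1 (l a)))"
proof -
  note h = assms(1)[unfolded is_maslov_index_def, THEN conjunct2, THEN conjunct2,
    THEN spec[of _ a], THEN spec[of _ b], THEN spec[of _ l], THEN spec[of _ L1]]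
  show ?thesis
    by (rule h[THEN mp, OF assms(2), THEN mp, OF assms(3), THEN mp, OF assms(4), THEN mp, OF assms(5),
        THEN mp, OF assms(6)])
qed

context symplectic begin

lemma exists_common_transverse3:
  assumes "lagrangian \<omega> L0" "lagrangian \<omega> L1" "lagrangian \<omega> L"
  obtains M where "lagrangian \<omega> M" "transverse L0 M" "transverse L1 M" "transverse L M"
proof (rule exists_common_transverse[of "{L0, L1, L}"])
  show "even DIM('v)" using lagrangianD(3)[OF assms(1)] by (metis dvd_triv_left)
  show "lagrangian \<omega> K" if "K \<in> {L0, L1, L}" for K using that assms by auto
  show thesis if "lagrangian \<omega> M" "\<And>K. K \<in> {L0, L1, L} \<Longrightarrow> transverse K M" for M
    using \<open>\<And>M. lagrangian \<omega> M \<Longrightarrow> transverse L0 M \<Longrightarrow> transverse L1 M \<Longrightarrow> transverse L M \<Longrightarrow> thesis\<close>[of M] that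
        by simp
qed simp

text \<open>Near each point of the path one \<open>M\<close> is transverse to \<open>L0\<close>,
  \<open>L1\<close> and all Lagrangians met, and the transversal clause gives both indices.
  \<open>Bolzano\<close> passes from short subintervals to the whole interval by additivity.\<close>

lemma maslov_difference:
  assumes L0: "lagrangian \<omega> L0" and L1: "lagrangian \<omega> L1"
    and \<mu>: "is_maslov_index \<omega> L0 \<mu>0" "is_maslov_index \<omega> L1 \<mu>1"
    and st: "s \<le> t" and l: "lag_continuous_on \<omega> {s..t} l"
  shows "\<mu>0 s t l - \<mu>1 s t l = hormander_index L0 L1 (l t) - hormander_index L0 L1 (l s)"
proof -
  have lag: "lagrangian \<omega> (l y)" if "y \<in> {s..t}" for y using l that by (simp add: lag_continuous_on_def)
  \<comment> \<open>The principle behind \<open>Bolzano\<close> quantifies over all pairs of reals,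
    hence the guard restricting \<open>Q\<close> to subintervals of \<open>[s,t]\<close>.\<close>
  define Q where "Q u v \<longleftrightarrow> (s \<le> u \<and> u \<le> v \<and> v \<le> t \<longrightarrow>
    \<mu>0 u v l - \<mu>1 u v l = hormander_index L0 L1 (l v) - hormander_index L0 L1 (l u))" for u v
  from st have "Q s t"
  proof (induction rule: Bolzano)
    case (trans u w v)
    show ?case unfolding Q_def
    proof
      assume *: "s \<le> u \<and> u \<le> v \<and> v \<le> t"
      then have c: "lag_continuous_on \<omega> {u..v} l" by (intro lag_continuous_on_subset[OF l]) auto
      have "\<mu>0 u v l = \<mu>0 u w l + \<mu>0 w v l" "\<mu>1 u v l = \<mu>1 u w l + \<mu>1 w v l"
        using is_maslov_index_concat[OF \<mu>(1) trans(3,4) c] is_maslov_index_concat[OF \<mu>(2) trans(3,4) c]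
            by auto
      then show "\<mu>0 u v l - \<mu>1 u v l = hormander_index L0 L1 (l v) - hormander_index L0 L1 (l u)"
        using trans * unfolding Q_def by auto
    qed
  next
    case (local x)
    then have x: "x \<in> {s..t}" by simp
    obtain M where M: "lagrangian \<omega> M" "transverse L0 M" "transverse L1 M" "transverse (l x) M"
      by (rule exists_common_transverse3[OF L0 L1 lag[OF x]])
    obtain d where d: "d > 0" "\<And>y. y \<in> {s..t} \<Longrightarrow> dist y x < d \<Longrightarrow> transverse (l y) M"
      by (rule transverse_open[OF l x lagrangianD(1)[OF M(1)] M(4)]) (rule that)
    have "Q u v" if uv: "u \<le> x" "x \<le> v" "v - u < d" for u v
      unfolding Q_def
    proof
      assume *: "s \<le> u \<and> u \<le> v \<and> v \<le> t"
      have t: "transverse (l y) M" if "y \<in> {u..v}" for y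
        by (rule d(2)) (use that uv * in \<open>auto simp: dist_real_def\<close>)
      have uv': "u \<le> v" using * by simp
      have cont: "lag_continuous_on \<omega> {u..v} l" using * by (intro lag_continuous_on_subset[OF l]) auto
      have "\<forall>y\<in>{u..v}. transverse (l y) M" using t by blast
      note m = is_maslov_index_transverse[OF \<mu>(1) uv' cont M(1) M(2) this]
        is_maslov_index_transverse[OF \<mu>(2) uv' cont M(1) M(3) this]
      \<comment> \<open>The last term does not involve \<open>y\<close>, so it cancels between
        \<open>u\<close> and \<open>v\<close>.\<close>
      have h: "int (pos_index L0 (lag_form \<omega> M (l y))) - int (pos_index L1 (lag_form \<omega> M (l y)))
          = hormander_index L0 L1 (l y) - int (neg_index L0 (lag_form \<omega> M L1))" if "y \<in> {u, v}" for y
        by (rule pos_index_diff_eq(1)[OF _ M(1) L0 L1 _ M(2) M(3)]) (use that lag t * in auto)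
      from h[of u] h[of v] m show "\<mu>0 u v l - \<mu>1 u v l = hormander_index L0 L1 (l v) - hormander_index
          L0 L1 (l u)" by simp
    qed
    then show ?case using d(1) by blast
  qed
  then show ?thesis using st by (simp add: Q_def)
qed

lemma hormander_index_bounds:
  assumes "lagrangian \<omega> L0" "lagrangian \<omega> L1" "lagrangian \<omega> L"
  shows "0 \<le> hormander_index L0 L1 L" "hormander_index L0 L1 L \<le> int (dim L0) - int (dim (L0 \<inter> L1))"
proof -
  obtain M where M: "lagrangian \<omega> M" "transverse L0 M" "transverse L1 M" "transverse L M"
    by (rule exists_common_transverse3[OF assms])
  show "0 \<le> hormander_index L0 L1 L" "hormander_index L0 L1 L \<le> int (dim L0) - int (dim (L0 \<inter> L1))"
    using pos_index_diff_eq(2,3)[OF assms(3) M(1) assms(1,2) M(4,2,3)] by auto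
qed

text \<open>Two values in an interval \<open>[0,r]\<close> differ by at most \<open>r\<close>;
  estimating each value by its absolute value would give no better than \<open>2 r\<close>.\<close>

lemma maslov_difference_bound:
  assumes "lagrangian \<omega> L0" "lagrangian \<omega> L1"
    and "is_maslov_index \<omega> L0 \<mu>0" "is_maslov_index \<omega> L1 \<mu>1"
    and "s \<le> t" "lag_continuous_on \<omega> {s..t} l"
  shows "\<bar>\<mu>0 s t l - \<mu>1 s t l\<bar> \<le> int (dim L0) - int (dim (L0 \<inter> L1))"
proof -
  have "lagrangian \<omega> (l s)" "lagrangian \<omega> (l t)" using assms(5,6) by (auto simp: lag_continuous_on_def)
  then show ?thesis
    using maslov_difference[OF assms] hormander_index_bounds[OF assms(1,2)] by (smt (verit))
qed

end

section \<open>Smooth maps\<close>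

lemma frechet_derivative_cong_open:
  assumes "open S" "x \<in> S" "\<And>y. y \<in> S \<Longrightarrow> f y = g y"
  shows "frechet_derivative f (at x) = frechet_derivative g (at x)"
proof -
  have "(f has_derivative D) (at x) \<longleftrightarrow> (g has_derivative D) (at x)" for D
    using has_derivative_transform_within_open[OF _ assms(1,2), of f D UNIV g]
      has_derivative_transform_within_open[OF _ assms(1,2), of g D UNIV f] assms(3) by metis
  then show ?thesis unfolding frechet_derivative_def by presburger
qed

lemma frechet_derivativeI: "(f has_derivative D) (at x) \<Longrightarrow> frechet_derivative f (at x) = D"
  by (metis frechet_derivative_at)

lemma differentiable_cong_open:
  assumes "open S" "x \<in> S" "\<And>y. y \<in> S \<Longrightarrow> f y = g y" "f differentiable (at x)"
  shows "g differentiable (at x)"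
  using assms(4) has_derivative_transform_within_open[OF _ assms(1,2), of f _ UNIV g] assms(3)
  unfolding differentiable_def by blast

lemma Ck_on_cong:
  assumes "open S" "\<And>x. x \<in> S \<Longrightarrow> f x = g x" "Ck_on k f S"
  shows "Ck_on k g S"
  using assms(2,3)
proof (induction k arbitrary: f g)
  case 0
  then show ?case using continuous_on_eq[of S f g] by auto
next
  case (Suc k)
  have "Ck_on k (\<lambda>x. frechet_derivative g (at x) v) S" for v
  proof (rule Suc.IH)
    show "frechet_derivative f (at x) v = frechet_derivative g (at x) v" if "x \<in> S" for x
      by (rule fun_cong[OF frechet_derivative_cong_open[OF assms(1) that Suc.prems(1)]])
    show "Ck_on k (\<lambda>x. frechet_derivative f (at x) v) S" using Suc.prems(2) by simp
  qed
  moreover have "g differentiable (at x)" if "x \<in> S" for x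
    using differentiable_cong_open[OF assms(1) that Suc.prems(1)] Suc.prems(2) that by auto
  ultimately show ?case by simp
qed

lemma Ck_on_subset: "Ck_on k f S \<Longrightarrow> T \<subseteq> S \<Longrightarrow> Ck_on k f T"
  by (induction k arbitrary: f) (auto intro: continuous_on_subset)

lemma Ck_on_Suc_imp: "Ck_on (Suc k) f S \<Longrightarrow> Ck_on k f S"
proof (induction k arbitrary: f)
  case 0
  then have "f differentiable (at x within S)" if "x \<in> S" for x
    using that by (auto intro: differentiable_at_withinI)
  then show ?case using differentiable_imp_continuous_on[of f S] by (auto simp: differentiable_on_def)
next
  case (Suc k)
  have "Ck_on (Suc k) (\<lambda>x. frechet_derivative f (at x) v) S" for v
    using Suc.prems unfolding Ck_on.simps(2)[of "Suc k"] by blast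
  then have "\<forall>v. Ck_on k (\<lambda>x. frechet_derivative f (at x) v) S" using Suc.IH by blast
  moreover have "\<forall>x\<in>S. f differentiable (at x)"
    using Suc.prems unfolding Ck_on.simps(2)[of "Suc k"] by blast
  ultimately show ?case unfolding Ck_on.simps(2) by blast
qed

lemma Ck_on_SucI:
  assumes "open S" "\<And>x. x \<in> S \<Longrightarrow> (f has_derivative D x) (at x)" "\<And>v. Ck_on k (\<lambda>x. D x v) S"
  shows "Ck_on (Suc k) f S"
proof -
  have "frechet_derivative f (at x) = D x" if "x \<in> S" for x
    using assms(2)[OF that] by (rule frechet_derivativeI)
  then have "Ck_on k (\<lambda>x. frechet_derivative f (at x) v) S" for v
    by (intro Ck_on_cong[OF assms(1) _ assms(3)[of v]]) simp
  then show ?thesis using assms(2) by (auto simp: differentiable_def)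
qed

lemma Ck_on_SucD:
  assumes "Ck_on (Suc k) f S"
  shows "x \<in> S \<Longrightarrow> (f has_derivative frechet_derivative f (at x)) (at x)"
    and "Ck_on k (\<lambda>x. frechet_derivative f (at x) v) S"
  using assms frechet_derivative_works by auto

lemma Ck_on_const: "Ck_on k (\<lambda>x. c) S"
  by (induction k arbitrary: c) auto

lemma Ck_on_bounded_linear_compose:
  assumes "open S" "bounded_linear L" "Ck_on k f S"
  shows "Ck_on k (\<lambda>x. L (f x)) S"
  using assms(3)
proof (induction k arbitrary: f)
  case 0
  then show ?case using bounded_linear.continuous_on[OF assms(2)] by simp
next
  case (Suc k)
  show ?case
  proof (rule Ck_on_SucI[OF assms(1)])
    show "((\<lambda>x. L (f x)) has_derivative (\<lambda>v. L (frechet_derivative f (at x) v))) (at x)" if "x \<in> S" for x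
      using bounded_linear.has_derivative[OF assms(2) Ck_on_SucD(1)[OF Suc.prems that]] .
    show "Ck_on k (\<lambda>x. L (frechet_derivative f (at x) v)) S" for v
      by (rule Suc.IH[OF Ck_on_SucD(2)[OF Suc.prems]])
  qed
qed

lemma Ck_on_add:
  assumes "open S" "Ck_on k f S" "Ck_on k g S"
  shows "Ck_on k (\<lambda>x. f x + g x) S"
  using assms(2,3)
proof (induction k arbitrary: f g)
  case 0
  then show ?case by (auto intro: continuous_intros)
next
  case (Suc k)
  show ?case
    by (rule Ck_on_SucI[OF assms(1) has_derivative_add[OF Ck_on_SucD(1)[OF Suc.prems(1)]
        Ck_on_SucD(1)[OF Suc.prems(2)]]])
      (auto intro!: Suc.IH Ck_on_SucD(2) Suc.prems)
qed

lemma Ck_on_sum: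
  assumes "open S" "\<And>i. i \<in> I \<Longrightarrow> Ck_on k (f i) S"
  shows "Ck_on k (\<lambda>x. \<Sum>i\<in>I. f i x) S"
  using assms(2)
proof (induction I rule: infinite_finite_induct)
  case (insert i I)
  then show ?case using Ck_on_add[OF assms(1), of k "f i" "\<lambda>x. \<Sum>i\<in>I. f i x"] by simp
qed (simp_all add: Ck_on_const)

lemma Ck_on_scaleR:
  fixes f :: "_ \<Rightarrow> real"
  assumes "open S" "Ck_on k f S" "Ck_on k g S"
  shows "Ck_on k (\<lambda>x. f x *\<^sub>R g x) S"
  using assms(2,3)
proof (induction k arbitrary: f g)
  case 0
  then show ?case by (auto intro: continuous_intros)
next
  case (Suc k)
  show ?case
    by (rule Ck_on_SucI[OF assms(1) has_derivative_scaleR[OF Ck_on_SucD(1)[OF Suc.prems(1)]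
        Ck_on_SucD(1)[OF Suc.prems(2)]]])
      (assumption | intro Ck_on_add[OF assms(1)] Suc.IH Ck_on_SucD(2)[OF Suc.prems(1)] Ck_on_SucD(2)[OF
          Suc.prems(2)]
        Ck_on_Suc_imp[OF Suc.prems(1)] Ck_on_Suc_imp[OF Suc.prems(2)])+
qed

lemma linear_frechet_derivative: "f differentiable (at x) \<Longrightarrow> linear (frechet_derivative f (at x))"
  using frechet_derivative_works has_derivative_linear by blast

lemma linear_euclidean_expand:
  fixes L :: "'a::euclidean_space \<Rightarrow> 'b::real_vector"
  assumes "linear L"
  shows "L y = (\<Sum>b\<in>Basis. (y \<bullet> b) *\<^sub>R L b)"
proof -
  have "L y = L (\<Sum>b\<in>Basis. (y \<bullet> b) *\<^sub>R b)" by (simp add: euclidean_representation)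
  also have "\<dots> = (\<Sum>b\<in>Basis. L ((y \<bullet> b) *\<^sub>R b))" by (rule linear_sum[OF assms])
  also have "\<dots> = (\<Sum>b\<in>Basis. (y \<bullet> b) *\<^sub>R L b)" by (simp only: linear_cmul[OF assms])
  finally show ?thesis .
qed

text \<open>Regularity of a family of linear maps is known vector by vector, as in
  \<open>Ck_on\<close> itself. Expansion in the basis reduces the application to a variable vector
  to products with scalar functions.\<close>

lemma Ck_on_linear_apply:
  fixes y :: "'x::real_normed_vector \<Rightarrow> 'a::euclidean_space"
  assumes S: "open S" and lin: "\<And>x. x \<in> S \<Longrightarrow> linear (F x)"
    and F: "\<And>b. b \<in> Basis \<Longrightarrow> Ck_on k (\<lambda>x. F x b) S" and y: "Ck_on k y S"
  shows "Ck_on k (\<lambda>x. F x (y x)) S"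
proof (rule Ck_on_cong[OF S])
  show "(\<Sum>b\<in>Basis. (y x \<bullet> b) *\<^sub>R F x b) = F x (y x)" if "x \<in> S" for x
    using linear_euclidean_expand[OF lin[OF that], of "y x"] by simp
  show "Ck_on k (\<lambda>x. \<Sum>b\<in>Basis. (y x \<bullet> b) *\<^sub>R F x b) S"
    by (intro Ck_on_sum Ck_on_scaleR S F Ck_on_bounded_linear_compose[OF S bounded_linear_inner_left y])
qed

text \<open>By the chain rule the derivative is a linear family, composed with \<open>g\<close>,
  applied to a function of class \<open>k\<close>; the induction runs through
  \<open>Ck_on_linear_apply\<close>.\<close>

lemma Ck_on_compose:
  fixes f :: "'b::euclidean_space \<Rightarrow> 'c::real_normed_vector"
  assumes S: "open S" and T: "open T" and gS: "g ` S \<subseteq> T" and "Ck_on k f T" "Ck_on k g S"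
  shows "Ck_on k (\<lambda>x. f (g x)) S"
  using assms(4,5)
proof (induction k arbitrary: f)
  case 0
  then show ?case using gS by (auto intro: continuous_on_compose2)
next
  case (Suc k)
  show ?case
  proof (rule Ck_on_SucI[OF S])
    fix x assume x: "x \<in> S"
    then have "g x \<in> T" using gS by auto
    from diff_chain_at[OF Ck_on_SucD(1)[OF Suc.prems(2) x] Ck_on_SucD(1)[OF Suc.prems(1) this]]
    show "((\<lambda>x. f (g x)) has_derivative
        (\<lambda>v. frechet_derivative f (at (g x)) (frechet_derivative g (at x) v))) (at x)"
      by (simp add: comp_def)
  next
    fix v
    show "Ck_on k (\<lambda>x. frechet_derivative f (at (g x)) (frechet_derivative g (at x) v)) S"
    proof (rule Ck_on_linear_apply[OF S])
      show "linear (frechet_derivative f (at (g x)))" if "x \<in> S" for x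
        using Suc.prems(1) gS that by (intro linear_frechet_derivative) auto
      show "Ck_on k (\<lambda>x. frechet_derivative f (at (g x)) b) S" for b
        by (rule Suc.IH[OF Ck_on_SucD(2)[OF Suc.prems(1)] Ck_on_Suc_imp[OF Suc.prems(2)]])
      show "Ck_on k (\<lambda>x. frechet_derivative g (at x) v) S" by (rule Ck_on_SucD(2)[OF Suc.prems(2)])
    qed
  qed
qed

lemma smooth_on_has_derivative:
  "smooth_on f S \<Longrightarrow> x \<in> S \<Longrightarrow> (f has_derivative frechet_derivative f (at x)) (at x)"
  using Ck_on_SucD(1)[of 0 f S x] by (simp add: smooth_on_def del: Ck_on.simps)

lemma smooth_on_differentiable: "smooth_on f S \<Longrightarrow> x \<in> S \<Longrightarrow> f differentiable (at x)"
  using smooth_on_has_derivative differentiable_def by blast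

lemma smooth_on_frechet_derivative:
  "smooth_on f S \<Longrightarrow> smooth_on (\<lambda>x. frechet_derivative f (at x) v) S"
  using Ck_on_SucD(2)[of _ f S v] by (simp add: smooth_on_def del: Ck_on.simps)

lemma smooth_on_continuous_on: "smooth_on f S \<Longrightarrow> continuous_on S f"
  unfolding smooth_on_def by (metis Ck_on.simps(1))

lemma smooth_on_subset: "smooth_on f S \<Longrightarrow> T \<subseteq> S \<Longrightarrow> smooth_on f T"
  unfolding smooth_on_def using Ck_on_subset by blast

lemma smooth_on_cong: "open S \<Longrightarrow> (\<And>x. x \<in> S \<Longrightarrow> f x = g x) \<Longrightarrow> smooth_on f S \<Longrightarrow> smooth_on g S"
  unfolding smooth_on_def using Ck_on_cong by blast

lemma smooth_on_compose:
  fixes f :: "'b::euclidean_space \<Rightarrow> 'c::real_normed_vector"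
  shows "open S \<Longrightarrow> open T \<Longrightarrow> g ` S \<subseteq> T \<Longrightarrow> smooth_on f T \<Longrightarrow> smooth_on g S \<Longrightarrow> smooth_on (\<lambda>x. f (g x)) S"
  unfolding smooth_on_def using Ck_on_compose by blast

lemma smooth_on_affine:
  fixes L :: "'a::real_normed_vector \<Rightarrow> 'b::real_normed_vector"
  assumes "open S" "bounded_linear L"
  shows "smooth_on (\<lambda>x. p + L x) S"
  unfolding smooth_on_def
proof
  fix k
  have d: "((\<lambda>x. p + L x) has_derivative L) (at x)" for x
    using bounded_linear_imp_has_derivative[OF assms(2)] by (auto intro!: derivative_eq_intros)
  show "Ck_on k (\<lambda>x. p + L x) S"
  proof (cases k)
    case 0
    then show ?thesis using d has_derivative_continuous_on[of S "\<lambda>x. p + L x" "\<lambda>_. L"]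
      by (auto intro: has_derivative_at_withinI)
  qed (auto intro!: Ck_on_SucI[OF assms(1) d] Ck_on_const simp del: Ck_on.simps)
qed

text \<open>The second difference is symmetric in \<open>u\<close> and \<open>v\<close>, whereas its
  limit is expressed by differentiating along \<open>u\<close> and then along \<open>v\<close>; this
  is the source of the symmetry of second derivatives. The mean value theorem in the direction
  \<open>u\<close>, applied to \<open>h\<close>, leaves only the differentiability of the
  \<open>u\<close>-derivative at the single point \<open>x\<close>.\<close>

lemma second_difference:
  fixes f :: "'a::real_normed_vector \<Rightarrow> real"
  assumes S: "open S" "x \<in> S" and f: "\<And>y. y \<in> S \<Longrightarrow> (f has_derivative f' y) (at y)"
    and g: "((\<lambda>y. f' y u) has_derivative g') (at x)"
  shows "((\<lambda>s. (f (x + s *\<^sub>R u + s *\<^sub>R v) - f (x + s *\<^sub>R u) - f (x + s *\<^sub>R v) + f x) / s\<^sup>2) \<longlongrightarrow> g' v)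
      (at_right 0)"
proof (rule tendstoI)
  fix e :: real assume e: "e > 0"
  \<comment> \<open>The errors at \<open>a = x + t u + s v\<close> and \<open>b = x + t u\<close>
    add up to at most \<open>e' s (2 |u| + |v|)\<close>. The summand 1 makes \<open>C\<close>
    positive and the bounds on the displacements strict; the factor 2 in \<open>e'\<close> makes the
    final bound \<open>e / 2\<close>.\<close>
  define C where "C = 2 * norm u + norm v + 1"
  have C: "C > 0" unfolding C_def by (smt (verit) norm_ge_zero)
  define e' where "e' = e / (2 * C)"
  have e': "e' > 0" using e C by (simp add: e'_def)
  obtain d where d: "d > 0" "\<And>y. norm (y - x) < d \<Longrightarrow> norm (f' y u - f' x u - g' (y - x)) \<le> e' * norm (y -
      x)"
    using g e' unfolding has_derivative_at_alt by blast
  obtain r where r: "r > 0" "ball x r \<subseteq> S" using S openE by blast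
  interpret g': bounded_linear g' using g by (rule has_derivative_bounded_linear)
  define \<delta> where "\<delta> = min d r / C"
  have \<delta>: "\<delta> > 0" using d r C by (simp add: \<delta>_def)
  have "dist ((f (x + s *\<^sub>R u + s *\<^sub>R v) - f (x + s *\<^sub>R u) - f (x + s *\<^sub>R v) + f x) / s\<^sup>2) (g' v) < e"
    if s: "0 < s" "s < \<delta>" for s
  proof -
    define h where "h t = f (x + t *\<^sub>R u + s *\<^sub>R v) - f (x + t *\<^sub>R u)" for t
    have sC: "s * C < d" "s * C < r" using s C by (auto simp: \<delta>_def field_simps)
    have near: "norm (t *\<^sub>R u + s *\<^sub>R v) \<le> s * (norm u + norm v)" "norm (t *\<^sub>R u) \<le> s * norm u"
      "s * (norm u + norm v) < s * C" "s * norm u < s * C" if "0 \<le> t" "t \<le> s" for t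
    proof -
      have "norm (t *\<^sub>R u) \<le> s * norm u" using that by (simp add: mult_right_mono)
      moreover have "norm (s *\<^sub>R v) = s * norm v" using s by simp
      ultimately show "norm (t *\<^sub>R u + s *\<^sub>R v) \<le> s * (norm u + norm v)" "norm (t *\<^sub>R u) \<le> s * norm u"
        using norm_triangle_ineq[of "t *\<^sub>R u" "s *\<^sub>R v"] unfolding distrib_left by linarith+
      show "s * (norm u + norm v) < s * C" "s * norm u < s * C"
        using s by (auto simp: C_def intro!: mult_strict_left_mono) (smt (verit) norm_ge_zero)+
    qed
    have inS: "x + t *\<^sub>R u + s *\<^sub>R v \<in> S" "x + t *\<^sub>R u \<in> S" if "0 \<le> t" "t \<le> s" for t
    proof -
      have r': "y \<in> S" if "norm (y - x) < r" for y
        using r(2) that by (auto simp: subset_iff dist_norm norm_minus_commute)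
      show "x + t *\<^sub>R u + s *\<^sub>R v \<in> S" "x + t *\<^sub>R u \<in> S"
        by (rule r', use near[OF that] sC in \<open>simp add: add.assoc\<close>)+
    qed
    have "(h has_derivative (\<lambda>k. f' (x + t *\<^sub>R u + s *\<^sub>R v) (k *\<^sub>R u) - f' (x + t *\<^sub>R u) (k *\<^sub>R u))) (at
        t)"
      if "0 \<le> t" "t \<le> s" for t
      unfolding h_def
      by (rule derivative_eq_intros has_derivative_compose[of _ _ _ _ f, OF _ f] inS[OF that] refl |
          simp)+
    then have "(h has_derivative (\<lambda>k. f' (x + t *\<^sub>R u + s *\<^sub>R v) (k *\<^sub>R u) - f' (x + t *\<^sub>R u) (k *\<^sub>R
        u))) (at t within {0..s})"
      if "0 \<le> t" "t \<le> s" for t using that has_derivative_at_withinI by blast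
    from mvt_very_simple[OF less_imp_le[OF s(1)] this]
    obtain t where t: "t \<in> {0..s}" "h s - h 0 = f' (x + t *\<^sub>R u + s *\<^sub>R v) ((s - 0) *\<^sub>R u) - f' (x + t
        *\<^sub>R u) ((s - 0) *\<^sub>R u)"
      by auto
    then have t': "0 \<le> t" "t \<le> s" by auto
    define a b where "a = x + t *\<^sub>R u + s *\<^sub>R v" and "b = x + t *\<^sub>R u"
    have ab: "linear (f' a)" "linear (f' b)" unfolding a_def b_def
      using f inS[OF t'] has_derivative_linear by blast+
    have hs: "h s - h 0 = s * (f' a u - f' b u)"
      using t(2) linear_cmul[OF ab(1)] linear_cmul[OF ab(2)] by (simp add: a_def b_def algebra_simps)
    have na: "norm (f' a u - f' x u - g' (a - x)) \<le> e' * norm (a - x)"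
      by (rule d(2)) (use near[OF t'] sC in \<open>simp add: a_def add.assoc\<close>)
    have nb: "norm (f' b u - f' x u - g' (b - x)) \<le> e' * norm (b - x)"
      by (rule d(2)) (use near[OF t'] sC in \<open>simp add: b_def\<close>)
    have "g' (a - x) - g' (b - x) = g' (s *\<^sub>R v)"
      by (simp add: g'.diff[symmetric] a_def b_def)
    also have "\<dots> = s * g' v" by (simp add: g'.scaleR)
    finally have "\<bar>f' a u - f' b u - s * g' v\<bar> \<le> e' * norm (a - x) + e' * norm (b - x)"
      using na nb by (simp add: abs_le_iff)
    also have "\<dots> \<le> e' * (s * (norm u + norm v)) + e' * (s * norm u)"
      using near(1,2)[OF t'] e' by (intro add_mono mult_left_mono) (auto simp: a_def b_def add.assoc)
    also have "\<dots> \<le> e' * (s * C)" using e' s by (simp add: C_def algebra_simps)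
    finally have "s * \<bar>f' a u - f' b u - s * g' v\<bar> \<le> s * (e' * (s * C))" using s
        by (intro mult_left_mono) auto
    moreover have "s * (f' a u - f' b u) - s\<^sup>2 * g' v = s * (f' a u - f' b u - s * g' v)"
      by (simp add: power2_eq_square algebra_simps)
    then have "\<bar>s * (f' a u - f' b u) - s\<^sup>2 * g' v\<bar> = s * \<bar>f' a u - f' b u - s * g' v\<bar>"
      using s(1) by (simp only: abs_mult abs_of_pos)
    moreover have "s * (e' * (s * C)) = s\<^sup>2 * (e' * C)" by (simp add: power2_eq_square)
    ultimately have "\<bar>s * (f' a u - f' b u) - s\<^sup>2 * g' v\<bar> \<le> s\<^sup>2 * (e' * C)" by linarith
    then have "\<bar>(s * (f' a u - f' b u) - s\<^sup>2 * g' v) / s\<^sup>2\<bar> \<le> e' * C"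
      using s by (simp add: abs_divide divide_le_eq mult.commute)
    moreover have "(s * (f' a u - f' b u) - s\<^sup>2 * g' v) / s\<^sup>2 = (h s - h 0) / s\<^sup>2 - g' v"
      using s hs by (simp add: diff_divide_distrib)
    moreover have "h s - h 0 = f (x + s *\<^sub>R u + s *\<^sub>R v) - f (x + s *\<^sub>R u) - f (x + s *\<^sub>R v) + f x"
      by (simp add: h_def)
    moreover have "e' * C < e" using e C by (simp add: e'_def)
    ultimately show ?thesis by (simp add: dist_real_def)
  qed
  then show "\<forall>\<^sub>F s in at_right 0. dist ((f (x + s *\<^sub>R u + s *\<^sub>R v) - f (x + s *\<^sub>R u) - f (x + s *\<^sub>R v) +
      f x) / s\<^sup>2) (g' v) < e"
    using \<delta> by (auto simp: eventually_at_right_field intro!: exI[of _ \<delta>])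
qed

lemma second_derivative_symmetric_real:
  fixes f :: "'a::real_normed_vector \<Rightarrow> real"
  assumes S: "open S" "x \<in> S" and f: "\<And>y. y \<in> S \<Longrightarrow> (f has_derivative f' y) (at y)"
    and g: "((\<lambda>y. f' y u) has_derivative g') (at x)" and k: "((\<lambda>y. f' y v) has_derivative k') (at x)"
  shows "g' v = k' u"
proof -
  note a = second_difference[OF S f g, where v = v] and b = second_difference[OF S f k, where v = u]
  have "x + s *\<^sub>R u + s *\<^sub>R v = x + s *\<^sub>R v + s *\<^sub>R u" for s by simp
  then have "((\<lambda>s. (f (x + s *\<^sub>R u + s *\<^sub>R v) - f (x + s *\<^sub>R u) - f (x + s *\<^sub>R v) + f x) / s\<^sup>2) \<longlongrightarrow> k' u)
      (at_right 0)"
    using b by (simp add: algebra_simps)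
  then show ?thesis using a tendsto_unique[OF trivial_limit_at_right_real] by blast
qed

lemma second_derivative_symmetric:
  fixes f :: "'a::real_normed_vector \<Rightarrow> 'b::euclidean_space"
  assumes S: "open S" "x \<in> S" and f: "smooth_on f S"
  shows "frechet_derivative (\<lambda>y. frechet_derivative f (at y) u) (at x) v
    = frechet_derivative (\<lambda>y. frechet_derivative f (at y) v) (at x) u"
proof (rule euclidean_eqI)
  fix b :: 'b
  let ?D = "\<lambda>u. frechet_derivative (\<lambda>y. frechet_derivative f (at y) u) (at x)"
  have D: "((\<lambda>y. frechet_derivative f (at y) w \<bullet> b) has_derivative (\<lambda>v. ?D w v \<bullet> b)) (at x)" for w
    by (rule has_derivative_inner_left[OF smooth_on_has_derivative[OF smooth_on_frechet_derivative[OF f]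
        S(2)]])
  have "(\<lambda>v. ?D u v \<bullet> b) v = (\<lambda>u. ?D v u \<bullet> b) u"
  proof (rule second_derivative_symmetric_real[OF S _ D D])
    show "((\<lambda>y. f y \<bullet> b) has_derivative (\<lambda>u. frechet_derivative f (at y) u \<bullet> b)) (at y)" if "y \<in> S" for y
      by (rule has_derivative_inner_left[OF smooth_on_has_derivative[OF f that]])
  qed
  then show "?D u v \<bullet> b = ?D v u \<bullet> b" by simp
qed

text \<open>The Leibniz rule for a family of linear maps that is differentiable vector by vector.
  Expansion in the basis proves it, and linearity of the derivative in the vector reassembles the
  sum.\<close>

lemma has_derivative_linear_apply:
  fixes y :: "'x::real_normed_vector \<Rightarrow> 'a::euclidean_space"
  assumes x: "x0 \<in> S" and lin: "\<And>x. x \<in> S \<Longrightarrow> linear (F x)"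
    and F: "\<And>v. ((\<lambda>x. F x v) has_derivative F' v) (at x0 within S)" and linF': "\<And>h. linear (\<lambda>v. F' v h)"
    and y: "(y has_derivative y') (at x0 within S)"
  shows "((\<lambda>x. F x (y x)) has_derivative (\<lambda>h. F' (y x0) h + F x0 (y' h))) (at x0 within S)"
proof -
  have "((\<lambda>x. \<Sum>b\<in>Basis. (y x \<bullet> b) *\<^sub>R F x b) has_derivative
      (\<lambda>h. \<Sum>b\<in>Basis. (y x0 \<bullet> b) *\<^sub>R F' b h + (y' h \<bullet> b) *\<^sub>R F x0 b)) (at x0 within S)"
    by (intro has_derivative_sum has_derivative_scaleR has_derivative_inner_left y F)
  moreover have "(\<Sum>b\<in>Basis. (y x0 \<bullet> b) *\<^sub>R F' b h + (y' h \<bullet> b) *\<^sub>R F x0 b) = F' (y x0) h + F x0 (y' h)"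
      for h
    using linear_euclidean_expand[OF linF', of "y x0" h] linear_euclidean_expand[OF lin[OF x], of "y' h"]
    by (simp add: sum.distrib)
  ultimately have "((\<lambda>x. \<Sum>b\<in>Basis. (y x \<bullet> b) *\<^sub>R F x b) has_derivative (\<lambda>h. F' (y x0) h + F x0 (y' h)))
      (at x0 within S)"
    by simp
  then show ?thesis
    by (rule has_derivative_transform[OF x, rotated]) (use linear_euclidean_expand[OF lin] in auto)
qed

lemma continuous_on_linear_apply:
  fixes y :: "'x::topological_space \<Rightarrow> 'a::euclidean_space" and F :: "'x \<Rightarrow> 'a \<Rightarrow> 'b::real_normed_vector"
  assumes lin: "\<And>x. x \<in> S \<Longrightarrow> linear (F x)" and F: "\<And>v. continuous_on S (\<lambda>x. F x v)"
      and y: "continuous_on S y"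
  shows "continuous_on S (\<lambda>x. F x (y x))"
proof -
  have "continuous_on S (\<lambda>x. \<Sum>b\<in>Basis. (y x \<bullet> b) *\<^sub>R F x b)" by (intro continuous_intros F y)
  then show ?thesis using linear_euclidean_expand[OF lin] by (subst continuous_on_cong[OF refl]) auto
qed

section \<open>The Levi-Civita connection in a chart\<close>

lemma Ck_on_uminus: "open S \<Longrightarrow> Ck_on k f S \<Longrightarrow> Ck_on k (\<lambda>x. - f x) S"
  using Ck_on_bounded_linear_compose[OF _ bounded_linear_minus[OF bounded_linear_ident]] by blast

lemma Ck_on_diff: "open S \<Longrightarrow> Ck_on k f S \<Longrightarrow> Ck_on k g S \<Longrightarrow> Ck_on k (\<lambda>x. f x - g x) S"
  using Ck_on_add[of S k f "\<lambda>x. - g x"] Ck_on_uminus by fastforce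

lemma linear_frechet_derivative_param:
  assumes S: "open S" "x \<in> S" and lin: "\<And>y. y \<in> S \<Longrightarrow> linear (F y)"
    and d: "\<And>v. (\<lambda>y. F y v) differentiable (at x)"
  shows "linear (\<lambda>v. frechet_derivative (\<lambda>y. F y v) (at x) h)"
proof (rule linearI)
  note D = d[unfolded frechet_derivative_works]
  fix u v c
  have "frechet_derivative (\<lambda>y. F y (u + v)) (at x) = frechet_derivative (\<lambda>y. F y u + F y v) (at x)"
    by (rule frechet_derivative_cong_open[OF S]) (rule linear_add[OF lin])
  then show "frechet_derivative (\<lambda>y. F y (u + v)) (at x) h
      = frechet_derivative (\<lambda>y. F y u) (at x) h + frechet_derivative (\<lambda>y. F y v) (at x) h"
    using frechet_derivativeI[OF has_derivative_add[OF D D]] by metis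
  have "frechet_derivative (\<lambda>y. F y (c *\<^sub>R u)) (at x) = frechet_derivative (\<lambda>y. c *\<^sub>R F y u) (at x)"
    by (rule frechet_derivative_cong_open[OF S]) (rule linear_cmul[OF lin])
  then show "frechet_derivative (\<lambda>y. F y (c *\<^sub>R u)) (at x) h = c *\<^sub>R frechet_derivative (\<lambda>y. F y u) (at
      x) h"
    using frechet_derivativeI[OF has_derivative_scaleR_right[OF D]] by metis
qed

text \<open>Continuity of \<open>f\<close> suffices because \<open>g\<close> vanishes at
  \<open>x\<close>: then \<open>g y\<close> is of order \<open>|y - x|\<close>, and
  \<open>(f y - f x) g y\<close> is of smaller order.\<close>

lemma has_derivative_scaleR_vanishing:
  fixes f :: "'a::real_normed_vector \<Rightarrow> real"
  assumes f: "isCont f x" and g: "(g has_derivative g') (at x)" "g x = 0"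
  shows "((\<lambda>y. f y *\<^sub>R g y) has_derivative (\<lambda>h. f x *\<^sub>R g' h)) (at x)"
proof -
  have 1: "((\<lambda>y. f x *\<^sub>R g y) has_derivative (\<lambda>h. f x *\<^sub>R g' h)) (at x)"
    by (rule has_derivative_scaleR_right[OF g(1)])
  have 2: "((\<lambda>y. (f y - f x) *\<^sub>R g y) has_derivative (\<lambda>h. 0)) (at x)"
    unfolding has_derivative_at_alt
  proof (intro conjI allI impI)
    fix e :: real assume e: "e > 0"
    interpret g': bounded_linear g' using g(1) by (rule has_derivative_bounded_linear)
    obtain B where B: "B > 0" "\<And>h. norm (g' h) \<le> norm h * B" using g'.pos_bounded by blast
    obtain d where d: "d > 0" "\<And>y. norm (y - x) < d \<Longrightarrow> norm (g y - g x - g' (y - x)) \<le> 1 * norm (y - x)"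
      using g(1) unfolding has_derivative_at_alt by (meson zero_less_one)
    \<comment> \<open>Near \<open>x\<close> one has \<open>|g y| \<le> (B + 1) |y - x|\<close>:
      \<open>B\<close> bounds the derivative and 1 the error.\<close>
    have "e / (B + 1) > 0" using e B by simp
    then obtain d' where d': "d' > 0" "\<And>y. dist y x < d' \<Longrightarrow> dist (f y) (f x) < e / (B + 1)"
      using f unfolding continuous_at_eps_delta by blast
    show "\<exists>d>0. \<forall>y. norm (y - x) < d \<longrightarrow> norm ((f y - f x) *\<^sub>R g y - (f x - f x) *\<^sub>R g x - 0) \<le> e * norm
        (y - x)"
    proof (intro exI[of _ "min d d'"] conjI allI impI)
      fix y assume y: "norm (y - x) < min d d'"
      have "norm (g y) \<le> norm (g' (y - x)) + norm (g y - g x - g' (y - x))"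
        using norm_triangle_ineq[of "g' (y - x)" "g y - g x - g' (y - x)"] g(2) by simp
      also have "\<dots> \<le> norm (y - x) * B + norm (y - x)"
        using B(2)[of "y - x"] d(2)[of y] y by simp
      finally have gy: "norm (g y) \<le> (B + 1) * norm (y - x)" by (simp add: algebra_simps)
      have "\<bar>f y - f x\<bar> \<le> e / (B + 1)" using d'(2)[of y] y by (simp add: dist_norm)
      then have "\<bar>f y - f x\<bar> * norm (g y) \<le> e / (B + 1) * ((B + 1) * norm (y - x))"
        using gy e B by (intro mult_mono) auto
      also have "\<dots> = e * norm (y - x)" using B by simp
      finally show "norm ((f y - f x) *\<^sub>R g y - (f x - f x) *\<^sub>R g x - 0) \<le> e * norm (y - x)" by simp
    qed (use d d' in auto)
  qed simp
  show ?thesis using has_derivative_add[OF 1 2] by (simp add: algebra_simps)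
qed

text \<open>The local theory of the Levi-Civita connection concerns one metric on one open set of
  the model space, detached from the manifold; images of charts and overlaps of charts are both
  instances.\<close>

locale metric_patch =
  fixes G :: "'a::euclidean_space local_metric" and S :: "'a set"
  assumes open_S: "open S"
    and G_bilin: "x \<in> S \<Longrightarrow> bilinear (G x)"
    and G_sym: "x \<in> S \<Longrightarrow> G x u v = G x v u"
    and G_nondeg: "x \<in> S \<Longrightarrow> (\<And>v. G x u v = 0) \<Longrightarrow> u = 0"
    and G_smooth: "smooth_on (\<lambda>x. G x u v) S"
begin

lemma G_linear: "x \<in> S \<Longrightarrow> linear (G x u)" "x \<in> S \<Longrightarrow> linear (\<lambda>u. G x u v)"
  using G_bilin by (auto simp: bilinear_def)

lemmas G_simps = bilinear_ladd[OF G_bilin] bilinear_radd[OF G_bilin] bilinear_lmul[OF G_bilin]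
  bilinear_rmul[OF G_bilin] bilinear_lsub[OF G_bilin] bilinear_rsub[OF G_bilin]
  bilinear_lneg[OF G_bilin] bilinear_rneg[OF G_bilin] bilinear_lzero[OF G_bilin] bilinear_rzero[OF
      G_bilin]

lemma G_eqI: "x \<in> S \<Longrightarrow> (\<And>w. G x u w = G x v w) \<Longrightarrow> u = v"
  using G_nondeg[of x "u - v"] by (simp add: G_simps)

text \<open>Lowering of an index, with covectors written in the Euclidean basis, so that
  \<open>G x\<close> becomes an endomorphism of the model space.\<close>

definition flat :: "'a \<Rightarrow> 'a \<Rightarrow> 'a" where "flat x y = (\<Sum>b\<in>Basis. G x y b *\<^sub>R b)"

lemma linear_flat: "x \<in> S \<Longrightarrow> linear (flat x)"
  unfolding flat_def by (intro linearI) (simp_all add: G_simps algebra_simps sum.distrib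
      scaleR_sum_right)

lemma flat_inner: "b \<in> Basis \<Longrightarrow> flat x y \<bullet> b = G x y b"
  unfolding flat_def by (simp add: inner_sum_left inner_Basis if_distrib cong: if_cong)

lemma inj_flat: "x \<in> S \<Longrightarrow> inj (flat x)"
proof (rule injI)
  fix u v assume x: "x \<in> S" and e: "flat x u = flat x v"
  have "G x u b = G x v b" if "b \<in> Basis" for b using flat_inner[OF that, of x] e by metis
  then have "G x u w = G x v w" for w
    using linear_euclidean_expand[OF G_linear(1)[OF x, of u], of w]
      linear_euclidean_expand[OF G_linear(1)[OF x, of v], of w] by simp
  then show "u = v" by (rule G_eqI[OF x])
qed

text \<open>The endomorphism \<open>flat x\<close> is injective by nondegeneracy and hence
  surjective. This justifies the definite description in \<open>christoffel\<close>.\<close>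

lemma represent:
  fixes f :: "'a \<Rightarrow> real"
  assumes x: "x \<in> S" and f: "linear f"
  shows "\<exists>!z. \<forall>w. G x z w = f w"
proof -
  have "surj (flat x)" using linear_flat inj_flat x linear_injective_imp_surjective by blast
  then obtain z where z: "flat x z = (\<Sum>b\<in>Basis. f b *\<^sub>R b)" by (metis surjD)
  have "G x z b = f b" if "b \<in> Basis" for b
    using flat_inner[OF that, of x z] that unfolding z
    by (simp add: inner_sum_left inner_Basis if_distrib cong: if_cong)
  then have "G x z w = f w" for w
    using linear_euclidean_expand[OF G_linear(1)[OF x, of z], of w] linear_euclidean_expand[OF f, of w]
        by simp
  then show ?thesis using G_eqI[OF x] by metis
qed

abbreviation DG :: "'a \<Rightarrow> 'a \<Rightarrow> 'a \<Rightarrow> 'a \<Rightarrow> real" where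
  "DG x u v w \<equiv> frechet_derivative (\<lambda>y. G y v w) (at x) u"

lemma G_has_derivative: "x \<in> S \<Longrightarrow> ((\<lambda>y. G y v w) has_derivative (\<lambda>h. DG x h v w)) (at x)"
  using smooth_on_has_derivative[OF G_smooth] by blast

lemma DG_linear:
  assumes x: "x \<in> S"
  shows "linear (\<lambda>u. DG x u v w)" "linear (\<lambda>v. DG x u v w)" "linear (\<lambda>w. DG x u v w)"
  using has_derivative_linear[OF G_has_derivative[OF x]]
    linear_frechet_derivative_param[OF open_S x, of "\<lambda>y v. G y v w" u]
    linear_frechet_derivative_param[OF open_S x, of "\<lambda>y w. G y v w" u]
    G_linear smooth_on_differentiable[OF G_smooth x] by auto

lemmas DG_simps = linear_add[OF DG_linear(1)] linear_add[OF DG_linear(2)] linear_add[OF DG_linear(3)]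
  linear_cmul[OF DG_linear(1)] linear_cmul[OF DG_linear(2)] linear_cmul[OF DG_linear(3)]

lemma DG_sym: "x \<in> S \<Longrightarrow> DG x u v w = DG x u w v"
  using frechet_derivative_cong_open[OF open_S, of x "\<lambda>y. G y v w" "\<lambda>y. G y w v"] G_sym by metis

text \<open>With \<open>L\<close> the inverse of \<open>flat x0\<close>, the solution satisfies \<open>z = L K - E z\<close> where \<open>E\<close> vanishes at \<open>x0\<close>, so
  that the product \<open>E z\<close> is differentiable there as soon as \<open>z\<close> is continuous.\<close>

lemma solve_differentiable:
  assumes x0: "x0 \<in> S" and z: "\<And>x w. x \<in> S \<Longrightarrow> G x (z x) w = \<kappa> x w" and \<kappa>: "\<And>w. isCont (\<lambda>x. \<kappa> x w) x0"
  shows "isCont z x0" and "(\<And>w. (\<lambda>x. \<kappa> x w) differentiable (at x0)) \<Longrightarrow> z differentiable (at x0)"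
proof -
  obtain L where L: "linear L" "L \<circ> flat x0 = id"
    using linear_injective_left_inverse[OF linear_flat[OF x0] inj_flat[OF x0]] by blast
  then have L0: "L (flat x0 y) = y" for y by (simp add: pointfree_idE)
  have bL: "bounded_linear L" using L(1) by (simp add: linear_conv_bounded_linear)
  define K where "K x = (\<Sum>b\<in>Basis. \<kappa> x b *\<^sub>R b)" for x
  define E where "E x y = L (flat x y) - y" for x y
  have E0: "E x0 y = 0" for y by (simp add: E_def L0)
  have linE: "linear (E x)" if "x \<in> S" for x
    unfolding E_def using linear_flat[OF that] L(1)
    by (intro linearI) (simp_all add: linear_add linear_cmul algebra_simps)
  have fz: "flat x (z x) = K x" if "x \<in> S" for x using z[OF that] by (simp add: flat_def K_def)
  have zE: "z x = L (K x) - (\<Sum>b\<in>Basis. (z x \<bullet> b) *\<^sub>R E x b)" if "x \<in> S" for x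
  proof -
    have "E x (z x) = L (K x) - z x" by (simp add: E_def fz[OF that])
    then have "(\<Sum>b\<in>Basis. (z x \<bullet> b) *\<^sub>R E x b) = L (K x) - z x"
      using linear_euclidean_expand[OF linE[OF that], of "z x"] by simp
    then show ?thesis by simp
  qed
  have dE: "(\<lambda>x. E x y) differentiable (at x0)" for y
    unfolding E_def flat_def
    by (intro differentiable_diff differentiable_const differentiable_compose[OF
        linear_imp_differentiable[OF L(1)]]
        differentiable_sum differentiable_scaleR smooth_on_differentiable[OF G_smooth x0] ballI
            finite_Basis)
  have LK: "isCont (\<lambda>x. L (K x)) x0"
    unfolding K_def by (intro bounded_linear.isCont[OF bL] continuous_intros \<kappa>)
  define \<eta> where "\<eta> x = (\<Sum>b\<in>Basis. norm (E x b))" for x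
  have \<eta>: "\<eta> \<midarrow>x0\<rightarrow> 0"
  proof -
    have "isCont \<eta> x0" unfolding \<eta>_def
      by (intro continuous_intros differentiable_imp_continuous_within dE)
    then show ?thesis by (simp add: isCont_def \<eta>_def E0)
  qed
  have En: "norm (\<Sum>b\<in>Basis. (y \<bullet> b) *\<^sub>R E x b) \<le> \<eta> x * norm y" for x y
    unfolding \<eta>_def sum_distrib_right
    by (rule order_trans[OF norm_sum], rule sum_mono)
      (simp add: mult.commute[of _ "norm y"] mult_right_mono Basis_le_norm)
  have nearS: "\<forall>\<^sub>F x in at x0. x \<in> S" using open_S x0 by (rule eventually_at_in_open')
  \<comment> \<open>Where \<open>\<eta> x < 1/2\<close> the term \<open>E z\<close> can be absorbed,
    giving \<open>|z| \<le> 2 |L K|\<close>; this bounds \<open>z\<close> near \<open>x0\<close>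
    before its continuity is known.\<close>
  have "\<forall>\<^sub>F x in at x0. \<eta> x < 1/2" using order_tendstoD(2)[OF \<eta>, of "1/2"] by simp
  with nearS have bd: "\<forall>\<^sub>F x in at x0. norm (z x - z x0) \<le> norm (L (K x) - L (K x0)) + \<eta> x * (2 * norm
      (L (K x)))"
  proof eventually_elim
    case (elim x)
    have \<eta>0: "\<eta> x \<ge> 0" by (simp add: \<eta>_def sum_nonneg)
    have "norm (z x) \<le> norm (L (K x)) + norm (\<Sum>b\<in>Basis. (z x \<bullet> b) *\<^sub>R E x b)"
      using zE[OF elim(1)] norm_triangle_ineq4 by metis
    also have "\<dots> \<le> norm (L (K x)) + 1/2 * norm (z x)"
      using En[of "z x" x] elim(2) mult_right_mono[OF less_imp_le[OF elim(2)] norm_ge_zero[of "z x"]]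
          by linarith
    finally have nz: "norm (z x) \<le> 2 * norm (L (K x))" by simp
    have "z x0 = L (K x0)" using zE[OF x0] by (simp add: E0)
    then have eq: "z x - z x0 = (L (K x) - L (K x0)) - (\<Sum>b\<in>Basis. (z x \<bullet> b) *\<^sub>R E x b)"
      using zE[OF elim(1)] by (metis diff_diff_eq2 diff_right_commute diff_diff_add add.commute)
    have "norm (z x - z x0) \<le> norm (L (K x) - L (K x0)) + \<eta> x * norm (z x)"
      unfolding eq
      using norm_triangle_ineq4[of "L (K x) - L (K x0)" "\<Sum>b\<in>Basis. (z x \<bullet> b) *\<^sub>R E x b"] En[of "z x" x]
          by linarith
    then show ?case using mult_left_mono[OF nz \<eta>0] by linarith
  qed
  have "((\<lambda>x. norm (L (K x) - L (K x0)) + \<eta> x * (2 * norm (L (K x)))) \<longlongrightarrow> norm (L (K x0) - L (K x0)) + 0 *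
      (2 * norm (L (K x0)))) (at x0)"
    using LK unfolding isCont_def by (intro tendsto_intros \<eta>)
  then have lim0: "((\<lambda>x. norm (L (K x) - L (K x0)) + \<eta> x * (2 * norm (L (K x)))) \<longlongrightarrow> 0) (at x0)" by simp
  have "((\<lambda>x. norm (z x - z x0)) \<longlongrightarrow> 0) (at x0)"
    by (rule tendsto_sandwich[OF _ bd tendsto_const lim0]) simp
  then show cz: "isCont z x0" unfolding isCont_def by (simp add: tendsto_norm_zero_iff LIM_zero_iff)
  assume dk: "\<And>w. (\<lambda>x. \<kappa> x w) differentiable (at x0)"
  have "(\<lambda>x. L (K x)) differentiable (at x0)"
    unfolding K_def
    by (intro differentiable_compose[OF linear_imp_differentiable[OF L(1)]]
        differentiable_sum differentiable_scaleR differentiable_const dk ballI finite_Basis)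
  moreover have "(\<lambda>x. (z x \<bullet> b) *\<^sub>R E x b) differentiable (at x0)" for b
  proof -
    have "isCont (\<lambda>x. z x \<bullet> b) x0" using cz by (intro continuous_intros)
    from has_derivative_scaleR_vanishing[OF this dE[of b, unfolded frechet_derivative_works] E0]
    show ?thesis by (auto simp: differentiable_def)
  qed
  ultimately have "(\<lambda>x. L (K x) - (\<Sum>b\<in>Basis. (z x \<bullet> b) *\<^sub>R E x b)) differentiable (at x0)"
    by (intro differentiable_diff differentiable_sum ballI finite_Basis)
  then show "z differentiable (at x0)"
    by (rule differentiable_cong_open[OF open_S x0, rotated]) (rule zE[symmetric])
qed

text \<open>Differentiating the equation shows that each directional derivative of \<open>z\<close>
  solves an equation of the same kind, with right-hand side \<open>D\<kappa> - DG(z)\<close>. That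
  side is of class \<open>k\<close> by the induction hypothesis for \<open>z\<close> itself, so the
  hypothesis applies again to the derivative.\<close>

lemma Ck_on_solve:
  assumes "\<And>x w. x \<in> S \<Longrightarrow> G x (z x) w = \<kappa> x w" "\<And>w. Ck_on k (\<lambda>x. \<kappa> x w) S"
  shows "Ck_on k z S"
  using assms
proof (induction k arbitrary: z \<kappa>)
  case 0
  have "isCont (\<lambda>x. \<kappa> x w) x" if "x \<in> S" for x w
    using 0(2) that open_S by (simp add: continuous_on_eq_continuous_at)
  then have "isCont z x" if "x \<in> S" for x using solve_differentiable(1)[OF that 0(1)] that by blast
  then show ?case by (simp add: continuous_at_imp_continuous_on)
next
  case (Suc k)
  have zk: "Ck_on k z S" using Suc.IH[of z \<kappa>] Suc.prems Ck_on_Suc_imp by blast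
  note dk = Ck_on_SucD(1)[OF Suc.prems(2)]
  have dz: "(z has_derivative frechet_derivative z (at x)) (at x)" if x: "x \<in> S" for x
  proof -
    have "isCont (\<lambda>x. \<kappa> x w) x" for w using dk[OF x] has_derivative_continuous by blast
    moreover have "(\<lambda>x. \<kappa> x w) differentiable (at x)" for w using dk[OF x] differentiable_def by blast
    ultimately have "z differentiable (at x)" using solve_differentiable(2)[OF x Suc.prems(1)] by blast
    then show ?thesis by (simp add: frechet_derivative_works)
  qed
  have eq: "G x (frechet_derivative z (at x) v) w = frechet_derivative (\<lambda>x. \<kappa> x w) (at x) v - DG x v (z
      x) w"
    if x: "x \<in> S" for x v w
  proof -
    have h1: "((\<lambda>y. G y (z y) w) has_derivative (\<lambda>h. DG x h (z x) w + G x (frechet_derivative z (at x)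
        h) w)) (at x)"
      using has_derivative_linear_apply[of x S "\<lambda>y u. G y u w" "\<lambda>v h. DG x h v w" z
          "frechet_derivative z (at x)"]
        x G_linear(2) G_has_derivative[OF x] DG_linear(2)[OF x] dz[OF x] at_within_open[OF x open_S]
            by simp
    have h2: "((\<lambda>y. G y (z y) w) has_derivative frechet_derivative (\<lambda>x. \<kappa> x w) (at x)) (at x)"
      by (rule has_derivative_transform_within_open[OF dk[OF x] open_S x]) (rule Suc.prems(1)[symmetric])
    show ?thesis using fun_cong[OF has_derivative_unique[OF h1 h2], of v] by simp
  qed
  show ?case
  proof (rule Ck_on_SucI[OF open_S dz])
    fix v
    show "Ck_on k (\<lambda>x. frechet_derivative z (at x) v) S"
    proof (rule Suc.IH[OF eq])
      fix w
      have "Ck_on k (\<lambda>x. DG x v (z x) w) S"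
      proof (rule Ck_on_linear_apply[OF open_S _ _ zk])
        show "linear (\<lambda>u. DG x v u w)" if "x \<in> S" for x by (rule DG_linear(2)[OF that])
        show "Ck_on k (\<lambda>x. DG x v b w) S" for b
          using smooth_on_frechet_derivative[OF G_smooth[of b w], of v] by (simp add: smooth_on_def)
      qed
      then show "Ck_on k (\<lambda>x. frechet_derivative (\<lambda>x. \<kappa> x w) (at x) v - DG x v (z x) w) S"
        by (intro Ck_on_diff[OF open_S] Ck_on_SucD(2)[OF Suc.prems(2)])
    qed
  qed
qed

section \<open>Christoffel map, compatibility with the metric and symmetries of the
  curvature\<close>

abbreviation \<Gamma> :: "'a \<Rightarrow> 'a \<Rightarrow> 'a \<Rightarrow> 'a" where "\<Gamma> \<equiv> christoffel G"

lemma christoffel_eq: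
  assumes x: "x \<in> S"
  shows "G x (\<Gamma> x u v) w = (DG x u v w + DG x v u w - DG x w u v) / 2"
proof -
  have "linear (\<lambda>w. (DG x u v w + DG x v u w - DG x w u v) / 2)"
    by (intro linearI) (simp_all add: DG_simps[OF x] field_simps)
  from theI'[OF represent[OF x this]] show ?thesis unfolding christoffel_def by blast
qed

lemma christoffel_sym:
  assumes x: "x \<in> S"
  shows "\<Gamma> x u v = \<Gamma> x v u"
proof (rule G_eqI[OF x])
  show "G x (\<Gamma> x u v) w = G x (\<Gamma> x v u) w" for w
    unfolding christoffel_eq[OF x] using DG_sym[OF x, of u v w] by simp
qed

lemma christoffel_linear:
  assumes x: "x \<in> S"
  shows "linear (\<Gamma> x u)" "linear (\<lambda>u. \<Gamma> x u v)"
proof -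
  show 1: "linear (\<Gamma> x u)" for u
    by (intro linearI G_eqI[OF x]) (simp_all add: G_simps[OF x] christoffel_eq[OF x] DG_simps[OF x]
        field_simps)
  show "linear (\<lambda>u. \<Gamma> x u v)" using 1[of v] by (simp add: christoffel_sym[OF x, of _ v])
qed

lemma bilinear_christoffel: "x \<in> S \<Longrightarrow> bilinear (\<Gamma> x)"
  using christoffel_linear by (simp add: bilinear_def)

lemma christoffel_smooth: "smooth_on (\<lambda>x. \<Gamma> x u v) S"
proof -
  have D: "Ck_on k (\<lambda>x. DG x u v w) S" for k u v w
    using smooth_on_frechet_derivative[OF G_smooth] unfolding smooth_on_def by blast
  have "Ck_on k (\<lambda>x. (DG x u v w + DG x v u w - DG x w u v) / 2) S" for k w
    by (rule Ck_on_bounded_linear_compose[OF open_S bounded_linear_divide])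
      (intro Ck_on_diff Ck_on_add open_S D)
  from Ck_on_solve[OF christoffel_eq this] have "Ck_on k (\<lambda>x. \<Gamma> x u v) S" for k
    by blast
  then show ?thesis by (simp add: smooth_on_def)
qed

text \<open>The equation \<open>\<nabla>g = 0\<close>, evaluated on fields with constant
  components.\<close>

lemma metric_compatible:
  assumes x: "x \<in> S"
  shows "DG x u v w = G x (\<Gamma> x u v) w + G x v (\<Gamma> x u w)"
proof -
  have "G x v (\<Gamma> x u w) = G x (\<Gamma> x u w) v" by (rule G_sym[OF x])
  then show ?thesis
    using christoffel_eq[OF x, of u v w] christoffel_eq[OF x, of u w v]
      DG_sym[OF x, of v w u] DG_sym[OF x, of u v w] DG_sym[OF x, of u w v] by argo
qed

abbreviation D\<Gamma> :: "'a \<Rightarrow> 'a \<Rightarrow> 'a \<Rightarrow> 'a \<Rightarrow> 'a" where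
  "D\<Gamma> x u v w \<equiv> frechet_derivative (\<lambda>y. \<Gamma> y v w) (at x) u"

lemma christoffel_has_derivative: "x \<in> S \<Longrightarrow> ((\<lambda>y. \<Gamma> y v w) has_derivative (\<lambda>h. D\<Gamma> x h v w)) (at x)"
  using smooth_on_has_derivative[OF christoffel_smooth] by blast

lemma D\<Gamma>_linear:
  assumes x: "x \<in> S"
  shows "linear (\<lambda>u. D\<Gamma> x u v w)" "linear (\<lambda>v. D\<Gamma> x u v w)" "linear (\<lambda>w. D\<Gamma> x u v w)"
proof -
  note d = smooth_on_differentiable[OF christoffel_smooth x]
  show "linear (\<lambda>u. D\<Gamma> x u v w)" by (rule has_derivative_linear[OF christoffel_has_derivative[OF x]])
  show "linear (\<lambda>v. D\<Gamma> x u v w)"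
    by (rule linear_frechet_derivative_param[OF open_S x _ d]) (rule christoffel_linear(2))
  show "linear (\<lambda>w. D\<Gamma> x u v w)"
    by (rule linear_frechet_derivative_param[OF open_S x _ d]) (rule christoffel_linear(1))
qed

lemma D\<Gamma>_sym: "x \<in> S \<Longrightarrow> D\<Gamma> x u v w = D\<Gamma> x u w v"
  using frechet_derivative_cong_open[OF open_S, of x "\<lambda>y. \<Gamma> y v w" "\<lambda>y. \<Gamma> y w v"] christoffel_sym
      by metis

lemma curvature_eq:
  assumes x: "x \<in> S"
  shows "curvature G x u v w = D\<Gamma> x u v w - D\<Gamma> x v u w + \<Gamma> x u (\<Gamma> x v w) - \<Gamma> x v (\<Gamma> x u w)"
proof -
  have n: "nabla G (\<lambda>_. a) (\<lambda>_. w) = (\<lambda>y. \<Gamma> y a w)" for a by (intro ext) (simp add: nabla_def)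
  have "lie_bracket (\<lambda>_. u) (\<lambda>_. v) = (\<lambda>_. 0)" by (simp add: lie_bracket_def fun_eq_iff)
  moreover have "\<Gamma> x 0 w = 0" using linear_0[OF christoffel_linear(2)[OF x]] .
  ultimately show ?thesis
    unfolding curvature_def Let_def n by (simp add: nabla_def)
qed

lemma curvature_linear:
  assumes x: "x \<in> S"
  shows "linear (\<lambda>u. curvature G x u v w)" "linear (\<lambda>v. curvature G x u v w)"
      "linear (\<lambda>w. curvature G x u v w)"
  unfolding curvature_eq[OF x]
  by (intro linearI; simp add: linear_add[OF D\<Gamma>_linear(1)[OF x]] linear_add[OF D\<Gamma>_linear(2)[OF x]]
      linear_add[OF D\<Gamma>_linear(3)[OF x]]
    linear_cmul[OF D\<Gamma>_linear(1)[OF x]] linear_cmul[OF D\<Gamma>_linear(2)[OF x]] linear_cmul[OF D\<Gamma>_linear(3)[OF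
        x]]
    linear_add[OF christoffel_linear(1)[OF x]] linear_add[OF christoffel_linear(2)[OF x]]
    linear_cmul[OF christoffel_linear(1)[OF x]] linear_cmul[OF christoffel_linear(2)[OF x]]
        algebra_simps)+

lemma curvature_continuous_on: "continuous_on S (\<lambda>x. curvature G x u v w)"
proof -
  have g: "continuous_on S (\<lambda>x. \<Gamma> x u v)" for u v
      by (rule smooth_on_continuous_on[OF christoffel_smooth])
  have gg: "continuous_on S (\<lambda>x. \<Gamma> x u (\<Gamma> x v w))" for u v w
    by (rule continuous_on_linear_apply[OF christoffel_linear(1) g g])
  have "continuous_on S (\<lambda>x. D\<Gamma> x u v w)" for u v w
    by (rule smooth_on_continuous_on[OF smooth_on_frechet_derivative[OF christoffel_smooth]])
  then have "continuous_on S (\<lambda>x. D\<Gamma> x u v w - D\<Gamma> x v u w + \<Gamma> x u (\<Gamma> x v w) - \<Gamma> x v (\<Gamma> x u w))"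
    by (intro continuous_intros gg)
  then show ?thesis by (subst continuous_on_cong[OF refl curvature_eq])
qed

lemma curvature_skew1: "x \<in> S \<Longrightarrow> curvature G x u v w = - curvature G x v u w"
  by (simp add: curvature_eq)

lemma curvature_bianchi:
  assumes x: "x \<in> S"
  shows "curvature G x u v w + curvature G x v w u + curvature G x w u v = 0"
proof -
  have e: "D\<Gamma> x v u w = D\<Gamma> x v w u" "D\<Gamma> x u w v = D\<Gamma> x u v w" "D\<Gamma> x w v u = D\<Gamma> x w u v"
    by (rule D\<Gamma>_sym[OF x])+
  have f: "\<Gamma> x u w = \<Gamma> x w u" "\<Gamma> x v u = \<Gamma> x u v" "\<Gamma> x w v = \<Gamma> x v w"
    by (rule christoffel_sym[OF x])+
  show ?thesis unfolding curvature_eq[OF x] e f by simp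
qed

text \<open>Differentiating \<open>metric_compatible\<close> once more gives \<open>D2\<close>. Its
  last two summands together are symmetric in \<open>u\<close> and \<open>v\<close>, as is the
  second derivative of the metric, so antisymmetrising leaves exactly the two curvature
  terms.\<close>

lemma curvature_skew2:
  assumes x: "x \<in> S"
  shows "G x (curvature G x u v w) z = - G x w (curvature G x u v z)"
proof -
  have D2: "frechet_derivative (\<lambda>y. DG y v w z) (at x) u =
      G x (D\<Gamma> x u v w + \<Gamma> x u (\<Gamma> x v w)) z + G x w (D\<Gamma> x u v z + \<Gamma> x u (\<Gamma> x v z))
      + G x (\<Gamma> x v w) (\<Gamma> x u z) + G x (\<Gamma> x u w) (\<Gamma> x v z)" for u v
  proof -
    note S' = at_within_open[OF x open_S]
    have 1: "((\<lambda>y. G y (\<Gamma> y v w) z) has_derivative (\<lambda>h. DG x h (\<Gamma> x v w) z + G x (D\<Gamma> x h v w) z)) (at x)"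
      using has_derivative_linear_apply[of x S "\<lambda>y u. G y u z" "\<lambda>v h. DG x h v z" "\<lambda>y. \<Gamma> y v w"
          "\<lambda>h. D\<Gamma> x h v w"]
        x G_linear(2) G_has_derivative[OF x] DG_linear(2)[OF x] christoffel_has_derivative[OF x] S'
            by simp
    have 2: "((\<lambda>y. G y w (\<Gamma> y v z)) has_derivative (\<lambda>h. DG x h w (\<Gamma> x v z) + G x w (D\<Gamma> x h v z))) (at x)"
      using has_derivative_linear_apply[of x S "\<lambda>y u. G y w u" "\<lambda>v h. DG x h w v" "\<lambda>y. \<Gamma> y v z"
          "\<lambda>h. D\<Gamma> x h v z"]
        x G_linear(1) G_has_derivative[OF x] DG_linear(3)[OF x] christoffel_has_derivative[OF x] S'
            by simp
    have "frechet_derivative (\<lambda>y. DG y v w z) (at x)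
        = frechet_derivative (\<lambda>y. G y (\<Gamma> y v w) z + G y w (\<Gamma> y v z)) (at x)"
      by (rule frechet_derivative_cong_open[OF open_S x metric_compatible])
    note this[THEN fun_cong, of u]
    also have "frechet_derivative (\<lambda>y. G y (\<Gamma> y v w) z + G y w (\<Gamma> y v z)) (at x) u = (DG x u (\<Gamma> x v w) z
        + G x (D\<Gamma> x u v w) z) + (DG x u w (\<Gamma> x v z) + G x w (D\<Gamma> x u v z))"
      by (rule frechet_derivativeI[OF has_derivative_add[OF 1 2], THEN fun_cong])
    finally show ?thesis by (simp add: metric_compatible[OF x] G_simps[OF x])
  qed
  have "frechet_derivative (\<lambda>y. DG y v w z) (at x) u = frechet_derivative (\<lambda>y. DG y u w z) (at x) v"
    using second_derivative_symmetric[OF open_S x G_smooth] by metis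
  then show ?thesis
    unfolding D2[of u v] D2[of v u] by (simp add: curvature_eq[OF x] G_simps[OF x])
qed

text \<open>The classical octahedron argument: the first Bianchi identity for the four cyclic
  rotations of the arguments, combined with both skew symmetries, is a linear system that implies
  the claim.\<close>

lemma curvature_pair_sym:
  assumes x: "x \<in> S"
  shows "G x (curvature G x u v w) z = G x (curvature G x w z u) v"
proof -
  let ?Q = "\<lambda>u v w z. G x (curvature G x u v w) z"
  have s1: "?Q u v w z = - ?Q v u w z" for u v w z
    using curvature_skew1[OF x, of u v w] by (simp add: G_simps[OF x])
  have s2: "?Q u v w z = - ?Q u v z w" for u v w z
    using curvature_skew2[OF x, of u v w z] G_sym[OF x] by metis
  have b: "?Q u v w z + ?Q v w u z + ?Q w u v z = 0" for u v w z
    using curvature_bianchi[OF x, of u v w] G_simps(1)[OF x] G_simps(9)[OF x] by metis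
  show ?thesis
    using b[of u v w z] b[of v w z u] b[of w z u v] b[of z u v w]
      s1[of w u v z] s1[of z v w u] s1[of v w u z] s1[of u v w z] s1[of w z u v] s1[of z u v w]
      s2[of u v w z] s2[of v w z u] s2[of w z u v] s2[of z u v w] s2[of w u v z] s2[of z v w u]
      s2[of v w u z] s2[of u w z v] s2[of w z v u] s2[of z u w v] s2[of u v z w] s2[of v z u w] s1[of u
          w z v] s1[of v z u w]
      s1[of v z w u] s1[of w u z v] s1[of z u w v] s1[of u z v w] s1[of v w z u]
    by linarith
qed

end

section \<open>Change of charts\<close>

lemma has_derivative_linear_apply_at:
  fixes y :: "'x::real_normed_vector \<Rightarrow> 'a::euclidean_space"
  assumes S: "open S" "x0 \<in> S" and lin: "\<And>x. x \<in> S \<Longrightarrow> linear (F x)"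
    and F: "\<And>v. ((\<lambda>x. F x v) has_derivative F' v) (at x0)" and linF': "\<And>h. linear (\<lambda>v. F' v h)"
    and y: "(y has_derivative y') (at x0)"
  shows "((\<lambda>x. F x (y x)) has_derivative (\<lambda>h. F' (y x0) h + F x0 (y' h))) (at x0)"
proof -
  note S' = at_within_open[OF S(2,1)]
  have "((\<lambda>x. F x v) has_derivative F' v) (at x0 within S)" for v using F by (simp add: S')
  moreover have "(y has_derivative y') (at x0 within S)" using y by (simp add: S')
  ultimately have "((\<lambda>x. F x (y x)) has_derivative (\<lambda>h. F' (y x0) h + F x0 (y' h))) (at x0 within S)"
    by (intro has_derivative_linear_apply S(2) lin linF')
  then show ?thesis by (simp add: S')
qed

text \<open>Intended for a transition map \<open>T\<close>, with \<open>S\<close> the overlap in the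
  first chart and \<open>S'\<close> the whole image of the second. Surjectivity of the derivative
  allows every test vector at \<open>T x\<close> to be written as the image of one at
  \<open>x\<close>.\<close>

locale metric_change = M: metric_patch G S + M': metric_patch G' S'
  for G :: "'a::euclidean_space local_metric" and S and G' :: "'a local_metric" and S' +
  fixes T :: "'a \<Rightarrow> 'a"
  assumes T_smooth: "smooth_on T S" and T_in: "x \<in> S \<Longrightarrow> T x \<in> S'"
    and T_surj: "x \<in> S \<Longrightarrow> surj (frechet_derivative T (at x))"
    and T_isometry: "x \<in> S \<Longrightarrow>
      G x u v = G' (T x) (frechet_derivative T (at x) u) (frechet_derivative T (at x) v)"
begin

abbreviation DT :: "'a \<Rightarrow> 'a \<Rightarrow> 'a" where "DT x \<equiv> frechet_derivative T (at x)"

abbreviation D2T :: "'a \<Rightarrow> 'a \<Rightarrow> 'a \<Rightarrow> 'a" where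
  "D2T x u v \<equiv> frechet_derivative (\<lambda>y. DT y v) (at x) u"

lemma T_has_derivative: "x \<in> S \<Longrightarrow> (T has_derivative DT x) (at x)"
  by (rule smooth_on_has_derivative[OF T_smooth])

lemma linear_DT: "x \<in> S \<Longrightarrow> linear (DT x)"
  by (rule has_derivative_linear[OF T_has_derivative])

lemma DT_has_derivative: "x \<in> S \<Longrightarrow> ((\<lambda>y. DT y v) has_derivative (\<lambda>h. D2T x h v)) (at x)"
  by (rule smooth_on_has_derivative[OF smooth_on_frechet_derivative[OF T_smooth]])

lemma D2T_sym: "x \<in> S \<Longrightarrow> D2T x u v = D2T x v u"
  by (rule second_derivative_symmetric[OF M.open_S _ T_smooth])

lemma linear_D2T:
  assumes x: "x \<in> S"
  shows "linear (\<lambda>u. D2T x u v)" "linear (\<lambda>v. D2T x u v)"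
proof -
  show *: "linear (\<lambda>u. D2T x u v)" for v by (rule has_derivative_linear[OF DT_has_derivative[OF x]])
  have "(\<lambda>v. D2T x u v) = (\<lambda>v. D2T x v u)" by (intro ext D2T_sym[OF x])
  then show "linear (\<lambda>v. D2T x u v)" using *[of u] by simp
qed

lemma D2T_has_derivative:
  "x \<in> S \<Longrightarrow> ((\<lambda>y. D2T y u v) has_derivative (\<lambda>h. frechet_derivative (\<lambda>y. D2T y u v) (at x) h)) (at x)"
  by (rule smooth_on_has_derivative[OF smooth_on_frechet_derivative[OF smooth_on_frechet_derivative[OF
      T_smooth]]])

lemma D3T_sym:
  assumes x: "x \<in> S"
  shows "frechet_derivative (\<lambda>y. D2T y u v) (at x) w = frechet_derivative (\<lambda>y. D2T y w v) (at x) u"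
  by (rule second_derivative_symmetric[OF M.open_S x smooth_on_frechet_derivative[OF T_smooth]])

text \<open>Serves twice, with the metric and with the Christoffel map of the second patch as
  \<open>F\<close>; the three terms come from the base point and from the two arguments.\<close>

lemma bilinear_family_has_derivative:
  fixes F :: "'a \<Rightarrow> 'a \<Rightarrow> 'a \<Rightarrow> 'b::real_normed_vector"
  assumes x: "x \<in> S"
    and lin: "\<And>y p. y \<in> S' \<Longrightarrow> linear (F y p)" "\<And>y q. y \<in> S' \<Longrightarrow> linear (\<lambda>p. F y p q)"
    and F: "\<And>p q. ((\<lambda>y. F y p q) has_derivative F' p q) (at (T x))"
    and linF': "\<And>p h. linear (\<lambda>q. F' p q h)" "\<And>q h. linear (\<lambda>p. F' p q h)"
  shows "((\<lambda>y. F (T y) (DT y u) (DT y v)) has_derivative (\<lambda>h. F' (DT x u) (DT x v) (DT x h)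
    + F (T x) (DT x u) (D2T x h v) + F (T x) (D2T x h u) (DT x v))) (at x)"
proof -
  have 0: "((\<lambda>y. F (T y) p q) has_derivative (\<lambda>h. F' p q (DT x h))) (at x)" for p q
    using diff_chain_at[OF T_has_derivative[OF x] F] by (simp add: comp_def)
  have 1: "((\<lambda>y. F (T y) p (DT y v)) has_derivative
      (\<lambda>h. F' p (DT x v) (DT x h) + F (T x) p (D2T x h v))) (at x)" for p
    by (rule has_derivative_linear_apply_at[OF M.open_S x, where F = "\<lambda>y. F (T y) p"
        and F' = "\<lambda>q h. F' p q (DT x h)"])
      (use lin(1) T_in linF'(1) 0 DT_has_derivative[OF x] in auto)
  show ?thesis
  proof (rule has_derivative_linear_apply_at[OF M.open_S x, where F = "\<lambda>y p. F (T y) p (DT y v)"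
        and F' = "\<lambda>p h. F' p (DT x v) (DT x h) + F (T x) p (D2T x h v)"])
    show "linear (\<lambda>p. F' p (DT x v) (DT x h) + F (T x) p (D2T x h v))" for h
      by (rule linear_compose_add[OF linF'(2) lin(2)[OF T_in[OF x]]])
  qed (use lin(2) T_in 1 DT_has_derivative[OF x] in auto)
qed

lemma DG_change:
  assumes x: "x \<in> S"
  shows "M.DG x h u v = M'.DG (T x) (DT x h) (DT x u) (DT x v)
    + G' (T x) (DT x u) (D2T x h v) + G' (T x) (D2T x h u) (DT x v)"
proof -
  note Tx = T_in[OF x]
  have 2: "((\<lambda>y. G' (T y) (DT y u) (DT y v)) has_derivative (\<lambda>h. M'.DG (T x) (DT x h) (DT x u) (DT x v)
      + G' (T x) (DT x u) (D2T x h v) + G' (T x) (D2T x h u) (DT x v))) (at x)"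
    by (rule bilinear_family_has_derivative[OF x M'.G_linear M'.G_has_derivative[OF Tx]
        M'.DG_linear(3,2)[OF Tx]])
  have "M.DG x h u v = frechet_derivative (\<lambda>y. G' (T y) (DT y u) (DT y v)) (at x) h"
    by (rule frechet_derivative_cong_open[OF M.open_S x T_isometry, THEN fun_cong])
  then show ?thesis using frechet_derivativeI[OF 2, THEN fun_cong, of h] by simp
qed

text \<open>The Koszul formula produces six terms with second derivatives of \<open>T\<close>. By
  symmetry of \<open>D2T\<close> four of them cancel, and the other two are equal and account for
  the inhomogeneous term.\<close>

lemma christoffel_change:
  assumes x: "x \<in> S"
  shows "DT x (M.\<Gamma> x u v) = M'.\<Gamma> (T x) (DT x u) (DT x v) + D2T x u v"
proof (rule M'.G_eqI[OF T_in[OF x]])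
  fix w'
  obtain w where w: "w' = DT x w" using T_surj[OF x] by (metis surjD)
  note Tx = T_in[OF x]
  have "G' (T x) (DT x (M.\<Gamma> x u v)) w' = G x (M.\<Gamma> x u v) w" using T_isometry[OF x] w by simp
  also have "\<dots> = (M.DG x u v w + M.DG x v u w - M.DG x w u v) / 2" by (rule M.christoffel_eq[OF x])
  also have "\<dots> = G' (T x) (M'.\<Gamma> (T x) (DT x u) (DT x v)) w' + G' (T x) (D2T x u v) w'"
    unfolding DG_change[OF x] M'.christoffel_eq[OF Tx] w
    using D2T_sym[OF x, of v u] D2T_sym[OF x, of w u] D2T_sym[OF x, of w v]
      M'.G_sym[OF Tx, of "DT x u" "D2T x v w"] M'.G_sym[OF Tx, of "DT x v" "D2T x u w"]
    by (simp add: field_simps)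
  finally show "G' (T x) (DT x (M.\<Gamma> x u v)) w' = G' (T x) (M'.\<Gamma> (T x) (DT x u) (DT x v) + D2T x u v) w'"
    by (simp add: M'.G_simps[OF Tx])
qed

lemma christoffel_change_derivative:
  assumes x: "x \<in> S"
  shows "D2T x z (M.\<Gamma> x u v) + DT x (M.D\<Gamma> x z u v)
    = M'.D\<Gamma> (T x) (DT x z) (DT x u) (DT x v) + M'.\<Gamma> (T x) (DT x u) (D2T x z v) + M'.\<Gamma> (T x) (D2T x z u)
        (DT x v)
      + frechet_derivative (\<lambda>y. D2T y u v) (at x) z"
proof -
  note Tx = T_in[OF x]
  have 2: "((\<lambda>y. M'.\<Gamma> (T y) (DT y u) (DT y v)) has_derivative (\<lambda>h. M'.D\<Gamma> (T x) (DT x h) (DT x u) (DT x v)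
      + M'.\<Gamma> (T x) (DT x u) (D2T x h v) + M'.\<Gamma> (T x) (D2T x h u) (DT x v))) (at x)"
    by (rule bilinear_family_has_derivative[OF x M'.christoffel_linear M'.christoffel_has_derivative[OF
        Tx] M'.D\<Gamma>_linear(3,2)[OF Tx]])
  have 3: "((\<lambda>y. DT y (M.\<Gamma> y u v)) has_derivative (\<lambda>h. D2T x h (M.\<Gamma> x u v) + DT x (M.D\<Gamma> x h u v))) (at
      x)"
    by (rule has_derivative_linear_apply_at[OF M.open_S x, where F = DT and F' = "\<lambda>p h. D2T x h p"])
      (use linear_DT linear_D2T(2)[OF x] DT_has_derivative[OF x] M.christoffel_has_derivative[OF x] in
          auto)
  have "frechet_derivative (\<lambda>y. DT y (M.\<Gamma> y u v)) (at x) z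
      = frechet_derivative (\<lambda>y. M'.\<Gamma> (T y) (DT y u) (DT y v) + D2T y u v) (at x) z"
    by (rule frechet_derivative_cong_open[OF M.open_S x christoffel_change, THEN fun_cong])
  then show ?thesis
    using frechet_derivativeI[OF 3, THEN fun_cong, of z]
      frechet_derivativeI[OF has_derivative_add[OF 2 D2T_has_derivative[OF x, where u = u
          and v = v]], THEN fun_cong, of z] by simp
qed

text \<open>The curvature is \<open>D\<Gamma> + \<Gamma>\<Gamma>\<close> antisymmetrised in its
  first two arguments. Under \<open>T\<close> this expression acquires terms with second and third
  derivatives, but these are symmetric in the two arguments and drop out.\<close>

lemma curvature_change:
  assumes x: "x \<in> S"
  shows "DT x (curvature G x z u v) = curvature G' (T x) (DT x z) (DT x u) (DT x v)"
proof -
  note Tx = T_in[OF x]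
  have D: "M'.D\<Gamma> (T x) (DT x z) (DT x u) (DT x v) + M'.\<Gamma> (T x) (DT x z) (M'.\<Gamma> (T x) (DT x u) (DT x v))
    = DT x (M.D\<Gamma> x z u v + M.\<Gamma> x z (M.\<Gamma> x u v))
      - (M'.\<Gamma> (T x) (DT x u) (D2T x z v) + M'.\<Gamma> (T x) (DT x z) (D2T x u v)
         + M'.\<Gamma> (T x) (D2T x z u) (DT x v) + frechet_derivative (\<lambda>y. D2T y u v) (at x) z)" for z u
  proof -
    have "M'.\<Gamma> (T x) (DT x u) (DT x v) = DT x (M.\<Gamma> x u v) - D2T x u v"
      using christoffel_change[OF x, where u = u and v = v] by simp
    then have "M'.\<Gamma> (T x) (DT x z) (M'.\<Gamma> (T x) (DT x u) (DT x v))
        = M'.\<Gamma> (T x) (DT x z) (DT x (M.\<Gamma> x u v)) - M'.\<Gamma> (T x) (DT x z) (D2T x u v)"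
      by (simp add: linear_diff[OF M'.christoffel_linear(1)[OF Tx]])
    also have "M'.\<Gamma> (T x) (DT x z) (DT x (M.\<Gamma> x u v)) = DT x (M.\<Gamma> x z (M.\<Gamma> x u v)) - D2T x z (M.\<Gamma> x u v)"
      using christoffel_change[OF x, where u = z and v = "M.\<Gamma> x u v"] by simp
    finally have c1: "M'.\<Gamma> (T x) (DT x z) (M'.\<Gamma> (T x) (DT x u) (DT x v))
        = DT x (M.\<Gamma> x z (M.\<Gamma> x u v)) - D2T x z (M.\<Gamma> x u v) - M'.\<Gamma> (T x) (DT x z) (D2T x u v)" .
    have c2: "M'.D\<Gamma> (T x) (DT x z) (DT x u) (DT x v)
        = D2T x z (M.\<Gamma> x u v) + DT x (M.D\<Gamma> x z u v) - M'.\<Gamma> (T x) (DT x u) (D2T x z v)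
          - M'.\<Gamma> (T x) (D2T x z u) (DT x v) - frechet_derivative (\<lambda>y. D2T y u v) (at x) z"
      unfolding christoffel_change_derivative[OF x, where z = z and u = u and v = v] by simp
    show ?thesis unfolding c1 c2 linear_add[OF linear_DT[OF x]] by (simp add: algebra_simps)
  qed
  have "curvature G' (T x) (DT x z) (DT x u) (DT x v)
      = DT x (M.D\<Gamma> x z u v + M.\<Gamma> x z (M.\<Gamma> x u v)) - DT x (M.D\<Gamma> x u z v + M.\<Gamma> x u (M.\<Gamma> x z v))"
  proof -
    \<comment> \<open>The non-tensorial part. Exchanging \<open>z\<close> and \<open>u\<close>
      permutes its first two terms and fixes the others by symmetry of second and third
      derivatives.\<close>
    let ?Y = "\<lambda>z u. M'.\<Gamma> (T x) (DT x u) (D2T x z v) + M'.\<Gamma> (T x) (DT x z) (D2T x u v)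
         + M'.\<Gamma> (T x) (D2T x z u) (DT x v) + frechet_derivative (\<lambda>y. D2T y u v) (at x) z"
    have Y: "?Y z u = ?Y u z"
      using D2T_sym[OF x, where u = u and v = z] D3T_sym[OF x, where u = u and v = v and w = z]
      by (simp add: add.commute)
    have "a - b + c - d = (a + c) - (b + d)" for a b c d :: 'a by simp
    then have "curvature G' (T x) (DT x z) (DT x u) (DT x v)
      = (M'.D\<Gamma> (T x) (DT x z) (DT x u) (DT x v) + M'.\<Gamma> (T x) (DT x z) (M'.\<Gamma> (T x) (DT x u) (DT x v)))
        - (M'.D\<Gamma> (T x) (DT x u) (DT x z) (DT x v) + M'.\<Gamma> (T x) (DT x u) (M'.\<Gamma> (T x) (DT x z) (DT x v)))"
      unfolding M'.curvature_eq[OF Tx] by blast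
    then show ?thesis unfolding D Y by simp
  qed
  then show ?thesis
    unfolding M.curvature_eq[OF x] by (simp add: linear_add[OF linear_DT[OF x]] linear_diff[OF
        linear_DT[OF x]] algebra_simps)
qed

end

section \<open>Charts and curves\<close>

lemma metric_patch_subset:
  assumes "metric_patch G S" "open T" "T \<subseteq> S"
  shows "metric_patch G T"
proof -
  interpret metric_patch G S by (rule assms(1))
  show ?thesis
    using assms(2,3) G_bilin G_sym G_nondeg smooth_on_subset[OF G_smooth assms(3)]
    by unfold_locales blast+
qed

definition overlap :: "('m, 'a) chart \<Rightarrow> ('m, 'a) chart \<Rightarrow> 'a set" where
  "overlap c c' = cmap c ` (cdom c \<inter> cdom c')"

locale semi_riem =
  fixes M :: "'m::{t2_space, second_countable_topology} set"
    and A :: "('m, 'a::euclidean_space) chart set" and g :: "('m, 'a) chart \<Rightarrow> 'a local_metric"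
  assumes srm: "semi_riemannian_manifold M A g"
begin

lemma smooth_manifold: "smooth_manifold M A"
  using srm by (simp add: semi_riemannian_manifold_def)

lemma chart:
  assumes "c \<in> A"
  shows open_cdom: "open (cdom c)" and open_cimg: "open (cimg c)"
    and chart_homeo: "homeomorphism (cdom c) (cimg c) (cmap c) (inv_into (cdom c) (cmap c))"
  using smooth_manifold assms by (auto simp: smooth_manifold_def is_chart_def)

lemma exists_chart: "p \<in> M \<Longrightarrow> \<exists>c\<in>A. p \<in> cdom c"
  using smooth_manifold unfolding smooth_manifold_def by blast

lemma cmap_inverse: "c \<in> A \<Longrightarrow> p \<in> cdom c \<Longrightarrow> inv_into (cdom c) (cmap c) (cmap c p) = p"
  using homeomorphism_apply1[OF chart_homeo] by blast

lemma continuous_on_cmap: "c \<in> A \<Longrightarrow> continuous_on (cdom c) (cmap c)"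
  using homeomorphism_cont1[OF chart_homeo] by blast

lemma open_cmap_image:
  assumes c: "c \<in> A" and U: "open U"
  shows "open (cmap c ` (cdom c \<inter> U))"
proof -
  have "cmap c ` (cdom c \<inter> U) = cimg c \<inter> inv_into (cdom c) (cmap c) -` U"
    using cmap_inverse[OF c] by auto
  moreover have "open (cimg c \<inter> inv_into (cdom c) (cmap c) -` U)"
    by (rule continuous_open_preimage[OF homeomorphism_cont2[OF chart_homeo[OF c]] open_cimg[OF c] U])
  ultimately show ?thesis by simp
qed

lemma open_overlap: "c \<in> A \<Longrightarrow> c' \<in> A \<Longrightarrow> open (overlap c c')"
  unfolding overlap_def by (rule open_cmap_image[OF _ open_cdom])

lemma cmap_in_overlap: "p \<in> cdom c \<Longrightarrow> p \<in> cdom c' \<Longrightarrow> cmap c p \<in> overlap c c'"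
  by (simp add: overlap_def)

lemma transition_cmap: "c \<in> A \<Longrightarrow> p \<in> cdom c \<Longrightarrow> transition c c' (cmap c p) = cmap c' p"
  by (simp add: transition_def cmap_inverse)

lemma smooth_transition: "c \<in> A \<Longrightarrow> c' \<in> A \<Longrightarrow> smooth_on (transition c c') (overlap c c')"
  using smooth_manifold by (auto simp: smooth_manifold_def smooth_compatible_def overlap_def)

lemma transition_has_derivative:
  assumes "c \<in> A" "c' \<in> A" "p \<in> cdom c" "p \<in> cdom c'"
  shows "(transition c c' has_derivative tangent_change c c' p) (at (cmap c p))"
  unfolding tangent_change_def
  by (rule smooth_on_has_derivative[OF smooth_transition[OF assms(1,2)] cmap_in_overlap[OF assms(3,4)]])

lemma linear_tangent_change:
  "c \<in> A \<Longrightarrow> c' \<in> A \<Longrightarrow> p \<in> cdom c \<Longrightarrow> p \<in> cdom c' \<Longrightarrow> linear (tangent_change c c' p)"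
  by (rule has_derivative_linear[OF transition_has_derivative])

lemma tangent_change_trans:
  assumes c: "c \<in> A" "c' \<in> A" "c'' \<in> A" and p: "p \<in> cdom c" "p \<in> cdom c'" "p \<in> cdom c''"
  shows "tangent_change c' c'' p (tangent_change c c' p v) = tangent_change c c'' p v"
proof -
  let ?U = "cmap c ` (cdom c \<inter> (cdom c' \<inter> cdom c''))"
  have U: "open ?U" by (rule open_cmap_image[OF c(1)]) (intro open_Int open_cdom c)
  have pU: "cmap c p \<in> ?U" using p by blast
  have t: "transition c c' (cmap c p) = cmap c' p" by (rule transition_cmap[OF c(1) p(1)])
  have "((\<lambda>x. transition c' c'' (transition c c' x)) has_derivative
      (\<lambda>v. tangent_change c' c'' p (tangent_change c c' p v))) (at (cmap c p))"
    using diff_chain_at[OF transition_has_derivative[OF c(1,2) p(1,2)], of "transition c' c''"]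
      transition_has_derivative[OF c(2,3) p(2,3)] by (simp add: t comp_def)
  then have "(transition c c'' has_derivative
      (\<lambda>v. tangent_change c' c'' p (tangent_change c c' p v))) (at (cmap c p))"
    by (rule has_derivative_transform_within_open[OF _ U pU]) (auto simp: transition_cmap c)
  from has_derivative_unique[OF this transition_has_derivative[OF c(1,3) p(1,3)]]
  show ?thesis by (rule fun_cong)
qed

lemma tangent_change_refl:
  assumes c: "c \<in> A" and p: "p \<in> cdom c"
  shows "tangent_change c c p v = v"
proof -
  have "((\<lambda>x. x) has_derivative (\<lambda>v. v)) (at (cmap c p))" by (rule has_derivative_ident)
  then have "(transition c c has_derivative (\<lambda>v. v)) (at (cmap c p))"
    by (rule has_derivative_transform_within_open[OF _ open_cimg[OF c]]) (use p in \<open>auto simp: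
        transition_cmap c\<close>)
  from has_derivative_unique[OF transition_has_derivative[OF c c p p] this]
  show ?thesis by (rule fun_cong)
qed

lemma tangent_change_inverse:
  assumes "c \<in> A" "c' \<in> A" "p \<in> cdom c" "p \<in> cdom c'"
  shows "tangent_change c' c p (tangent_change c c' p v) = v"
  using tangent_change_trans[OF assms(1,2,1,3,4,3)] tangent_change_refl[OF assms(1,3)] by simp

lemma metric_patch_chart:
  assumes "c \<in> A"
  shows "metric_patch (g c) (cimg c)"
proof
  show "open (cimg c)" by (rule open_cimg[OF assms])
  fix u v
  show "smooth_on (\<lambda>x. g c x u v) (cimg c)"
    using srm assms by (auto simp: semi_riemannian_manifold_def)
  fix x assume x: "x \<in> cimg c"
  then have "bilinear (g c x) \<and> (\<forall>u v. g c x u v = g c x v u) \<and> nondegenerate_on UNIV (g c x)"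
    using srm assms unfolding semi_riemannian_manifold_def by blast
  then show "bilinear (g c x)" "g c x u v = g c x v u" "(\<And>v. g c x u v = 0) \<Longrightarrow> u = 0"
    by (auto simp: nondegenerate_on_def)
qed

lemma overlap_subset: "overlap c c' \<subseteq> cimg c"
  by (auto simp: overlap_def)

lemma metric_tangent_change:
  assumes "c \<in> A" "c' \<in> A" "p \<in> cdom c" "p \<in> cdom c'"
  shows "g c (cmap c p) u v = g c' (cmap c' p) (tangent_change c c' p u) (tangent_change c c' p v)"
  using srm assms unfolding semi_riemannian_manifold_def by blast

lemma metric_change_chart:
  assumes c: "c \<in> A" "c' \<in> A"
  shows "metric_change (g c) (overlap c c') (g c') (cimg c') (transition c c')"
proof -
  interpret M: metric_patch "g c" "overlap c c'"
    by (rule metric_patch_subset[OF metric_patch_chart[OF c(1)] open_overlap[OF c] overlap_subset])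
  interpret M': metric_patch "g c'" "cimg c'" by (rule metric_patch_chart[OF c(2)])
  show ?thesis
  proof
    show "smooth_on (transition c c') (overlap c c')" by (rule smooth_transition[OF c])
    fix x assume "x \<in> overlap c c'"
    then obtain p where p: "x = cmap c p" "p \<in> cdom c" "p \<in> cdom c'" by (auto simp: overlap_def)
    then show "transition c c' x \<in> cimg c'" by (simp add: transition_cmap c)
    show "surj (frechet_derivative (transition c c') (at x))"
      using tangent_change_inverse[OF c(2,1) p(3,2)] unfolding tangent_change_def p(1) by (metis surjI)
    show "g c x u v = g c' (transition c c' x) (frechet_derivative (transition c c') (at x) u)
        (frechet_derivative (transition c c') (at x) v)" for u v
      using metric_tangent_change[OF c p(2,3)]
          by (simp add: p(1) transition_cmap[OF c(1) p(2)] tangent_change_def)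
  qed
qed

end

section \<open>Covariant differentiation along the geodesic and its independence of charts\<close>

locale geodesic_setting = semi_riem M A g
  for M :: "'m::{t2_space, second_countable_topology} set"
    and A :: "('m, 'a::euclidean_space) chart set" and g +
  fixes a b :: real and \<gamma> :: "real \<Rightarrow> 'm"
  assumes ab: "a < b" and geod: "geodesic M A g a b \<gamma>"
begin

abbreviation vel :: "('m, 'a) chart \<Rightarrow> real \<Rightarrow> 'a" where "vel \<equiv> velocity a b \<gamma>"

abbreviation pos :: "('m, 'a) chart \<Rightarrow> real \<Rightarrow> 'a" where "pos c t \<equiv> cmap c (\<gamma> t)"

lemma gamma_continuous: "continuous_on {a..b} \<gamma>"
  using geod by (simp add: geodesic_def)

lemma exists_chart_at: "t \<in> {a..b} \<Longrightarrow> \<exists>c\<in>A. \<gamma> t \<in> cdom c"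
  using geod by (intro exists_chart) (auto simp: geodesic_def)

lemma pos_in: "\<gamma> t \<in> cdom c \<Longrightarrow> pos c t \<in> cimg c"
  by simp

lemma near_chart:
  assumes c: "c \<in> A" and t: "t \<in> {a..b}" "\<gamma> t \<in> cdom c"
  obtains d where "d > 0" "\<And>s. s \<in> {a..b} \<Longrightarrow> dist s t < d \<Longrightarrow> \<gamma> s \<in> cdom c"
proof -
  have "((\<gamma>) \<longlongrightarrow> \<gamma> t) (at t within {a..b})" using gamma_continuous t by (simp add: continuous_on_def)
  then have "\<forall>\<^sub>F s in at t within {a..b}. \<gamma> s \<in> cdom c" using open_cdom[OF c] t(2)
      by (rule topological_tendstoD)
  then obtain d where "d > 0" "\<And>s. s \<in> {a..b} \<Longrightarrow> s \<noteq> t \<Longrightarrow> dist s t < d \<Longrightarrow> \<gamma> s \<in> cdom c"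
    unfolding eventually_at by blast
  then show thesis using that[of d] t(2) by metis
qed

lemma pos_has_vector_derivative:
  assumes "c \<in> A" "t \<in> {a..b}" "\<gamma> t \<in> cdom c"
  shows "(pos c has_vector_derivative vel c t) (at t within {a..b})"
proof -
  have "(cmap c \<circ> \<gamma>) differentiable (at t within {a..b})" using geod assms by (auto simp: geodesic_def)
  then show ?thesis by (simp add: vector_derivative_works velocity_def comp_def)
qed

text \<open>This is where \<open>a < b\<close> enters: on such an interval the one-sided derivatives
  at the end points are unique as well.\<close>

lemma unique_within:
  assumes "t \<in> {a..b}" "(f has_vector_derivative u) (at t within {a..b})"
      "(f has_vector_derivative v) (at t within {a..b})"
  shows "u = v"
  using vector_derivative_within_cbox[of a b t f] assms ab by (simp add: cbox_interval) metis

lemma vel_change: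
  assumes c: "c \<in> A" "c' \<in> A" and t: "t \<in> {a..b}" "\<gamma> t \<in> cdom c" "\<gamma> t \<in> cdom c'"
  shows "vel c' t = tangent_change c c' (\<gamma> t) (vel c t)"
proof -
  obtain d where d: "d > 0" "\<And>s. s \<in> {a..b} \<Longrightarrow> dist s t < d \<Longrightarrow> \<gamma> s \<in> cdom c"
    using near_chart[OF c(1) t(1,2)] by blast
  have "((\<lambda>s. transition c c' (pos c s)) has_vector_derivative tangent_change c c' (\<gamma> t) (vel c t)) (at
      t within {a..b})"
    using vector_derivative_diff_chain_within[OF pos_has_vector_derivative[OF c(1) t(1,2)], of
        "transition c c'"]
      has_derivative_at_withinI[OF transition_has_derivative[OF c t(2,3)]] by (simp add: comp_def)
  then have "(pos c' has_vector_derivative tangent_change c c' (\<gamma> t) (vel c t)) (at t within {a..b})"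
    by (rule has_vector_derivative_transform_within[OF _ d(1) t(1)]) (use d(2) transition_cmap[OF c(1)]
        in auto)
  then show ?thesis using pos_has_vector_derivative[OF c(2) t(1,3)] unique_within[OF t(1)] by blast
qed

text \<open>\<open>Y\<close> is the covariant derivative of \<open>X\<close> at \<open>t\<close>. As
  a relation it includes differentiability, and it is relative to \<open>I\<close> so that it
  applies to solutions on subintervals; the velocity remains that of the curve on
  \<open>{a..b}\<close>.\<close>

definition cov_rel :: "real set \<Rightarrow> ('m, 'a) chart \<Rightarrow> (real \<Rightarrow> 'a) \<Rightarrow> 'a \<Rightarrow> real \<Rightarrow> bool" where
  "cov_rel I c X Y t \<longleftrightarrow>
     (X has_vector_derivative (Y - christoffel (g c) (pos c t) (vel c t) (X t))) (at t within I)"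

lemma patch_along:
  assumes "c \<in> A" "t \<in> I" "I \<subseteq> {a..b}" "\<gamma> t \<in> cdom c"
  shows "(pos c has_vector_derivative vel c t) (at t within I)"
  using pos_has_vector_derivative[of c t] assms has_vector_derivative_within_subset by blast

text \<open>Differentiating the derivative of the transition map along the curve produces a term
  \<open>D2T\<close>, which cancels against the inhomogeneous term in the transformation of the
  Christoffel map.\<close>

lemma cov_rel_change:
  assumes c: "c \<in> A" "c' \<in> A" and t: "t \<in> I" "I \<subseteq> {a..b}" "\<gamma> t \<in> cdom c" "\<gamma> t \<in> cdom c'"
    and X: "cov_rel I c X Y t"
    and X': "\<And>s. s \<in> I \<Longrightarrow> \<gamma> s \<in> cdom c \<Longrightarrow> \<gamma> s \<in> cdom c' \<Longrightarrow> X' s = tangent_change c c' (\<gamma> s) (X s)"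
  shows "cov_rel I c' X' (tangent_change c c' (\<gamma> t) Y) t"
proof -
  interpret metric_change "g c" "overlap c c'" "g c'" "cimg c'" "transition c c'"
    by (rule metric_change_chart[OF c])
  have tab: "t \<in> {a..b}" using t by auto
  obtain d where d: "d > 0" "\<And>s. s \<in> {a..b} \<Longrightarrow> dist s t < d \<Longrightarrow> \<gamma> s \<in> cdom c"
    using near_chart[OF c(1) tab t(3)] by blast
  obtain d' where d': "d' > 0" "\<And>s. s \<in> {a..b} \<Longrightarrow> dist s t < d' \<Longrightarrow> \<gamma> s \<in> cdom c'"
    using near_chart[OF c(2) tab t(4)] by blast
  \<comment> \<open>The part of \<open>I\<close> near \<open>t\<close> on which the curve lies in
    both charts; derivatives at \<open>t\<close> are unaffected by this restriction.\<close>
  define N where "N = I \<inter> ball t (min d d')"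
  have tN: "t \<in> N" using t d d' by (simp add: N_def)
  have N: "\<gamma> s \<in> cdom c" "\<gamma> s \<in> cdom c'" "s \<in> I" if "s \<in> N" for s
    using that d(2)[of s] d'(2)[of s] t(2) by (auto simp: N_def dist_commute)
  have atN: "at t within I = at t within N"
    unfolding N_def by (rule at_within_nhd[of t "ball t (min d d')"]) (use d d' in auto)
  let ?x = "pos c t"
  have x: "?x \<in> overlap c c'" using t by (intro cmap_in_overlap)
  have pd: "(pos c has_vector_derivative vel c t) (at t within N)"
    using patch_along[OF c(1) t(1,2,3)] by (simp add: atN)
  have F: "((\<lambda>s. DT (pos c s) v) has_derivative (\<lambda>h. h *\<^sub>R D2T ?x (vel c t) v)) (at t within N)" for v
    using vector_derivative_diff_chain_within[OF pd has_derivative_at_withinI[OF DT_has_derivative[OF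
        x]], of v]
    by (simp add: comp_def has_vector_derivative_def)
  have Xd: "(X has_derivative (\<lambda>h. h *\<^sub>R (Y - M.\<Gamma> ?x (vel c t) (X t)))) (at t within N)"
    using X by (simp add: cov_rel_def has_vector_derivative_def atN)
  have "((\<lambda>s. DT (pos c s) (X s)) has_derivative
      (\<lambda>h. h *\<^sub>R D2T ?x (vel c t) (X t) + DT ?x (h *\<^sub>R (Y - M.\<Gamma> ?x (vel c t) (X t))))) (at t within N)"
  proof (rule has_derivative_linear_apply[OF tN _ F _ Xd])
    show "linear (DT (pos c s))" if "s \<in> N" for s
      by (rule linear_DT[OF cmap_in_overlap[OF N(1,2)[OF that]]])
    show "linear (\<lambda>v. h *\<^sub>R D2T ?x (vel c t) v)" for h
      by (rule linear_compose_scale_right[OF linear_D2T(2)[OF x]])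
  qed
  moreover have "h *\<^sub>R D2T ?x (vel c t) (X t) + DT ?x (h *\<^sub>R (Y - M.\<Gamma> ?x (vel c t) (X t)))
      = h *\<^sub>R (DT ?x Y - M'.\<Gamma> (pos c' t) (vel c' t) (X' t))" for h
  proof -
    have "DT ?x (h *\<^sub>R (Y - M.\<Gamma> ?x (vel c t) (X t))) = h *\<^sub>R (DT ?x Y - DT ?x (M.\<Gamma> ?x (vel c t) (X t)))"
      using linear_DT[OF x] by (simp add: linear_cmul linear_diff)
    moreover have "DT ?x (M.\<Gamma> ?x (vel c t) (X t)) = M'.\<Gamma> (pos c' t) (vel c' t) (X' t) + D2T ?x (vel c t)
        (X t)"
      using christoffel_change[OF x, where u = "vel c t" and v = "X t"] vel_change[OF c tab t(3,4)]
        X'[OF t(1,3,4)] transition_cmap[OF c(1) t(3)] by (simp add: tangent_change_def)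
    ultimately show ?thesis by (simp add: algebra_simps)
  qed
  ultimately have "((\<lambda>s. DT (pos c s) (X s)) has_vector_derivative
      (DT ?x Y - M'.\<Gamma> (pos c' t) (vel c' t) (X' t))) (at t within N)"
    by (simp add: has_vector_derivative_def)
  then have "(X' has_vector_derivative (DT ?x Y - M'.\<Gamma> (pos c' t) (vel c' t) (X' t))) (at t within N)"
    by (rule has_vector_derivative_transform[OF tN, rotated]) (use X' N in \<open>simp add:
        tangent_change_def\<close>)
  then show ?thesis by (simp add: cov_rel_def atN tangent_change_def)
qed

text \<open>The derivative of the metric along the curve is taken up by the two Christoffel terms,
  by \<open>metric_compatible\<close>.\<close>

lemma metric_product_rule:
  assumes c: "c \<in> A" and t: "t \<in> I" "I \<subseteq> {a..b}" "\<gamma> t \<in> cdom c"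
    and X: "cov_rel I c X Y t" and X': "cov_rel I c X' Y' t"
  shows "((\<lambda>s. g c (pos c s) (X s) (X' s)) has_vector_derivative
    (g c (pos c t) Y (X' t) + g c (pos c t) (X t) Y')) (at t within I)"
proof -
  interpret metric_patch "g c" "cimg c" by (rule metric_patch_chart[OF c])
  have tab: "t \<in> {a..b}" using t by auto
  obtain d where d: "d > 0" "\<And>s. s \<in> {a..b} \<Longrightarrow> dist s t < d \<Longrightarrow> \<gamma> s \<in> cdom c"
    using near_chart[OF c tab t(3)] by blast
  define N where "N = I \<inter> ball t d"
  have tN: "t \<in> N" using t d by (simp add: N_def)
  have N: "pos c s \<in> cimg c" if "s \<in> N" for s
    using that d(2)[of s] t(2) by (auto simp: N_def dist_commute)
  have atN: "at t within I = at t within N"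
    unfolding N_def by (rule at_within_nhd[of t "ball t d"]) (use d in auto)
  let ?x = "pos c t"
  have x: "?x \<in> cimg c" by (rule N[OF tN])
  note lin = DG_linear[OF x] G_linear[OF x]
  have pd: "(pos c has_vector_derivative vel c t) (at t within N)"
    using patch_along[OF c t(1,2,3)] by (simp add: atN)
  have F: "((\<lambda>s. g c (pos c s) u v) has_derivative (\<lambda>h. h *\<^sub>R DG ?x (vel c t) u v)) (at t within N)" for
      u v
    using vector_derivative_diff_chain_within[OF pd has_derivative_at_withinI[OF G_has_derivative[OF
        x]], of u v]
    by (simp add: comp_def has_vector_derivative_def)
  let ?x1 = "Y - \<Gamma> ?x (vel c t) (X t)" and ?x2 = "Y' - \<Gamma> ?x (vel c t) (X' t)"
  have Xd: "(X has_derivative (\<lambda>h. h *\<^sub>R ?x1)) (at t within N)"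
      "(X' has_derivative (\<lambda>h. h *\<^sub>R ?x2)) (at t within N)"
    using X X' by (simp_all add: cov_rel_def has_vector_derivative_def atN)
  have 1: "((\<lambda>s. g c (pos c s) u (X' s)) has_derivative
      (\<lambda>h. h *\<^sub>R DG ?x (vel c t) u (X' t) + g c ?x u (h *\<^sub>R ?x2))) (at t within N)" for u
    by (rule has_derivative_linear_apply[OF tN _ F _ Xd(2)])
      (use N G_linear(1) linear_compose_scale_right[OF lin(3)] in blast)+
  have "linear (\<lambda>u. h *\<^sub>R DG ?x (vel c t) u (X' t) + g c ?x u (h *\<^sub>R ?x2))" for h
    by (rule linear_compose_add[OF linear_compose_scale_right[OF lin(2)] lin(5)])
  then have "((\<lambda>s. g c (pos c s) (X s) (X' s)) has_derivative
      (\<lambda>h. (h *\<^sub>R DG ?x (vel c t) (X t) (X' t) + g c ?x (X t) (h *\<^sub>R ?x2)) + g c ?x (h *\<^sub>R ?x1) (X' t)))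
          (at t within N)"
    by (intro has_derivative_linear_apply[OF tN _ 1 _ Xd(1)] G_linear(2) N)
  moreover have "(h *\<^sub>R DG ?x (vel c t) (X t) (X' t) + g c ?x (X t) (h *\<^sub>R ?x2)) + g c ?x (h *\<^sub>R ?x1)
      (X' t)
      = h *\<^sub>R (g c ?x Y (X' t) + g c ?x (X t) Y')" for h
    unfolding metric_compatible[OF x] by (simp add: G_simps[OF x] algebra_simps)
  ultimately show ?thesis by (simp add: has_vector_derivative_def atN)
qed

end

section \<open>Linear differential equations\<close>

text \<open>Compactness bounds the images of the basis vectors, and linearity turns these bounds
  into a uniform operator bound.\<close>

lemma bounded_family:
  fixes A :: "real \<Rightarrow> 'e::euclidean_space \<Rightarrow> 'e"
  assumes lin: "\<And>t. t \<in> {p..q} \<Longrightarrow> linear (A t)" and cont: "\<And>v. continuous_on {p..q} (\<lambda>t. A t v)"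
  obtains C where "C > 0" "\<And>t v. t \<in> {p..q} \<Longrightarrow> norm (A t v) \<le> C * norm v"
proof -
  have "\<forall>e. \<exists>B. \<forall>t\<in>{p..q}. norm (A t e) \<le> B"
  proof
    fix e
    have "bounded ((\<lambda>t. A t e) ` {p..q})"
      by (rule compact_imp_bounded[OF compact_continuous_image[OF cont compact_Icc]])
    then show "\<exists>B. \<forall>t\<in>{p..q}. norm (A t e) \<le> B" by (auto simp: bounded_iff)
  qed
  then obtain B where B: "\<And>e t. t \<in> {p..q} \<Longrightarrow> norm (A t e) \<le> B e" by metis
  let ?C = "1 + (\<Sum>e\<in>Basis. \<bar>B e\<bar>)"
  have "norm (A t v) \<le> ?C * norm v" if t: "t \<in> {p..q}" for t v
  proof -
    have "norm (A t v) = norm (\<Sum>e\<in>Basis. (v \<bullet> e) *\<^sub>R A t e)"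
      using linear_euclidean_expand[OF lin[OF t], of v] by simp
    also have "\<dots> \<le> (\<Sum>e\<in>Basis. norm ((v \<bullet> e) *\<^sub>R A t e))" by (rule norm_sum)
    also have "\<dots> \<le> (\<Sum>e\<in>Basis. \<bar>B e\<bar> * norm v)"
    proof (rule sum_mono)
      fix e :: 'e assume e: "e \<in> Basis"
      have "\<bar>v \<bullet> e\<bar> * norm (A t e) \<le> norm v * \<bar>B e\<bar>"
        using Basis_le_norm[OF e, of v] B[OF t, of e] by (intro mult_mono) auto
      then show "norm ((v \<bullet> e) *\<^sub>R A t e) \<le> \<bar>B e\<bar> * norm v" by (simp add: mult.commute)
    qed
    also have "\<dots> = (\<Sum>e\<in>Basis. \<bar>B e\<bar>) * norm v" by (simp only: sum_distrib_right)
    also have "\<dots> \<le> ?C * norm v" by (simp add: distrib_right)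
    finally show ?thesis .
  qed
  moreover have "(\<Sum>e\<in>Basis. \<bar>B e\<bar>) \<ge> 0" by (rule sum_nonneg) simp
  then have "?C > 0" by linarith
  ultimately show thesis using that by blast
qed

text \<open>Picard's integral operator is a contraction with constant 1/2, thanks to
  \<open>small\<close>. Only existence is claimed; uniqueness of Jacobi fields will come from the
  Wronskian.\<close>

lemma linear_ode_local:
  fixes A :: "real \<Rightarrow> 'e::euclidean_space \<Rightarrow> 'e"
  assumes lin: "\<And>t. t \<in> {p..q} \<Longrightarrow> linear (A t)" and cont: "\<And>v. continuous_on {p..q} (\<lambda>t. A t v)"
    and C: "\<And>t v. t \<in> {p..q} \<Longrightarrow> norm (A t v) \<le> C * norm v" "C > 0"
    and small: "(q - p) * C \<le> 1/2" and pq: "p \<le> q"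
  shows "\<exists>y. y p = y0 \<and> (\<forall>t\<in>{p..q}. (y has_vector_derivative A t (y t)) (at t within {p..q}))"
proof -
  define h where "h x t = y0 + integral {p..t} (\<lambda>s. A s (apply_bcontfun x s))" for x :: "real \<Rightarrow>\<^sub>C 'e"
      and t
  have cA: "continuous_on {p..q} (\<lambda>s. A s (apply_bcontfun x s))" for x :: "real \<Rightarrow>\<^sub>C 'e"
    by (rule continuous_on_linear_apply[OF lin cont]) (auto intro: continuous_on_apply_bcontfun)
  have iA: "(\<lambda>s. A s (apply_bcontfun x s)) integrable_on {p..t}" if "t \<in> {p..q}" for t
      and x :: "real \<Rightarrow>\<^sub>C 'e"
    by (rule integrable_continuous_real[OF continuous_on_subset[OF cA]]) (use that in auto)
  have ch: "continuous_on (cbox p q) (h x)" for x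
    unfolding h_def cbox_interval
    by (intro continuous_intros indefinite_integral_continuous_1 integrable_continuous_real cA)
  \<comment> \<open>The fixed point is sought among bounded continuous functions on the whole line;
    \<open>clamp\<close> extends a function on \<open>[p,q]\<close> by its values at the end
    points.\<close>
  define F where "F x = Bcontfun (\<lambda>t. h x (clamp p q t))" for x
  have hb: "(\<lambda>t. h x (clamp p q t)) \<in> bcontfun" for x
    unfolding bcontfun_def
  proof (intro CollectI conjI)
    show "continuous_on UNIV (\<lambda>t. h x (clamp p q t))" by (rule clamp_continuous_on[OF ch])
    have "bounded (h x ` cbox p q)" by (rule compact_imp_bounded[OF compact_continuous_image[OF ch
        compact_cbox]])
    then show "bounded (range (\<lambda>t. h x (clamp p q t)))" using clamp_bounded by blast
  qed
  have Fx: "apply_bcontfun (F x) t = h x (clamp p q t)" for x t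
    unfolding F_def using Bcontfun_inverse[OF hb] by simp
  have "dist (F x) (F y) \<le> 1/2 * dist x y" for x y
  proof (rule dist_bound)
    fix t :: real
    let ?t = "clamp p q t"
    have t: "?t \<in> {p..q}" using clamp_in_interval[of p q t] pq by (simp add: cbox_interval)
    have "h x ?t - h y ?t = integral {p..?t} (\<lambda>s. A s (apply_bcontfun x s) - A s (apply_bcontfun y s))"
      unfolding h_def by (simp add: integral_diff[OF iA[OF t] iA[OF t]])
    also have "norm \<dots> \<le> integral {p..?t} (\<lambda>s. C * dist x y)"
    proof (rule integral_norm_bound_integral)
      show "(\<lambda>s. A s (apply_bcontfun x s) - A s (apply_bcontfun y s)) integrable_on {p..?t}"
        by (rule integrable_diff[OF iA[OF t] iA[OF t]])
      fix s assume s: "s \<in> {p..?t}"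
      then have s': "s \<in> {p..q}" using t by auto
      have "norm (A s (apply_bcontfun x s) - A s (apply_bcontfun y s)) = norm (A s (apply_bcontfun x s -
          apply_bcontfun y s))"
        by (simp add: linear_diff[OF lin[OF s']])
      also have "\<dots> \<le> C * norm (apply_bcontfun x s - apply_bcontfun y s)" by (rule C(1)[OF s'])
      also have "\<dots> \<le> C * dist x y"
        using dist_bounded[of x s y] C(2) by (intro mult_left_mono) (auto simp: dist_norm)
      finally show "norm (A s (apply_bcontfun x s) - A s (apply_bcontfun y s)) \<le> C * dist x y" .
    qed (rule integrable_const_ivl)
    also have "\<dots> = ((?t - p) * C) * dist x y" using t by simp
    also have "\<dots> \<le> 1/2 * dist x y"
    proof (rule mult_right_mono)
      have "(?t - p) * C \<le> (q - p) * C" using t C(2) by (intro mult_right_mono) auto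
      then show "(?t - p) * C \<le> 1/2" using small by linarith
    qed simp
    finally show "dist (apply_bcontfun (F x) t) (apply_bcontfun (F y) t) \<le> 1/2 * dist x y"
      by (simp add: Fx dist_norm)
  qed
  then have "\<exists>!x. F x = x"
    by (intro banach_fix_type[of "1/2" F]) auto
  then obtain x where x: "F x = x" by blast
  have xt: "apply_bcontfun x t = h x t" if "t \<in> {p..q}" for t
    using Fx[of x t] clamp_cancel_cbox[of t p q] that by (simp add: x cbox_interval)
  have "(apply_bcontfun x has_vector_derivative A t (apply_bcontfun x t)) (at t within {p..q})" if t:
      "t \<in> {p..q}" for t
  proof -
    have "(h x has_vector_derivative (A t (apply_bcontfun x t))) (at t within {p..q})"
      unfolding h_def using has_vector_derivative_add[OF has_vector_derivative_const
        integral_has_vector_derivative[OF cA t, of x]] by simp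
    then show ?thesis by (rule has_vector_derivative_transform[OF t, rotated]) (rule xt)
  qed
  moreover have "apply_bcontfun x p = y0" using xt[of p] pq by (simp add: h_def)
  ultimately show ?thesis by blast
qed

section \<open>Jacobi fields\<close>

text \<open>At \<open>\<tau> = u\<close> the limits from the two sides combine; elsewhere one of the
  pieces is the whole function near \<open>\<tau>\<close>.\<close>

lemma has_vector_derivative_glue:
  fixes f1 f2 :: "real \<Rightarrow> 'e::real_normed_vector"
  assumes \<tau>: "\<tau> \<in> {s..t}" and su: "s \<le> u" "u \<le> t"
    and 1: "\<tau> \<le> u \<Longrightarrow> (f1 has_vector_derivative D) (at \<tau> within {s..u})"
    and 2: "u \<le> \<tau> \<Longrightarrow> (f2 has_vector_derivative D) (at \<tau> within {u..t})"
    and eq: "\<tau> = u \<Longrightarrow> f1 u = f2 u"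
  shows "((\<lambda>x. if x \<le> u then f1 x else f2 x) has_vector_derivative D) (at \<tau> within {s..t})" (is
      "(?f has_vector_derivative D) _")
proof -
  consider "\<tau> < u" | "\<tau> = u" | "\<tau> > u" by linarith
  then show ?thesis
  proof cases
    case 1
    have "at \<tau> within {s..t} = at \<tau> within {s..u}"
      by (rule at_within_nhd[of \<tau> "{..<u}"]) (use 1 su in auto)
    moreover have "(?f has_vector_derivative D) (at \<tau> within {s..u})"
      by (rule has_vector_derivative_transform[OF _ _ assms(4)]) (use 1 \<tau> in auto)
    ultimately show ?thesis by simp
  next
    case 3
    have "at \<tau> within {s..t} = at \<tau> within {u<..t}"
      by (rule at_within_nhd[of \<tau> "{u<..}"]) (use 3 su in auto)
    moreover have "(f2 has_vector_derivative D) (at \<tau> within {u<..t})"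
      by (rule has_vector_derivative_within_subset[OF assms(5)]) (use 3 in auto)
    then have "(?f has_vector_derivative D) (at \<tau> within {u<..t})"
      by (rule has_vector_derivative_transform[rotated 2]) (use 3 \<tau> in auto)
    ultimately show ?thesis by simp
  next
    case c: 2
    have "(?f has_vector_derivative D) (at \<tau> within {s..u})"
      by (rule has_vector_derivative_transform[OF _ _ assms(4)]) (use c su in auto)
    moreover have "(?f has_vector_derivative D) (at \<tau> within {u..t})"
      by (rule has_vector_derivative_transform[OF _ _ assms(5)]) (use c su eq in auto)
    moreover have "{s..t} = {s..u} \<union> {u..t}" using su by auto
    ultimately show ?thesis
      unfolding has_vector_derivative_def has_derivative_within by (simp add: Lim_within_Un)
  qed
qed

section \<open>Continuity of a family of Lagrangians from its closed graph\<close>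

context symplectic begin

text \<open>\<open>N\<close> inverts the identification with the dual space given by
  \<open>\<omega>\<close>; it converts Euclidean orthogonality to a set into membership in its
  symplectic orthogonal.\<close>

lemma omega_dual:
  obtains N where "linear N" "\<And>w y. \<omega> (N w) y = w \<bullet> y"
proof -
  define F where "F u = (\<Sum>b\<in>Basis. \<omega> u b *\<^sub>R b)" for u
  have lin: "linear F"
    unfolding F_def by (intro linearI) (simp_all add: omega_simps algebra_simps sum.distrib
        scaleR_sum_right)
  have linw: "linear (\<omega> u)" for u using bilin by (simp add: bilinear_def)
  have F: "F u \<bullet> y = \<omega> u y" for u y
    unfolding F_def using linear_euclidean_expand[OF linw, of u y]
    by (simp add: inner_sum_left inner_commute[of y] mult.commute)
  have "inj F"
    unfolding linear_injective_0[OF lin]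
  proof (intro allI impI)
    fix u assume "F u = 0"
    then have "\<omega> u y = 0" for y using F[of u y] by simp
    then show "u = 0" by (rule nondeg)
  qed
  then obtain N where N: "linear N" "\<And>x. N (F x) = x" "\<And>x. F (N x) = x"
    using linear_injective_isomorphism[OF lin] by blast
  then show thesis using that[of N] F N(3) by metis
qed

text \<open>A closed graph suffices: if \<open>P\<close> is the projection onto a Lagrangian \<open>L\<close>, then not only \<open>P x\<close> but also
  \<open>N (x - P x)\<close> lies in \<open>orth L = L\<close>, and these two conditions determine \<open>P x\<close>.\<close>

lemma lag_continuous_onI:
  fixes l :: "'p::metric_space \<Rightarrow> 'v set"
  assumes lag: "\<And>s. s \<in> S \<Longrightarrow> lagrangian \<omega> (l s)"
    and closed: "\<And>x y m k. x \<in> S \<Longrightarrow> (\<And>n::nat. y n \<in> S) \<Longrightarrow> y \<longlonglongrightarrow> x \<Longrightarrow> (\<And>n. m n \<in> l (y n)) \<Longrightarrow> m \<longlonglongrightarrow> k \<Longrightarrow> k \<in> l x"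
  shows "lag_continuous_on \<omega> S l"
  unfolding lag_continuous_on_def
proof (intro conjI ballI allI lag)
  fix x :: 'v
  let ?P = "\<lambda>s. closest_point (l s) x"
  obtain N where N: "linear N" "\<And>w y. \<omega> (N w) y = w \<bullet> y" by (rule omega_dual) (assumption | rule that)+
  have sub: "subspace (l s)" if "s \<in> S" for s by (rule lagrangianD(1)[OF lag[OF that]])
  have cl: "closed (l s)" "convex (l s)" "l s \<noteq> {}" if "s \<in> S" for s
    using sub[OF that] by (auto simp: closed_subspace subspace_imp_convex dest: subspace_0)
  have P: "?P s \<in> l s" if "s \<in> S" for s by (rule closest_point_in_set[OF cl(1,3)[OF that]])
  have Porth: "(x - ?P s) \<bullet> y = 0" if s: "s \<in> S" and y: "y \<in> l s" for s y
  proof -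
    have "?P s + y \<in> l s" "?P s - y \<in> l s" using P[OF s] y sub[OF s]
        by (auto intro: subspace_add subspace_diff)
    then have "(x - ?P s) \<bullet> (?P s + y - ?P s) \<le> 0" "(x - ?P s) \<bullet> (?P s - y - ?P s) \<le> 0"
      using closest_point_dot[OF cl(2,1)[OF s]] by blast+
    then show ?thesis by (simp add: inner_diff_right)
  qed
  have NP: "N (x - ?P s) \<in> l s" if s: "s \<in> S" for s
  proof -
    have "N (x - ?P s) \<in> orth (l s)" using Porth[OF s] by (simp add: orth_def N(2))
    then show ?thesis using orth_lagrangian[OF lag[OF s]] by simp
  qed
  have uniq: "z = ?P s" if s: "s \<in> S" and z: "z \<in> l s" "N (x - z) \<in> l s" for s z
  proof -
    have "\<omega> (N (x - z)) y = 0" if "y \<in> l s" for y using lagrangianD(2)[OF lag[OF s] z(2) that] .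
    then have o: "(x - z) \<bullet> y = 0" if "y \<in> l s" for y using that by (simp add: N(2))
    have "z - ?P s \<in> l s" using z P[OF s] sub[OF s] by (intro subspace_diff)
    then have "(x - z) \<bullet> (z - ?P s) = 0" "(x - ?P s) \<bullet> (z - ?P s) = 0" using o Porth[OF s] by auto
    then have "(z - ?P s) \<bullet> (z - ?P s) = 0" by (simp add: inner_diff_left)
    then show ?thesis by simp
  qed
  have bound: "norm (?P s) \<le> norm x" if s: "s \<in> S" for s
  proof -
    have "(x - ?P s) \<bullet> ?P s = 0" by (rule Porth[OF s P[OF s]])
    then have "?P s \<bullet> ?P s = x \<bullet> ?P s" by (simp add: inner_diff_left)
    then have "norm (?P s) * norm (?P s) \<le> norm x * norm (?P s)"
      using norm_cauchy_schwarz[of x "?P s"] by (simp add: dot_square_norm power2_eq_square)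
    then show ?thesis by (cases "?P s = 0") auto
  qed
  show "continuous_on S ?P"
    unfolding continuous_on_sequentially
  proof (intro allI ballI impI, elim conjE)
    fix y :: "nat \<Rightarrow> 'p" and s assume s: "s \<in> S" and y: "\<forall>n. y n \<in> S" "y \<longlonglongrightarrow> s"
    show "(?P \<circ> y) \<longlonglongrightarrow> ?P s"
    proof (rule ccontr)
      assume "\<not> (?P \<circ> y) \<longlonglongrightarrow> ?P s"
      then obtain e where e: "e > 0" and nev: "\<not> (\<forall>\<^sub>F n in sequentially. dist (?P (y n)) (?P s) < e)"
        by (auto simp: tendsto_iff)
      have "\<forall>n0. \<exists>n>n0. \<not> dist (?P (y n)) (?P s) < e"
        using nev unfolding eventually_sequentially by (meson Suc_le_eq)
      then have "infinite {n. \<not> dist (?P (y n)) (?P s) < e}"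
        unfolding infinite_nat_iff_unbounded by auto
      \<comment> \<open>A subsequence along which the projections stay at distance at least
        \<open>e\<close> from the expected limit. They are bounded by \<open>norm x\<close>, so a
        further subsequence converges, and \<open>uniq\<close> forces its limit to be the expected
        one.\<close>
      then obtain r :: "nat \<Rightarrow> nat" where r: "strict_mono r" "\<And>n. r n \<in> {n. \<not> dist (?P (y n)) (?P s) < e}"
        using infinite_enumerate by blast
      have "\<forall>n. ?P (y (r n)) \<in> cball 0 (norm x)" using bound y(1) by simp
      then obtain z q where z: "z \<in> cball 0 (norm x)" "strict_mono q" "((\<lambda>n. ?P (y (r n))) \<circ> q) \<longlonglongrightarrow> z"
        by (rule seq_compactE[OF compact_cball[of "0::'v" "norm x", unfolded
            compact_eq_seq_compact_metric]])
      have lim: "(\<lambda>n. ?P (y (r (q n)))) \<longlonglongrightarrow> z" using z(3) by (simp add: comp_def)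
      have yl: "(\<lambda>n. y (r (q n))) \<longlonglongrightarrow> s"
        using LIMSEQ_subseq_LIMSEQ[OF LIMSEQ_subseq_LIMSEQ[OF y(2) r(1)] z(2)] by (simp add: comp_def)
      have "z \<in> l s"
        by (rule closed[OF s _ yl _ lim]) (use y(1) P in auto)
      moreover have "N (x - z) \<in> l s"
      proof (rule closed[OF s _ yl])
        show "(\<lambda>n. N (x - ?P (y (r (q n))))) \<longlonglongrightarrow> N (x - z)"
          by (intro bounded_linear.tendsto[OF N(1)[unfolded linear_conv_bounded_linear]] tendsto_intros
              lim)
      qed (use y(1) NP in auto)
      ultimately have "z = ?P s" by (rule uniq[OF s])
      then have "\<forall>\<^sub>F n in sequentially. dist (?P (y (r (q n)))) (?P s) < e"
        using tendstoD[OF lim e] by simp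
      then show False using r(2) by (auto simp: eventually_sequentially)
    qed
  qed
qed

end

context semi_riem begin

lemma symplectic_chart:
  assumes "c \<in> A" "x \<in> cimg c"
  shows "symplectic (symp_form (g c x))"
proof
  interpret metric_patch "g c" "cimg c" by (rule metric_patch_chart[OF assms(1)])
  note s = G_simps[OF assms(2)]
  show "bilinear (symp_form (g c x))"
    by (subst bilinear_def, intro conjI allI linearI) (auto simp: symp_form_def split_beta s
        algebra_simps)
  fix z z' :: "'a \<times> 'a"
  show "symp_form (g c x) z z' = - symp_form (g c x) z' z"
    by (auto simp: symp_form_def split_beta)
  assume 0: "\<And>z'. symp_form (g c x) z z' = 0"
  have "g c x (fst z) w = 0" for w using 0[of "(0, w)"] by (simp add: symp_form_def split_beta s)
  moreover have "g c x (snd z) w = 0" for w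
    using 0[of "(w, 0)"] by (simp add: symp_form_def split_beta s G_sym[OF assms(2), of "snd z" w])
  ultimately have "fst z = 0" "snd z = 0" using G_nondeg[OF assms(2)] by blast+
  then show "z = 0" by (simp add: prod_eq_iff)
qed

end

section \<open>Jacobi fields as first-order systems: existence on all of the interval\<close>

context geodesic_setting begin

definition field_on :: "real set \<Rightarrow> (('m, 'a) chart \<Rightarrow> real \<Rightarrow> 'a) \<Rightarrow> bool" where
  "field_on I X \<longleftrightarrow> (\<forall>c\<in>A. \<forall>c'\<in>A. \<forall>t\<in>I. \<gamma> t \<in> cdom c \<longrightarrow> \<gamma> t \<in> cdom c' \<longrightarrow>
     X c' t = tangent_change c c' (\<gamma> t) (X c t))"

definition Rv :: "('m, 'a) chart \<Rightarrow> real \<Rightarrow> 'a \<Rightarrow> 'a" where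
  "Rv c t v = curvature (g c) (pos c t) (vel c t) v (vel c t)"

text \<open>The covariant derivative \<open>K\<close> is carried as a second unknown, which makes
  the equation a first-order system. This also frees the notion from \<open>cov_deriv\<close>, which
  is tied to \<open>[a,b]\<close>, while solutions are constructed on subintervals.\<close>

definition jac :: "real set \<Rightarrow> (('m, 'a) chart \<Rightarrow> real \<Rightarrow> 'a) \<Rightarrow> (('m, 'a) chart \<Rightarrow> real \<Rightarrow> 'a) \<Rightarrow> bool" where
  "jac I J K \<longleftrightarrow> field_on I J \<and> field_on I K \<and>
     (\<forall>c\<in>A. \<forall>t\<in>I. \<gamma> t \<in> cdom c \<longrightarrow>
        cov_rel I c (J c) (K c t) t \<and> cov_rel I c (K c) (Rv c t (J c t)) t)"

lemma field_onD:
  "field_on I X \<Longrightarrow> c \<in> A \<Longrightarrow> c' \<in> A \<Longrightarrow> t \<in> I \<Longrightarrow> \<gamma> t \<in> cdom c \<Longrightarrow> \<gamma> t \<in> cdom c' \<Longrightarrow>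
    X c' t = tangent_change c c' (\<gamma> t) (X c t)"
  unfolding field_on_def by blast

lemma jacD:
  assumes "jac I J K"
  shows "field_on I J" "field_on I K"
    and "c \<in> A \<Longrightarrow> t \<in> I \<Longrightarrow> \<gamma> t \<in> cdom c \<Longrightarrow> cov_rel I c (J c) (K c t) t"
    and "c \<in> A \<Longrightarrow> t \<in> I \<Longrightarrow> \<gamma> t \<in> cdom c \<Longrightarrow> cov_rel I c (K c) (Rv c t (J c t)) t"
  using assms unfolding jac_def by blast+

lemma linear_Rv: "c \<in> A \<Longrightarrow> \<gamma> t \<in> cdom c \<Longrightarrow> linear (Rv c t)"
  unfolding Rv_def using metric_patch.curvature_linear(2)[OF metric_patch_chart] pos_in by blast

lemma Rv_change:
  assumes c: "c \<in> A" "c' \<in> A" and t: "t \<in> {a..b}" "\<gamma> t \<in> cdom c" "\<gamma> t \<in> cdom c'"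
  shows "Rv c' t (tangent_change c c' (\<gamma> t) v) = tangent_change c c' (\<gamma> t) (Rv c t v)"
  using metric_change.curvature_change[OF metric_change_chart[OF c] cmap_in_overlap[OF t(2,3)]]
    vel_change[OF c t] transition_cmap[OF c(1) t(2)]
  by (simp add: Rv_def tangent_change_def)

lemma cov_deriv_rel:
  assumes "c \<in> A" "t \<in> {a..b}" "\<gamma> t \<in> cdom c" "X c differentiable (at t within {a..b})"
  shows "cov_rel {a..b} c (X c) (cov_deriv g a b \<gamma> X c t) t"
  using assms by (simp add: cov_rel_def cov_deriv_def vector_derivative_works)

lemma cov_deriv_eq:
  assumes "t \<in> {a..b}" "cov_rel {a..b} c (X c) Y t"
  shows "cov_deriv g a b \<gamma> X c t = Y"
proof -
  have "vector_derivative (X c) (at t within {a..b}) = Y - christoffel (g c) (pos c t) (vel c t) (X c t)"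
    using vector_derivative_within_cbox[of a b t "X c"] ab assms by (simp add: cov_rel_def cbox_interval)
  then show ?thesis by (simp add: cov_deriv_def)
qed

text \<open>\<open>jacobi_field\<close> asks for compatibility with changes of charts of
  \<open>J\<close> only; for its covariant derivative this follows from
  \<open>cov_rel_change\<close> and the uniqueness of derivatives.\<close>

lemma jac_of_jacobi_field:
  assumes J: "jacobi_field A g a b \<gamma> J"
  shows "jac {a..b} J (cov_deriv g a b \<gamma> J)"
proof -
  let ?K = "cov_deriv g a b \<gamma> J"
  have fJ: "field_on {a..b} J"
    using J unfolding jacobi_field_def field_along_def field_on_def by blast
  have d: "J c differentiable (at t within {a..b})" "?K c differentiable (at t within {a..b})"
      "cov_deriv g a b \<gamma> ?K c t - Rv c t (J c t) = 0"
    if "c \<in> A" "t \<in> {a..b}" "\<gamma> t \<in> cdom c" for c t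
    using J that unfolding jacobi_field_def Rv_def by blast+
  have r1: "cov_rel {a..b} c (J c) (?K c t) t" if "c \<in> A" "t \<in> {a..b}" "\<gamma> t \<in> cdom c" for c t
    by (rule cov_deriv_rel[where X = J, OF that d(1)[OF that]])
  have r2: "cov_rel {a..b} c (?K c) (Rv c t (J c t)) t" if "c \<in> A" "t \<in> {a..b}" "\<gamma> t \<in> cdom c" for c t
    using cov_deriv_rel[where X = ?K, OF that] d(2,3)[OF that] by simp
  have "field_on {a..b} ?K"
    unfolding field_on_def
  proof (intro ballI impI)
    fix c c' t assume *: "c \<in> A" "c' \<in> A" "t \<in> {a..b}" "\<gamma> t \<in> cdom c" "\<gamma> t \<in> cdom c'"
    have "cov_rel {a..b} c' (J c') (tangent_change c c' (\<gamma> t) (?K c t)) t"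
      by (rule cov_rel_change[OF *(1,2,3) order_refl *(4,5) r1[OF *(1,3,4)]])
        (use field_onD[OF fJ *(1,2)] in blast)
    then show "?K c' t = tangent_change c c' (\<gamma> t) (?K c t)" by (rule cov_deriv_eq[OF *(3), where X = J])
  qed
  then show ?thesis using fJ r1 r2 by (simp add: jac_def)
qed

lemma jacobi_field_of_jac:
  assumes jac: "jac {a..b} J K"
  shows "jacobi_field A g a b \<gamma> J"
    and "c \<in> A \<Longrightarrow> t \<in> {a..b} \<Longrightarrow> \<gamma> t \<in> cdom c \<Longrightarrow> cov_deriv g a b \<gamma> J c t = K c t"
proof -
  have e: "cov_deriv g a b \<gamma> J c t = K c t" if "c \<in> A" "t \<in> {a..b}" "\<gamma> t \<in> cdom c" for c t
    by (rule cov_deriv_eq[where X = J, OF that(2) jacD(3)[OF jac that]])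
  then show "c \<in> A \<Longrightarrow> t \<in> {a..b} \<Longrightarrow> \<gamma> t \<in> cdom c \<Longrightarrow> cov_deriv g a b \<gamma> J c t = K c t" .
  have r: "cov_rel {a..b} c (cov_deriv g a b \<gamma> J c) (Rv c t (J c t)) t"
    if h: "c \<in> A" "t \<in> {a..b}" "\<gamma> t \<in> cdom c" for c t
  proof -
    obtain d where d: "d > 0" "\<And>s. s \<in> {a..b} \<Longrightarrow> dist s t < d \<Longrightarrow> \<gamma> s \<in> cdom c"
      using near_chart[OF h] by blast
    have "(K c has_vector_derivative (Rv c t (J c t) - christoffel (g c) (pos c t) (vel c t) (K c t)))
        (at t within {a..b})"
      using jacD(4)[OF jac h] by (simp add: cov_rel_def)
    then have "(cov_deriv g a b \<gamma> J c has_vector_derivative (Rv c t (J c t) - christoffel (g c) (pos c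
        t) (vel c t) (K c t))) (at t within {a..b})"
      by (rule has_vector_derivative_transform_within[OF _ d(1) h(2)]) (use d(2) e[OF h(1)] in metis)
    then show ?thesis by (simp add: cov_rel_def e[OF h])
  qed
  show "jacobi_field A g a b \<gamma> J"
    unfolding jacobi_field_def
  proof (intro conjI ballI impI)
    show "field_along A a b \<gamma> J"
      using jacD(1)[OF jac] unfolding field_along_def field_on_def by blast
    fix c t assume *: "c \<in> A" "t \<in> {a..b}" "\<gamma> t \<in> cdom c"
    show "J c differentiable (at t within {a..b})"
      using jacD(3)[OF jac *] unfolding cov_rel_def has_vector_derivative_def differentiable_def by blast
    show "cov_deriv g a b \<gamma> J c differentiable (at t within {a..b})"
      using r[OF *] unfolding cov_rel_def has_vector_derivative_def differentiable_def by blast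
    show "cov_deriv g a b \<gamma> (cov_deriv g a b \<gamma> J) c t
        - curvature (g c) (pos c t) (vel c t) (J c t) (vel c t) = 0"
      using cov_deriv_eq[where X = "cov_deriv g a b \<gamma> J", OF *(2) r[OF *]] by (simp add: Rv_def)
  qed
qed

lemma cov_rel_sum:
  assumes c: "c \<in> A" "\<gamma> t \<in> cdom c" and X: "\<And>e. e \<in> E \<Longrightarrow> cov_rel I c (X e) (Y e) t"
  shows "cov_rel I c (\<lambda>s. \<Sum>e\<in>E. k e *\<^sub>R X e s) (\<Sum>e\<in>E. k e *\<^sub>R Y e) t"
proof -
  have lin: "linear (christoffel (g c) (pos c t) (vel c t))"
    using metric_patch.christoffel_linear(1)[OF metric_patch_chart[OF c(1)] pos_in[OF c(2)]] .
  have "((\<lambda>s. \<Sum>e\<in>E. k e *\<^sub>R X e s) has_vector_derivative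
      (\<Sum>e\<in>E. k e *\<^sub>R (Y e - christoffel (g c) (pos c t) (vel c t) (X e t)))) (at t within I)"
    using X unfolding cov_rel_def
    by (intro has_vector_derivative_sum bounded_linear.has_vector_derivative[OF
        bounded_linear_scaleR_right]) auto
  then show ?thesis
    by (simp add: cov_rel_def linear_sum[OF lin] linear_cmul[OF lin] scaleR_diff_right sum_subtractf)
qed

lemma jac_sum:
  assumes I: "I \<subseteq> {a..b}" and jac: "\<And>e. e \<in> E \<Longrightarrow> jac I (J e) (K e)"
  shows "jac I (\<lambda>c t. \<Sum>e\<in>E. k e *\<^sub>R J e c t) (\<lambda>c t. \<Sum>e\<in>E. k e *\<^sub>R K e c t)"
proof -
  have f: "field_on I (\<lambda>c t. \<Sum>e\<in>E. k e *\<^sub>R X e c t)" if X: "\<And>e. e \<in> E \<Longrightarrow> field_on I (X e)"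
    for X :: "_ \<Rightarrow> ('m, 'a) chart \<Rightarrow> real \<Rightarrow> 'a"
    unfolding field_on_def
  proof (intro ballI impI)
    fix c c' t assume *: "c \<in> A" "c' \<in> A" "t \<in> I" "\<gamma> t \<in> cdom c" "\<gamma> t \<in> cdom c'"
    note lin = linear_tangent_change[OF *(1,2,4,5)]
    show "(\<Sum>e\<in>E. k e *\<^sub>R X e c' t) = tangent_change c c' (\<gamma> t) (\<Sum>e\<in>E. k e *\<^sub>R X e c t)"
      unfolding linear_sum[OF lin] linear_cmul[OF lin]
      by (rule sum.cong[OF refl]) (simp add: field_onD[OF X *])
  qed
  show ?thesis
    unfolding jac_def
  proof (intro conjI ballI impI f)
    fix c t assume *: "c \<in> A" "t \<in> I" "\<gamma> t \<in> cdom c"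
    show "cov_rel I c (\<lambda>t. \<Sum>e\<in>E. k e *\<^sub>R J e c t) (\<Sum>e\<in>E. k e *\<^sub>R K e c t) t"
      by (rule cov_rel_sum[OF *(1,3)]) (rule jacD(3)[OF jac *])
    have "Rv c t (\<Sum>e\<in>E. k e *\<^sub>R J e c t) = (\<Sum>e\<in>E. k e *\<^sub>R Rv c t (J e c t))"
      using linear_Rv[OF *(1,3)] by (simp add: linear_sum linear_cmul)
    then show "cov_rel I c (\<lambda>t. \<Sum>e\<in>E. k e *\<^sub>R K e c t) (Rv c t (\<Sum>e\<in>E. k e *\<^sub>R J e c t)) t"
      using cov_rel_sum[OF *(1,3), of E I "\<lambda>e. K e c" "\<lambda>e. Rv c t (J e c t)" k] jacD(4)[OF jac *] by simp
  qed (use jacD(1,2)[OF jac] in auto)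
qed

text \<open>Inside one chart the pair \<open>(J, K)\<close> solves a linear equation in
  \<open>'a \<times> 'a\<close>. One bound \<open>C\<close> for its coefficients on
  \<open>[p,q]\<close> makes the length \<open>1 / (2 C)\<close> admissible for every
  subinterval.\<close>

lemma jac_local:
  assumes c1: "c1 \<in> A" and pq: "p \<le> q" "{p..q} \<subseteq> {a..b}" and dom: "\<And>t. t \<in> {p..q} \<Longrightarrow> \<gamma> t \<in> cdom c1"
  shows "\<exists>\<delta>>0. \<forall>s t. p \<le> s \<longrightarrow> s \<le> t \<longrightarrow> t \<le> q \<longrightarrow> t - s \<le> \<delta> \<longrightarrow>
    (\<forall>v w. \<exists>J K. jac {s..t} J K \<and> J c1 s = v \<and> K c1 s = w)"
proof -
  interpret metric_patch "g c1" "cimg c1" by (rule metric_patch_chart[OF c1])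
  \<comment> \<open>The system written with ordinary derivatives: each covariant derivative gives up
    its Christoffel term.\<close>
  define B where "B t z = (snd z - \<Gamma> (pos c1 t) (vel c1 t) (fst z), Rv c1 t (fst z) - \<Gamma> (pos c1 t) (vel
      c1 t) (snd z))" for t z
  have inS: "pos c1 t \<in> cimg c1" if "t \<in> {p..q}" for t using dom[OF that] by simp
  have linB: "linear (B t)" if t: "t \<in> {p..q}" for t
    unfolding B_def using christoffel_linear(1)[OF inS[OF t], of "vel c1 t"] linear_Rv[OF c1 dom[OF t]]
    by (intro linearI) (simp_all add: linear_add linear_cmul algebra_simps)
  have cpos: "continuous_on {p..q} (pos c1)"
    using continuous_on_compose2[OF continuous_on_cmap[OF c1] continuous_on_subset[OF gamma_continuous
        pq(2)]] dom by blast
  have cvel: "continuous_on {p..q} (vel c1)"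
    unfolding continuous_on_eq_continuous_within
  proof
    fix t assume t: "t \<in> {p..q}"
    then have "t \<in> {a..b}" "\<gamma> t \<in> cdom c1" using pq(2) dom by auto
    then have "vel c1 differentiable (at t within {a..b})" using geod c1 unfolding geodesic_def by blast
    then have "vel c1 differentiable (at t within {p..q})"
        by (rule differentiable_within_subset[OF _ pq(2)])
    then show "continuous (at t within {p..q}) (vel c1)" by (rule differentiable_imp_continuous_within)
  qed
  have comp: "continuous_on {p..q} (\<lambda>t. F (pos c1 t))" if "continuous_on (cimg c1) F" for F :: "'a \<Rightarrow> 'a"
    using continuous_on_compose2[OF that cpos] inS by blast
  have c\<Gamma>: "continuous_on {p..q} (\<lambda>t. \<Gamma> (pos c1 t) (vel c1 t) v)" for v
    by (rule continuous_on_linear_apply[OF christoffel_linear(2)[OF inS] comp[OF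
        smooth_on_continuous_on[OF christoffel_smooth]] cvel])
  have cR0: "continuous_on {p..q} (\<lambda>t. curvature (g c1) (pos c1 t) (vel c1 t) v u)" for u v
    by (rule continuous_on_linear_apply[OF curvature_linear(1)[OF inS] comp[OF curvature_continuous_on]
        cvel])
  have cR: "continuous_on {p..q} (\<lambda>t. Rv c1 t v)" for v
    unfolding Rv_def
    by (rule continuous_on_linear_apply[OF curvature_linear(3)[OF inS] cR0 cvel])
  have contB: "continuous_on {p..q} (\<lambda>t. B t z)" for z
    unfolding B_def by (intro continuous_intros c\<Gamma> cR)
  obtain C where C: "C > 0" "\<And>t z. t \<in> {p..q} \<Longrightarrow> norm (B t z) \<le> C * norm z"
    using bounded_family[OF linB contB] by blast
  have "\<exists>J K. jac {s..t} J K \<and> J c1 s = v \<and> K c1 s = w"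
    if st: "p \<le> s" "s \<le> t" "t \<le> q" "t - s \<le> 1 / (2 * C)" for s t v w
  proof -
    have sub: "{s..t} \<subseteq> {p..q}" using st by auto
    have "(t - s) * C \<le> 1/2" using st(4) C(1) by (simp add: field_simps)
    then obtain y where y: "y s = (v, w)"
        "\<And>\<tau>. \<tau> \<in> {s..t} \<Longrightarrow> (y has_vector_derivative B \<tau> (y \<tau>)) (at \<tau> within {s..t})"
      using linear_ode_local[of s t B C "(v, w)"] linB contB C st sub
        continuous_on_subset[OF contB sub] by (metis subsetD)
    \<comment> \<open>Components in the other charts are defined by transport from
      \<open>c1\<close>; that they form a field is then the composition rule
      \<open>tangent_change_trans\<close>.\<close>
    define J where "J c \<tau> = tangent_change c1 c (\<gamma> \<tau>) (fst (y \<tau>))" for c \<tau>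
    define K where "K c \<tau> = tangent_change c1 c (\<gamma> \<tau>) (snd (y \<tau>))" for c \<tau>
    have JK1: "J c1 \<tau> = fst (y \<tau>)" "K c1 \<tau> = snd (y \<tau>)" if "\<tau> \<in> {s..t}" for \<tau>
      using tangent_change_refl[OF c1 dom] that sub by (auto simp: J_def K_def)
    have r1: "cov_rel {s..t} c1 (\<lambda>\<tau>. fst (y \<tau>)) (snd (y \<tau>)) \<tau>"
      "cov_rel {s..t} c1 (\<lambda>\<tau>. snd (y \<tau>)) (Rv c1 \<tau> (fst (y \<tau>))) \<tau>" if "\<tau> \<in> {s..t}" for \<tau>
      using bounded_linear.has_vector_derivative[OF bounded_linear_fst y(2)[OF that]]
        bounded_linear.has_vector_derivative[OF bounded_linear_snd y(2)[OF that]]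
      by (simp_all add: cov_rel_def B_def)
    have fields: "field_on {s..t} J" "field_on {s..t} K"
      unfolding field_on_def J_def K_def using tangent_change_trans[OF c1] dom sub by (metis subsetD)+
    have "cov_rel {s..t} c (J c) (K c \<tau>) \<tau> \<and> cov_rel {s..t} c (K c) (Rv c \<tau> (J c \<tau>)) \<tau>"
      if c: "c \<in> A" "\<tau> \<in> {s..t}" "\<gamma> \<tau> \<in> cdom c" for c \<tau>
    proof
      have d1: "\<gamma> \<tau> \<in> cdom c1" and sub': "{s..t} \<subseteq> {a..b}" and \<tau>ab: "\<tau> \<in> {a..b}"
          using dom sub pq(2) c(2) by auto
      show "cov_rel {s..t} c (J c) (K c \<tau>) \<tau>"
        using cov_rel_change[OF c1 c(1,2) sub' d1 c(3) r1(1)[OF c(2)], of "J c"]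
            by (simp add: J_def K_def)
      have "cov_rel {s..t} c (K c) (tangent_change c1 c (\<gamma> \<tau>) (Rv c1 \<tau> (fst (y \<tau>)))) \<tau>"
        by (rule cov_rel_change[OF c1 c(1,2) sub' d1 c(3) r1(2)[OF c(2)]]) (simp add: K_def)
      then show "cov_rel {s..t} c (K c) (Rv c \<tau> (J c \<tau>)) \<tau>"
        using Rv_change[OF c1 c(1) \<tau>ab d1 c(3)] by (simp add: J_def)
    qed
    then have "jac {s..t} J K" using fields by (simp add: jac_def)
    then show ?thesis using JK1[of s] y(1) st(2) by (intro exI[of _ J] exI[of _ K]) simp
  qed
  then show ?thesis using C(1) by (intro exI[of _ "1 / (2 * C)"]) auto
qed

end

context geodesic_setting begin

lemma cov_rel_glue:
  assumes \<tau>: "\<tau> \<in> {s..t}" and su: "s \<le> u" "u \<le> t"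
    and 1: "\<tau> \<le> u \<Longrightarrow> cov_rel {s..u} c X1 Y \<tau>" and 2: "u \<le> \<tau> \<Longrightarrow> cov_rel {u..t} c X2 Y \<tau>"
    and eq: "\<tau> = u \<Longrightarrow> X1 u = X2 u"
  shows "cov_rel {s..t} c (\<lambda>x. if x \<le> u then X1 x else X2 x) Y \<tau>"
  unfolding cov_rel_def
  by (rule has_vector_derivative_glue[OF \<tau> su]) (use 1 2 eq in \<open>auto simp: cov_rel_def\<close>)

text \<open>Agreement at \<open>u\<close> in the one chart \<open>c0\<close> is enough, because the
  components of a field in one chart determine those in every other.\<close>

lemma jac_glue:
  assumes su: "s \<le> u" "u \<le> t" and j1: "jac {s..u} J1 K1" and j2: "jac {u..t} J2 K2"
    and c0: "c0 \<in> A" "\<gamma> u \<in> cdom c0" and eq0: "J1 c0 u = J2 c0 u" "K1 c0 u = K2 c0 u"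
  shows "jac {s..t} (\<lambda>c \<tau>. if \<tau> \<le> u then J1 c \<tau> else J2 c \<tau>) (\<lambda>c \<tau>. if \<tau> \<le> u then K1 c \<tau> else K2 c \<tau>)"
    (is "jac _ ?J ?K")
proof -
  have mem: "u \<in> {s..u}" "u \<in> {u..t}" using su by auto
  have eq: "J1 c u = J2 c u" "K1 c u = K2 c u" if "c \<in> A" "\<gamma> u \<in> cdom c" for c
    using field_onD[OF jacD(1)[OF j1] c0(1) that(1) mem(1) c0(2) that(2)] field_onD[OF jacD(1)[OF j2]
        c0(1) that(1) mem(2) c0(2) that(2)]
      field_onD[OF jacD(2)[OF j1] c0(1) that(1) mem(1) c0(2) that(2)] field_onD[OF jacD(2)[OF j2] c0(1)
          that(1) mem(2) c0(2) that(2)] eq0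
    by simp_all
  have f: "field_on {s..t} (\<lambda>c \<tau>. if \<tau> \<le> u then X1 c \<tau> else X2 c \<tau>)" if "field_on {s..u} X1"
      "field_on {u..t} X2" for X1 X2
    unfolding field_on_def
  proof (intro ballI impI)
    fix c c' \<tau> assume *: "c \<in> A" "c' \<in> A" "\<tau> \<in> {s..t}" "\<gamma> \<tau> \<in> cdom c" "\<gamma> \<tau> \<in> cdom c'"
    show "(if \<tau> \<le> u then X1 c' \<tau> else X2 c' \<tau>) = tangent_change c c' (\<gamma> \<tau>) (if \<tau> \<le> u then X1 c \<tau> else X2
        c \<tau>)"
      using field_onD[OF that(1) *(1,2) _ *(4,5)] field_onD[OF that(2) *(1,2) _ *(4,5)] *(3) by simp
  qed
  have "cov_rel {s..t} c (?J c) (?K c \<tau>) \<tau> \<and> cov_rel {s..t} c (?K c) (Rv c \<tau> (?J c \<tau>)) \<tau>"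
    if c: "c \<in> A" "\<tau> \<in> {s..t}" "\<gamma> \<tau> \<in> cdom c" for c \<tau>
  proof
    have m1: "\<tau> \<in> {s..u}" if "\<tau> \<le> u" using that c(2) by simp
    have m2: "\<tau> \<in> {u..t}" if "u \<le> \<tau>" using that c(2) by simp
    have J2: "?J c \<tau> = J2 c \<tau>" "?K c \<tau> = K2 c \<tau>" if "u \<le> \<tau>"
      using that eq[OF c(1)] c(3) by (cases "\<tau> = u"; simp)+
    note e = eq[OF c(1)]
    show "cov_rel {s..t} c (?J c) (?K c \<tau>) \<tau>"
      by (rule cov_rel_glue[OF c(2) su])
        (use jacD(3)[OF j1 c(1) m1 c(3)] jacD(3)[OF j2 c(1) m2 c(3)] J2 e c(3) in auto)
    show "cov_rel {s..t} c (?K c) (Rv c \<tau> (?J c \<tau>)) \<tau>"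
      by (rule cov_rel_glue[OF c(2) su])
        (use jacD(4)[OF j1 c(1) m1 c(3)] jacD(4)[OF j2 c(1) m2 c(3)] J2 e c(3) in auto)
  qed
  then show ?thesis unfolding jac_def
      using f[OF jacD(1)[OF j1] jacD(1)[OF j2]] f[OF jacD(2)[OF j1] jacD(2)[OF j2]] by blast
qed

definition solvable :: "real \<Rightarrow> real \<Rightarrow> bool" where
  "solvable s t \<longleftrightarrow> (\<forall>c\<in>A. \<gamma> s \<in> cdom c \<longrightarrow> (\<forall>v w. \<exists>J K. jac {s..t} J K \<and> J c s = v \<and> K c s = w))"

lemma solvableD:
  assumes "solvable s t" "c \<in> A" "\<gamma> s \<in> cdom c"
  obtains J K where "jac {s..t} J K" "J c s = v" "K c s = w"
  using assms unfolding solvable_def by blast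

lemma solvable_trans:
  assumes su: "a \<le> s" "s \<le> u" "u \<le> t" "t \<le> b" and 1: "solvable s u" and 2: "solvable u t"
  shows "solvable s t"
  unfolding solvable_def
proof (intro ballI impI allI)
  fix c v w assume c: "c \<in> A" "\<gamma> s \<in> cdom c"
  obtain J1 K1 where j1: "jac {s..u} J1 K1" "J1 c s = v" "K1 c s = w" by (rule solvableD[OF 1 c])
  obtain c0 where c0: "c0 \<in> A" "\<gamma> u \<in> cdom c0" using exists_chart_at[of u] su by auto
  obtain J2 K2 where j2: "jac {u..t} J2 K2" "J2 c0 u = J1 c0 u" "K2 c0 u = K1 c0 u"
      by (rule solvableD[OF 2 c0])
  show "\<exists>J K. jac {s..t} J K \<and> J c s = v \<and> K c s = w"
    by (intro exI conjI, rule jac_glue[OF su(2,3) j1(1) j2(1) c0 j2(2,3)[symmetric]]) (use su(2) j1 in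
        auto)
qed

lemma solvable_local:
  assumes x: "x \<in> {a..b}"
  shows "\<exists>d>0. \<forall>s t. s \<le> x \<and> x \<le> t \<and> t - s < d \<longrightarrow> a \<le> s \<longrightarrow> t \<le> b \<longrightarrow> solvable s t"
proof -
  obtain c1 where c1: "c1 \<in> A" "\<gamma> x \<in> cdom c1" using exists_chart_at[OF x] by blast
  obtain d where d: "d > 0" "\<And>s. s \<in> {a..b} \<Longrightarrow> dist s x < d \<Longrightarrow> \<gamma> s \<in> cdom c1"
    using near_chart[OF c1(1) x c1(2)] by blast
  \<comment> \<open>Half of \<open>d\<close> keeps the closed interval inside the open ball on which
    the curve stays in the chart; the ends are cut off at \<open>a\<close> and
    \<open>b\<close>.\<close>
  define p q where "p = max a (x - d/2)" and "q = min b (x + d/2)"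
  have pq: "p \<le> q" "{p..q} \<subseteq> {a..b}" using x d(1) ab by (auto simp: p_def q_def)
  have dom: "\<gamma> t \<in> cdom c1" if t: "t \<in> {p..q}" for t
  proof (rule d(2))
    show "t \<in> {a..b}" using t pq(2) by blast
    have "t \<le> x + d / 2" "x - d / 2 \<le> t" using t by (auto simp: p_def q_def)
    then have "\<bar>t - x\<bar> \<le> d / 2" by linarith
    then show "dist t x < d" using d(1) by (simp add: dist_real_def)
  qed
  obtain \<delta> where \<delta>: "\<delta> > 0" "\<And>s t v w. p \<le> s \<Longrightarrow> s \<le> t \<Longrightarrow> t \<le> q \<Longrightarrow> t - s \<le> \<delta> \<Longrightarrow>
      \<exists>J K. jac {s..t} J K \<and> J c1 s = v \<and> K c1 s = w"
    using jac_local[OF c1(1) pq dom] by blast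
  have "solvable s t" if st: "s \<le> x" "x \<le> t" "t - s < min \<delta> (d/2)" "a \<le> s" "t \<le> b" for s t
    unfolding solvable_def
  proof (intro ballI impI allI)
    fix c v w assume c: "c \<in> A" "\<gamma> s \<in> cdom c"
    have s: "p \<le> s" "s \<le> t" "t \<le> q" "t - s \<le> \<delta>" using st by (auto simp: p_def q_def)
    have ds: "\<gamma> s \<in> cdom c1" using dom[of s] s by simp
    obtain J K where JK: "jac {s..t} J K" "J c1 s = tangent_change c c1 (\<gamma> s) v"
        "K c1 s = tangent_change c c1 (\<gamma> s) w"
      using \<delta>(2)[OF s] by blast
    have "J c s = v" "K c s = w"
      using field_onD[OF jacD(1)[OF JK(1)] c1(1) c(1) _ ds c(2)] field_onD[OF jacD(2)[OF JK(1)] c1(1)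
          c(1) _ ds c(2)]
        tangent_change_inverse[OF c(1) c1(1) c(2) ds] JK(2,3) s(2) by simp_all
    then show "\<exists>J K. jac {s..t} J K \<and> J c s = v \<and> K c s = w" using JK(1) by blast
  qed
  then show ?thesis using \<delta>(1) d(1) by (intro exI[of _ "min \<delta> (d/2)"]) auto
qed

text \<open>Bisection replaces a finite subdivision by intervals that each lie in one chart.\<close>

lemma solvable: "solvable a b"
proof -
  define Q where "Q s t \<longleftrightarrow> (a \<le> s \<longrightarrow> t \<le> b \<longrightarrow> solvable s t)" for s t
  have "a \<le> b" using ab by simp
  then have "Q a b"
  proof (induction rule: Bolzano)
    case (trans s u t)
    then show ?case unfolding Q_def using solvable_trans[of s u t] by auto
  next
    case (local x)
    then show ?case unfolding Q_def using solvable_local[of x] by simp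
  qed
  then show ?thesis by (simp add: Q_def)
qed

section \<open>The Wronskian and the path of Lagrangians of the geodesic\<close>

abbreviation \<Omega> :: "('m, 'a) chart \<Rightarrow> real \<Rightarrow> 'a \<times> 'a \<Rightarrow> 'a \<times> 'a \<Rightarrow> real" where
  "\<Omega> c t \<equiv> symp_form (g c (pos c t))"

text \<open>The derivative of the Wronskian vanishes by the pair symmetry of the curvature.\<close>

lemma wronskian_constant:
  assumes j: "jac {a..b} J K" and j': "jac {a..b} J' K'"
    and c: "c \<in> A" "t \<in> {a..b}" "\<gamma> t \<in> cdom c" and c0: "c0 \<in> A" "t0 \<in> {a..b}" "\<gamma> t0 \<in> cdom c0"
  shows "\<Omega> c t (J c t, K c t) (J' c t, K' c t) = \<Omega> c0 t0 (J c0 t0, K c0 t0) (J' c0 t0, K' c0 t0)"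
proof -
  define W where "W c t = \<Omega> c t (J c t, K c t) (J' c t, K' c t)" for c t
  have W: "W c t = g c (pos c t) (J' c t) (K c t) - g c (pos c t) (J c t) (K' c t)" for c t
    by (simp add: W_def symp_form_def)
  have indep: "W c t = W c' t" if "c \<in> A" "c' \<in> A" "t \<in> {a..b}" "\<gamma> t \<in> cdom c" "\<gamma> t \<in> cdom c'" for c c' t
    unfolding W metric_tangent_change[OF that(1,2,4,5)]
    by (simp add: field_onD[OF jacD(1)[OF j] that] field_onD[OF jacD(2)[OF j] that]
        field_onD[OF jacD(1)[OF j'] that] field_onD[OF jacD(2)[OF j'] that])
  have dW: "(W c has_vector_derivative 0) (at t within {a..b})" if *: "c \<in> A" "t \<in> {a..b}"
      "\<gamma> t \<in> cdom c" for c t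
  proof -
    interpret metric_patch "g c" "cimg c" by (rule metric_patch_chart[OF *(1)])
    have x: "pos c t \<in> cimg c" using *(3) by simp
    note r = metric_product_rule[OF *(1,2) order_refl *(3)]
    have "(W c has_vector_derivative
        (g c (pos c t) (K' c t) (K c t) + g c (pos c t) (J' c t) (Rv c t (J c t)))
        - (g c (pos c t) (K c t) (K' c t) + g c (pos c t) (J c t) (Rv c t (J' c t)))) (at t within
            {a..b})"
    proof -
      have "W c = (\<lambda>t. g c (pos c t) (J' c t) (K c t) - g c (pos c t) (J c t) (K' c t))" by (intro ext W)
      then show ?thesis
        using has_vector_derivative_diff[OF r[OF jacD(3)[OF j' *] jacD(4)[OF j *]] r[OF jacD(3)[OF j *]
            jacD(4)[OF j' *]]]
        by (simp only:)
    qed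
    moreover have "g c (pos c t) (J' c t) (Rv c t (J c t)) = g c (pos c t) (J c t) (Rv c t (J' c t))"
    proof -
      have "g c (pos c t) (J' c t) (Rv c t (J c t)) = g c (pos c t) (Rv c t (J c t)) (J' c t)"
          by (rule G_sym[OF x])
      also have "\<dots> = g c (pos c t) (Rv c t (J' c t)) (J c t)" unfolding Rv_def
          by (rule curvature_pair_sym[OF x])
      also have "\<dots> = g c (pos c t) (J c t) (Rv c t (J' c t))" by (rule G_sym[OF x])
      finally show ?thesis .
    qed
    moreover have "g c (pos c t) (K' c t) (K c t) = g c (pos c t) (K c t) (K' c t)" by (rule G_sym[OF x])
    ultimately show ?thesis by simp
  qed
  \<comment> \<open>The Wronskian does not depend on the chart, so choosing a chart at each time
    gives one function \<open>V\<close> on \<open>[a,b]\<close>. Near each \<open>t\<close> it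
    agrees with the Wronskian in the fixed chart \<open>ct t\<close>, whose derivative is
    known.\<close>
  define ct where "ct t = (SOME c. c \<in> A \<and> \<gamma> t \<in> cdom c)" for t
  have ct: "ct t \<in> A \<and> \<gamma> t \<in> cdom (ct t)" if "t \<in> {a..b}" for t
    unfolding ct_def by (rule someI_ex) (use exists_chart_at[OF that] in blast)
  define V where "V t = W (ct t) t" for t
  have "(V has_derivative (\<lambda>h. 0)) (at t within {a..b})" if t: "t \<in> {a..b}" for t
  proof -
    note c = conjunct1[OF ct[OF t]] and d = conjunct2[OF ct[OF t]]
    obtain e where e: "e > 0" "\<And>s. s \<in> {a..b} \<Longrightarrow> dist s t < e \<Longrightarrow> \<gamma> s \<in> cdom (ct t)"
      using near_chart[OF c t d] by blast
    have "W (ct t) s = V s" if s: "s \<in> {a..b}" "dist s t < e" for s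
      unfolding V_def by (rule indep[OF c conjunct1[OF ct[OF s(1)]] s(1) e(2)[OF s] conjunct2[OF ct[OF
          s(1)]]])
    then have "(V has_vector_derivative 0) (at t within {a..b})"
      by (rule has_vector_derivative_transform_within[OF dW[OF c t d] e(1) t])
    then show ?thesis by (simp add: has_vector_derivative_def)
  qed
  then obtain k where "\<And>t. t \<in> {a..b} \<Longrightarrow> V t = k"
    using has_derivative_zero_constant[of "{a..b}" V] by auto
  then have "W c t = W c0 t0"
    using indep[OF c(1) _ c(2,3)] indep[OF c0(1) _ c0(2,3)] ct[OF c(2)] ct[OF c0(2)] c(2) c0(2)
        by (metis V_def)
  then show ?thesis by (simp add: W_def)
qed

text \<open>Solutions with basis vectors as initial data are combined linearly. In this way linear
  dependence on the initial data is available before uniqueness is.\<close>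

lemma jacobi_flow:
  assumes c: "c \<in> A" "\<gamma> a \<in> cdom c"
  obtains JJ KK :: "'a \<times> 'a \<Rightarrow> ('m, 'a) chart \<Rightarrow> real \<Rightarrow> 'a"
  where "\<And>z. jac {a..b} (JJ z) (KK z)" "\<And>z. JJ z c a = fst z" "\<And>z. KK z c a = snd z"
    "\<And>c' t. linear (\<lambda>z. JJ z c' t)" "\<And>c' t. linear (\<lambda>z. KK z c' t)"
proof -
  have "\<forall>z. \<exists>J K. jac {a..b} J K \<and> J c a = fst z \<and> K c a = snd z"
    using solvable c unfolding solvable_def by blast
  then obtain J0 K0 where 0: "\<And>z. jac {a..b} (J0 z) (K0 z)" "\<And>z. J0 z c a = fst z" "\<And>z. K0 z c a = snd z"
    by metis
  define JJ where "JJ z c' t = (\<Sum>e\<in>Basis. (z \<bullet> e) *\<^sub>R J0 e c' t)" for z c' t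
  define KK where "KK z c' t = (\<Sum>e\<in>Basis. (z \<bullet> e) *\<^sub>R K0 e c' t)" for z c' t
  have "JJ z = (\<lambda>c t. \<Sum>e\<in>Basis. (z \<bullet> e) *\<^sub>R J0 e c t)" "KK z = (\<lambda>c t. \<Sum>e\<in>Basis. (z \<bullet> e) *\<^sub>R K0 e c t)"
      for z
    by (intro ext; simp add: JJ_def KK_def)+
  then have "jac {a..b} (JJ z) (KK z)" for z
    using jac_sum[where J = J0 and K = K0 and E = Basis and k = "\<lambda>e. z \<bullet> e", OF order_refl 0(1)] by simp
  moreover have "JJ z c a = fst z" "KK z c a = snd z" for z
    using linear_euclidean_expand[OF linear_fst, of z] linear_euclidean_expand[OF linear_snd, of z]
    by (simp_all add: JJ_def KK_def 0)
  moreover have "linear (\<lambda>z. JJ z c' t)" "linear (\<lambda>z. KK z c' t)" for c' t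
    unfolding JJ_def KK_def
    by (intro linearI; simp add: inner_add_left scaleR_add_left sum.distrib scaleR_sum_right)+
  ultimately show thesis by (rule that)
qed

text \<open>\<open>\<Phi> c' t\<close> sends initial data to data at \<open>t\<close>. It is
  symplectic by constancy of the Wronskian, hence bijective, and the Lagrangian at \<open>t\<close>
  is the preimage of \<open>{0} \<times> UNIV\<close>. Continuity reduces to the closed graph, that
  is, to continuity of the solutions in time.\<close>

lemma geodesic_lagrangian_continuous:
  assumes c: "c \<in> A" "\<gamma> a \<in> cdom c"
  shows "lag_continuous_on (\<Omega> c a) {a..b} (geodesic_lagrangian A g a b \<gamma> c)"
proof -
  have aab: "a \<in> {a..b}" using ab by simp
  interpret Va: symplectic "\<Omega> c a" by (rule symplectic_chart[OF c(1)]) (use c(2) in simp)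
  obtain JJ KK :: "'a \<times> 'a \<Rightarrow> ('m, 'a) chart \<Rightarrow> real \<Rightarrow> 'a"
    where jj: "\<And>z. jac {a..b} (JJ z) (KK z)" and init: "\<And>z. JJ z c a = fst z" "\<And>z. KK z c a = snd z"
    and lin: "\<And>c' t. linear (\<lambda>z. JJ z c' t)" "\<And>c' t. linear (\<lambda>z. KK z c' t)"
    by (rule jacobi_flow[OF c]) blast
  define \<Phi> where "\<Phi> c' t z = (JJ z c' t, KK z c' t)" for c' t z
  have lin\<Phi>: "linear (\<Phi> c' t)" for c' t
    unfolding \<Phi>_def by (intro linearI) (simp_all add: linear_add[OF lin(1)] linear_add[OF lin(2)]
        linear_cmul[OF lin(1)] linear_cmul[OF lin(2)])
  have symp: "\<Omega> c' t (\<Phi> c' t z) (\<Phi> c' t z') = \<Omega> c a z z'" if "c' \<in> A" "t \<in> {a..b}" "\<gamma> t \<in> cdom c'" for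
      c' t z z'
    using wronskian_constant[OF jj jj that c(1) aab c(2), of z z'] by (simp add: \<Phi>_def init)
  have inj: "inj (\<Phi> c' t)" if *: "c' \<in> A" "t \<in> {a..b}" "\<gamma> t \<in> cdom c'" for c' t
    unfolding linear_injective_0[OF lin\<Phi>]
  proof (intro allI impI)
    fix z assume z: "\<Phi> c' t z = 0"
    interpret Vt: symplectic "\<Omega> c' t" by (rule symplectic_chart[OF *(1)]) (use *(3) in simp)
    have "\<Omega> c a z z' = 0" for z' using symp[OF *, of z z'] by (simp add: z Vt.omega_simps)
    then show "z = 0" by (rule Va.nondeg)
  qed
  have bij: "surj (\<Phi> c' t)" if "c' \<in> A" "t \<in> {a..b}" "\<gamma> t \<in> cdom c'" for c' t
    by (rule linear_injective_imp_surjective[OF lin\<Phi> inj[OF that]]) (rule refl)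
  \<comment> \<open>Every vector at \<open>t\<close> is some \<open>\<Phi> c' t z'\<close>, and
    against it both solutions have the same Wronskian, namely that of the initial data. Their
    difference is therefore symplectically orthogonal to everything.\<close>
  have uniq: "J c' t = JJ z c' t"
    if j: "jac {a..b} J K" "J c a = fst z" "K c a = snd z"
        and *: "c' \<in> A" "t \<in> {a..b}" "\<gamma> t \<in> cdom c'" for J K z c' t
  proof -
    interpret Vt: symplectic "\<Omega> c' t" by (rule symplectic_chart[OF *(1)]) (use *(3) in simp)
    have "\<Omega> c' t ((J c' t, K c' t) - \<Phi> c' t z) y = 0" for y
    proof -
      obtain z' where z': "y = \<Phi> c' t z'" using bij[OF *] by (metis surjD)
      have "\<Omega> c' t (J c' t, K c' t) y = \<Omega> c a z z'"
        using wronskian_constant[OF j(1) jj * c(1) aab c(2), of z'] by (simp add: z' \<Phi>_def init j(2,3))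
      then show ?thesis using symp[OF *, of z z'] by (simp add: Vt.omega_simps z')
    qed
    then have "(J c' t, K c' t) - \<Phi> c' t z = 0" by (rule Vt.nondeg)
    then show ?thesis by (simp add: \<Phi>_def zero_prod_def)
  qed
  have l: "geodesic_lagrangian A g a b \<gamma> c t = {z. JJ z c1 t = 0}" if *: "c1 \<in> A" "t \<in> {a..b}"
      "\<gamma> t \<in> cdom c1" for c1 t
  proof (intro equalityI subsetI)
    fix z assume "z \<in> geodesic_lagrangian A g a b \<gamma> c t"
    then obtain J where J: "jacobi_field A g a b \<gamma> J" "J c a = fst z" "cov_deriv g a b \<gamma> J c a = snd z"
        "\<And>c'. c' \<in> A \<Longrightarrow> \<gamma> t \<in> cdom c' \<Longrightarrow> J c' t = 0"
      by (auto simp: geodesic_lagrangian_def)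
    have "J c1 t = JJ z c1 t" by (rule uniq[OF jac_of_jacobi_field[OF J(1)] J(2,3) *])
    then show "z \<in> {z. JJ z c1 t = 0}" using J(4)[OF *(1,3)] by simp
  next
    fix z assume "z \<in> {z. JJ z c1 t = 0}"
    then have z: "JJ z c1 t = 0" by simp
    have "JJ z c' t = 0" if "c' \<in> A" "\<gamma> t \<in> cdom c'" for c'
      using field_onD[OF jacD(1)[OF jj] *(1) that(1) *(2,3) that(2)] linear_0[OF
          linear_tangent_change[OF *(1) that(1) *(3) that(2)]]
      by (simp add: z)
    then show "z \<in> geodesic_lagrangian A g a b \<gamma> c t"
      unfolding geodesic_lagrangian_def mem_Collect_eq case_prod_beta
      using jacobi_field_of_jac(1)[OF jj] jacobi_field_of_jac(2)[OF jj c(1) aab c(2)] init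
      by (intro exI[of _ "JJ z"] conjI ballI impI) auto
  qed
  show ?thesis
  proof (rule Va.lag_continuous_onI)
    fix t assume t: "t \<in> {a..b}"
    obtain c1 where c1: "c1 \<in> A" "\<gamma> t \<in> cdom c1" using exists_chart_at[OF t] by blast
    note * = c1(1) t c1(2)
    let ?L = "{z. JJ z c1 t = 0}"
    interpret Vt: symplectic "\<Omega> c1 t" by (rule symplectic_chart[OF *(1)]) (use *(3) in simp)
    have sub: "subspace ?L" by (rule linear_subspace_kernel[OF lin(1)])
    have "\<Omega> c a z z' = 0" if "z \<in> ?L" "z' \<in> ?L" for z z'
    proof -
      have "\<Omega> c a z z' = \<Omega> c1 t (\<Phi> c1 t z) (\<Phi> c1 t z')" by (rule symp[OF *, symmetric])
      also have "\<dots> = 0"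
        using that metric_patch.G_simps(9,10)[OF metric_patch_chart[OF c1(1)] pos_in[OF c1(2)]]
        by (simp add: \<Phi>_def symp_form_def)
      finally show ?thesis .
    qed
    moreover have "\<Phi> c1 t ` ?L = {0} \<times> UNIV"
    proof (intro equalityI subsetI)
      fix y :: "'a \<times> 'a" assume "y \<in> {0} \<times> UNIV"
      moreover obtain z where "y = \<Phi> c1 t z" using bij[OF *] by (metis surjD)
      ultimately show "y \<in> \<Phi> c1 t ` ?L" by (auto simp: \<Phi>_def)
    qed (auto simp: \<Phi>_def)
    moreover have "inj_on (\<Phi> c1 t) (span ?L)" using inj[OF *] by (rule inj_on_subset) simp
    then have "dim (\<Phi> c1 t ` ?L) = dim ?L" by (rule dim_image_eq[OF lin\<Phi>])
    moreover have "dim ({0::'a} \<times> (UNIV :: 'a set)) = DIM('a)"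
      by (simp add: dim_Times subspace_UNIV)
    ultimately show "lagrangian (\<Omega> c a) (geodesic_lagrangian A g a b \<gamma> c t)"
      unfolding l[OF *] lagrangian_def using sub by simp
  next
    fix t and y :: "nat \<Rightarrow> real" and m :: "nat \<Rightarrow> 'a \<times> 'a" and k
    assume t: "t \<in> {a..b}" and y: "\<And>n. y n \<in> {a..b}" "y \<longlonglongrightarrow> t"
      and m: "\<And>n. m n \<in> geodesic_lagrangian A g a b \<gamma> c (y n)" "m \<longlonglongrightarrow> k"
    obtain c1 where c1: "c1 \<in> A" "\<gamma> t \<in> cdom c1" using exists_chart_at[OF t] by blast
    obtain d where d: "d > 0" "\<And>s. s \<in> {a..b} \<Longrightarrow> dist s t < d \<Longrightarrow> \<gamma> s \<in> cdom c1"
      using near_chart[OF c1(1) t c1(2)] by blast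
    have J: "(\<lambda>n. JJ z c1 (y n)) \<longlonglongrightarrow> JJ z c1 t" for z
    proof -
      have "continuous (at t within {a..b}) (JJ z c1)"
        using jacD(3)[OF jj c1(1) t c1(2)] has_vector_derivative_continuous unfolding cov_rel_def
            by blast
      then show ?thesis using y unfolding continuous_within_sequentially by (auto simp: comp_def)
    qed
    \<comment> \<open>Both the initial data and the time vary with \<open>n\<close>. Linearity in
      the data separates them, so continuity in time of finitely many solutions is enough.\<close>
    have "(\<lambda>n. \<Sum>e\<in>Basis. (m n \<bullet> e) *\<^sub>R JJ e c1 (y n)) \<longlonglongrightarrow> (\<Sum>e\<in>Basis. (k \<bullet> e) *\<^sub>R JJ e c1 t)"
      by (intro tendsto_intros m J)
    then have lim: "(\<lambda>n. JJ (m n) c1 (y n)) \<longlonglongrightarrow> JJ k c1 t"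
      unfolding linear_euclidean_expand[OF lin(1), symmetric] .
    have "\<forall>\<^sub>F n in sequentially. dist (y n) t < d" using y(2) d(1) by (rule tendstoD)
    then have "\<forall>\<^sub>F n in sequentially. JJ (m n) c1 (y n) = 0"
    proof eventually_elim
      case (elim n)
      have "\<gamma> (y n) \<in> cdom c1" by (rule d(2)[OF y(1) elim])
      then show ?case using m(1)[of n] l[OF c1(1) y(1)] by auto
    qed
    then have "(\<lambda>n. JJ (m n) c1 (y n)) \<longlonglongrightarrow> 0" by (rule tendsto_eventually)
    then have "JJ k c1 t = 0" by (rule LIMSEQ_unique[OF lim])
    then show "k \<in> geodesic_lagrangian A g a b \<gamma> c t" using l[OF c1(1) t c1(2)] by simp
  qed
qed

end

section \<open>Submanifolds\<close>

text \<open>The product of \<open>f\<close> with the component \<open>z\<close> of \<open>D\<close>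
  orthogonal to \<open>S\<close> is constant near \<open>x\<close>, so \<open>D\<close> has product
  0 with \<open>z\<close>, which forces \<open>z = 0\<close>.\<close>

lemma vector_derivative_in_subspace:
  fixes f :: "real \<Rightarrow> 'e::euclidean_space"
  assumes f: "(f has_vector_derivative D) (at x)" and S: "subspace S"
    and ev: "\<forall>\<^sub>F t in nhds x. f t - f x \<in> S"
  shows "D \<in> S"
proof -
  obtain y z where yz: "y \<in> span S" "\<And>w. w \<in> span S \<Longrightarrow> orthogonal z w" "D = y + z"
    using orthogonal_subspace_decomp_exists[of S D] by blast
  have sp: "span S = S" by (rule span_eq_iff[THEN iffD2, OF S])
  have 1: "((\<lambda>t. f t \<bullet> z) has_vector_derivative D \<bullet> z) (at x)"
    by (rule bounded_linear.has_vector_derivative[OF bounded_linear_inner_left f])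
  obtain U where U: "open U" "x \<in> U" "\<And>t. t \<in> U \<Longrightarrow> f t - f x \<in> S" using ev unfolding eventually_nhds
      by blast
  have "f t \<bullet> z = f x \<bullet> z" if "t \<in> U" for t
    using yz(2)[of "f t - f x"] U(3)[OF that]
        by (simp add: sp orthogonal_def inner_diff_right inner_commute)
  then have "((\<lambda>t. f t \<bullet> z) has_vector_derivative 0) (at x)"
    using has_vector_derivative_transform_within_open[OF has_vector_derivative_const U(1,2), of
        "f x \<bullet> z" "\<lambda>t. f t \<bullet> z"] by simp
  then have "D \<bullet> z = 0" using vector_derivative_unique_at[OF 1] by blast
  then have "z = 0" using yz(1) yz(2)[of y] by (simp add: yz(3) inner_add orthogonal_def inner_commute)
  then show ?thesis using yz sp by simp
qed

section \<open>Slice charts, tangent spaces and fields tangent to a submanifold\<close>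

context semi_riem begin

lemma cmap_overlapD:
  assumes c: "c \<in> A" and q: "q \<in> cdom c" "cmap c q \<in> overlap c c'"
  shows "q \<in> cdom c'"
proof -
  obtain q' where q': "cmap c q = cmap c q'" "q' \<in> cdom c \<inter> cdom c'"
    using q(2) unfolding overlap_def by (rule imageE)
  have "q = inv_into (cdom c) (cmap c) (cmap c q)" by (rule cmap_inverse[OF c q(1), symmetric])
  also have "\<dots> = q'" unfolding q'(1) using q'(2) by (intro cmap_inverse[OF c]) blast
  finally show ?thesis using q'(2) by simp
qed

lemma transition_in_overlap: "c \<in> A \<Longrightarrow> x \<in> overlap c c' \<Longrightarrow> transition c c' x \<in> overlap c' c"
  by (auto simp: overlap_def transition_cmap)

end

text \<open>\<open>c\<close> is the chart in which the Lagrangians are expressed; \<open>c1\<close>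
  is a slice chart around \<open>p\<close>, in which \<open>P\<close> is part of an affine subspace
  with direction \<open>S\<close>.\<close>

locale slice = semi_riem M A g
  for M :: "'m::{t2_space, second_countable_topology} set"
    and A :: "('m, 'a::euclidean_space) chart set" and g +
  fixes P :: "'m set" and p :: 'm and c c1 :: "('m, 'a) chart" and S :: "'a set"
  assumes p: "p \<in> P" "p \<in> cdom c" "p \<in> cdom c1" and c: "c \<in> A" and c1: "c1 \<in> A"
    and S: "subspace S"
    and slice: "cmap c1 ` (P \<inter> cdom c1) = cimg c1 \<inter> (\<lambda>s. cmap c1 p + s) ` S"
begin

lemma mem_slice:
  assumes q: "q \<in> P" "q \<in> cdom c1" and y: "y \<in> overlap c1 c" "y - cmap c1 q \<in> S"
  obtains q' where "q' \<in> P" "q' \<in> cdom c1" "q' \<in> cdom c" "y = cmap c1 q'"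
proof -
  obtain q' where q': "y = cmap c1 q'" "q' \<in> cdom c1" "q' \<in> cdom c" using y(1)
      by (auto simp: overlap_def)
  have "cmap c1 q \<in> (\<lambda>s. cmap c1 p + s) ` S" using slice q by blast
  then obtain s where s: "s \<in> S" "cmap c1 q = cmap c1 p + s" by blast
  have "y = cmap c1 p + (s + (y - cmap c1 q))" by (simp add: s(2))
  moreover have "s + (y - cmap c1 q) \<in> S" by (rule subspace_add[OF S s(1) y(2)])
  ultimately have "y \<in> cmap c1 ` (P \<inter> cdom c1)" unfolding slice using q' by blast
  then obtain q'' where "q'' \<in> P" "q'' \<in> cdom c1" "cmap c1 q'' = cmap c1 q'" using q'(1) by auto
  then have "q' \<in> P" using cmap_inverse[OF c1] q'(2) by metis
  then show thesis using that q' by blast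
qed

lemma slice_diff:
  assumes "q \<in> P" "q \<in> cdom c1" "q' \<in> P" "q' \<in> cdom c1"
  shows "cmap c1 q - cmap c1 q' \<in> S"
proof -
  have "cmap c1 q \<in> (\<lambda>s. cmap c1 p + s) ` S" "cmap c1 q' \<in> (\<lambda>s. cmap c1 p + s) ` S" using slice assms
      by blast+
  then obtain s s' where "s \<in> S" "s' \<in> S" "cmap c1 q = cmap c1 p + s" "cmap c1 q' = cmap c1 p + s'"
      by blast
  then show ?thesis using S by (simp add: subspace_diff)
qed

text \<open>One inclusion follows straight lines of the slice chart; the other reads a curve in
  \<open>P\<close> in the slice chart, where it stays in a translate of \<open>S\<close>. The
  statement covers all \<open>q\<close> near \<open>p\<close> because tangent fields will be
  differentiated along \<open>P\<close>.\<close>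

lemma tangent_space_eq:
  assumes q: "q \<in> P" "q \<in> cdom c" "q \<in> cdom c1"
  shows "tangent_space c P q = tangent_change c1 c q ` S"
proof (intro equalityI subsetI)
  fix v assume "v \<in> tangent_change c1 c q ` S"
  then obtain s where s: "s \<in> S" "v = tangent_change c1 c q s" by blast
  let ?y = "\<lambda>t. cmap c1 q + t *\<^sub>R s"
  let ?O = "overlap c1 c"
  have y0: "cmap c1 q \<in> ?O" by (rule cmap_in_overlap[OF q(3,2)])
  then obtain e where e: "e > 0" "ball (cmap c1 q) e \<subseteq> ?O" using open_overlap[OF c1 c] openE by blast
  \<comment> \<open>Keeps the line inside the ball of radius \<open>e\<close>; the summand 1 covers
    the case \<open>s = 0\<close>.\<close>
  define \<epsilon> where "\<epsilon> = e / (norm s + 1)"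
  have \<epsilon>: "\<epsilon> > 0" using e(1) by (simp add: \<epsilon>_def add_nonneg_pos)
  have yO: "?y t \<in> ?O" if t: "t \<in> {-\<epsilon><..<\<epsilon>}" for t
  proof -
    have "\<bar>t\<bar> * norm s \<le> \<bar>t\<bar> * (norm s + 1)" by (simp add: mult_left_mono)
    also have "\<dots> < \<epsilon> * (norm s + 1)" using t
        by (intro mult_strict_right_mono) (auto simp: add_nonneg_pos)
    also have "\<dots> = e"
    proof -
      have "norm s + 1 \<noteq> 0" using norm_ge_zero[of s] by linarith
      then show ?thesis by (simp add: \<epsilon>_def)
    qed
    finally show ?thesis using e(2) by (auto simp: dist_norm subset_iff)
  qed
  define \<sigma> where "\<sigma> t = inv_into (cdom c1) (cmap c1) (?y t)" for t
  have \<sigma>: "\<sigma> t \<in> P \<and> \<sigma> t \<in> cdom c1 \<and> \<sigma> t \<in> cdom c \<and> cmap c1 (\<sigma> t) = ?y t" if t: "t \<in> {-\<epsilon><..<\<epsilon>}" for t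
  proof -
    have "?y t - cmap c1 q \<in> S" using s S by (simp add: subspace_scale)
    then obtain q' where "q' \<in> P" "q' \<in> cdom c1" "q' \<in> cdom c" "?y t = cmap c1 q'"
      by (rule mem_slice[OF q(1,3) yO[OF t]])
    then show ?thesis using cmap_inverse[OF c1] by (simp add: \<sigma>_def)
  qed
  have c\<sigma>: "(cmap c \<circ> \<sigma>) t = transition c1 c (?y t)" if t: "t \<in> {-\<epsilon><..<\<epsilon>}" for t
    using \<sigma>[OF t] transition_cmap[OF c1, of "\<sigma> t" c] by simp
  have \<sigma>0: "\<sigma> 0 = q" using cmap_inverse[OF c1 q(3)] by (simp add: \<sigma>_def)
  have sm: "smooth_on (cmap c \<circ> \<sigma>) {-\<epsilon><..<\<epsilon>}"
  proof (rule smooth_on_cong)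
    show "smooth_on (\<lambda>t. transition c1 c (?y t)) {-\<epsilon><..<\<epsilon>}"
      by (rule smooth_on_compose[OF _ open_overlap[OF c1 c] _ smooth_transition[OF c1 c]
            smooth_on_affine[OF _ bounded_linear_scaleR_left]]) (use yO in auto)
  qed (use c\<sigma> in simp_all)
  have "((\<lambda>t. transition c1 c (?y t)) has_vector_derivative v) (at 0)"
  proof -
    have "(?y has_vector_derivative s) (at 0)" by (auto intro!: derivative_eq_intros)
    moreover have "(transition c1 c has_derivative tangent_change c1 c q) (at (?y 0))"
      using transition_has_derivative[OF c1 c q(3,2)] by simp
    ultimately show ?thesis
      using vector_derivative_diff_chain_within[of ?y s 0 UNIV "transition c1 c" "tangent_change c1 c q"]
      by (simp add: comp_def s(2) has_derivative_at_withinI)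
  qed
  then have "((cmap c \<circ> \<sigma>) has_vector_derivative v) (at 0)"
    by (rule has_vector_derivative_transform_within_open[of _ _ _ "{-\<epsilon><..<\<epsilon>}"]) (use \<epsilon> c\<sigma> in auto)
  then show "v \<in> tangent_space c P q"
    unfolding tangent_space_def using \<epsilon> \<sigma> \<sigma>0 sm by (intro CollectI exI[of _ \<sigma>] exI[of _ \<epsilon>]) auto
next
  fix v assume "v \<in> tangent_space c P q"
  then obtain \<sigma> \<epsilon> where \<sigma>: "\<epsilon> > 0" "\<sigma> ` {-\<epsilon><..<\<epsilon>} \<subseteq> P \<inter> cdom c" "\<sigma> 0 = q"
    "((cmap c \<circ> \<sigma>) has_vector_derivative v) (at (0::real))" unfolding tangent_space_def by blast
  let ?f = "\<lambda>t. transition c c1 ((cmap c \<circ> \<sigma>) t)"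
  have "isCont (cmap c \<circ> \<sigma>) 0" using \<sigma>(4) by (rule has_vector_derivative_continuous)
  then have "((cmap c \<circ> \<sigma>) \<longlongrightarrow> cmap c q) (nhds 0)" unfolding isCont_def tendsto_at_iff_tendsto_nhds
      by (simp add: \<sigma>(3))
  then have "\<forall>\<^sub>F t in nhds 0. (cmap c \<circ> \<sigma>) t \<in> overlap c c1"
    by (rule topological_tendstoD[OF _ open_overlap[OF c c1] cmap_in_overlap[OF q(2,3)]])
  moreover have "\<forall>\<^sub>F t in nhds 0. t \<in> {-\<epsilon><..<\<epsilon>}"
    using \<sigma>(1) by (intro eventually_nhds_in_open) auto
  ultimately have ev: "\<forall>\<^sub>F t in nhds 0. ?f t - ?f 0 \<in> S"
  proof eventually_elim
    case (elim t)
    then have t: "\<sigma> t \<in> P" "\<sigma> t \<in> cdom c" using \<sigma>(2) by auto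
    then have "\<sigma> t \<in> cdom c1" using cmap_overlapD[OF c t(2)] elim(1) by simp
    then show ?case
      using slice_diff[OF t(1) _ q(1,3)] transition_cmap[OF c t(2)] transition_cmap[OF c q(2)]
          by (simp add: \<sigma>(3))
  qed
  have "(?f has_vector_derivative tangent_change c c1 q v) (at 0)"
    using vector_derivative_diff_chain_within[of "cmap c \<circ> \<sigma>" v 0 UNIV "transition c c1"
        "tangent_change c c1 q"]
      \<sigma>(3,4) has_derivative_at_withinI[OF transition_has_derivative[OF c c1 q(2,3)]]
          by (simp add: comp_def)
  then have "tangent_change c c1 q v \<in> S" using S ev by (rule vector_derivative_in_subspace)
  moreover have "v = tangent_change c1 c q (tangent_change c c1 q v)"
    using tangent_change_inverse[OF c c1 q(2,3)] by simp
  ultimately show "v \<in> tangent_change c1 c q ` S" by blast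
qed

abbreviation T :: "'a set" where "T \<equiv> tangent_space c P p"

lemma T_eq: "T = tangent_change c1 c p ` S"
  by (rule tangent_space_eq[OF p])

lemma subspace_T: "subspace T"
  unfolding T_eq by (rule linear_subspace_image[OF linear_tangent_change[OF c1 c p(3,2)] S])

lemma dim_T: "dim T = dim S"
proof -
  have "inj_on (tangent_change c1 c p) (span S)"
    by (rule inj_on_inverseI[of _ "tangent_change c c1 p"]) (rule tangent_change_inverse[OF c1 c p(3,2)])
  then show ?thesis unfolding T_eq by (rule dim_image_eq[OF linear_tangent_change[OF c1 c p(3,2)]])
qed

text \<open>The field is the one that is constant in the slice chart, read in \<open>c\<close>; by
  \<open>tangent_space_eq\<close> it is tangent to \<open>P\<close> at every nearby point of
  \<open>P\<close>.\<close>

lemma tangent_field_exists: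
  assumes "v \<in> T"
  obtains V where "tangent_field_near c P p V" "V (cmap c p) = v"
proof -
  obtain s where s: "s \<in> S" "v = tangent_change c1 c p s" using assms T_eq by blast
  define V where "V x = frechet_derivative (transition c1 c) (at (transition c c1 x)) s" for x
  have Vq: "V (cmap c q) = tangent_change c1 c q s" if "q \<in> cdom c" for q
    by (simp add: V_def transition_cmap[OF c that] tangent_change_def)
  have "smooth_on V (overlap c c1)"
    unfolding V_def
    by (rule smooth_on_compose[OF open_overlap[OF c c1] open_overlap[OF c1 c] _
          smooth_on_frechet_derivative[OF smooth_transition[OF c1 c]] smooth_transition[OF c c1]])
      (use transition_in_overlap[OF c] in blast)
  moreover have "V (cmap c q) \<in> tangent_space c P q" if q: "q \<in> P \<inter> cdom c" "cmap c q \<in> overlap c c1"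
      for q
  proof -
    have "q \<in> cdom c1" using cmap_overlapD[OF c _ q(2)] q(1) by simp
    then show ?thesis using tangent_space_eq[of q] q(1) s(1) Vq[of q] by auto
  qed
  ultimately have "tangent_field_near c P p V"
    unfolding tangent_field_near_def
    using open_overlap[OF c c1] cmap_in_overlap[OF p(2,3)] overlap_subset[of c c1]
        by (intro exI[of _ "overlap c c1"]) auto
  then show thesis using that Vq[OF p(2)] s(2) by blast
qed

text \<open>Along \<open>P\<close> the field \<open>V\<close> is the image under the chart change of a field \<open>u\<close> with values in \<open>S\<close>. The
  derivative of \<open>u\<close> contributes a tangent vector, which \<open>N\<close> does not see; what is left depends on \<open>V\<close>
  at \<open>p\<close> only.\<close>

lemma nabla_normal:
  assumes V: "tangent_field_near c P p V" and s: "s \<in> S"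
    and N: "\<And>u. u \<in> T \<Longrightarrow> g c (cmap c p) N u = 0"
  shows "g c (cmap c p) (nabla (g c) (\<lambda>_. tangent_change c1 c p s) V (cmap c p)) N
    = g c (cmap c p) (tangent_change c1 c p
        (christoffel (g c1) (cmap c1 p) s (tangent_change c c1 p (V (cmap c p))))) N"
proof -
  interpret C: metric_change "g c1" "overlap c1 c" "g c" "cimg c" "transition c1 c"
    by (rule metric_change_chart[OF c1 c])
  interpret C': metric_change "g c" "overlap c c1" "g c1" "cimg c1" "transition c c1"
    by (rule metric_change_chart[OF c c1])
  obtain W where W: "open W" "cmap c p \<in> W" "smooth_on V W"
    "\<And>q. q \<in> P \<Longrightarrow> q \<in> cdom c \<Longrightarrow> cmap c q \<in> W \<Longrightarrow> V (cmap c q) \<in> tangent_space c P q"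
    using V unfolding tangent_field_near_def by blast
  let ?x = "cmap c p" and ?y = "cmap c1 p"
  let ?y' = "\<lambda>t. ?y + t *\<^sub>R s"
  let ?z = "\<lambda>t. transition c1 c (?y' t)"
  let ?v = "tangent_change c1 c p s"
  have x: "?x \<in> overlap c c1" and y: "?y \<in> overlap c1 c" using p by (auto intro: cmap_in_overlap)
  have xc: "?x \<in> cimg c" using p(2) by simp
  have Ty: "transition c1 c ?y = ?x" by (rule transition_cmap[OF c1 p(3)])
  have dy: "(?y' has_vector_derivative s) (at 0)" by (auto intro!: derivative_eq_intros)
  have dz: "(?z has_vector_derivative ?v) (at 0)"
    using vector_derivative_diff_chain_within[of ?y' s 0 UNIV "transition c1 c" "tangent_change c1 c p"]
      dy has_derivative_at_withinI[OF transition_has_derivative[OF c1 c p(3,2)]] by (simp add: comp_def)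
  have VD: "(V has_derivative frechet_derivative V (at ?x)) (at ?x)"
    by (rule smooth_on_has_derivative[OF W(3,2)])
  have dV: "((\<lambda>t. V (?z t)) has_vector_derivative frechet_derivative V (at ?x) ?v) (at 0)"
    using vector_derivative_diff_chain_within[of ?z ?v 0 UNIV V "frechet_derivative V (at ?x)"]
      dz has_derivative_at_withinI[OF VD] by (simp add: comp_def Ty)
  define O' where "O' = {t. ?y' t \<in> overlap c1 c \<inter> (overlap c1 c \<inter> transition c1 c -` (W \<inter> overlap c
      c1))}"
  have "open (overlap c1 c \<inter> transition c1 c -` (W \<inter> overlap c c1))"
    by (rule continuous_open_preimage[OF smooth_on_continuous_on[OF smooth_transition[OF c1 c]]
        open_overlap[OF c1 c]
          open_Int[OF W(1) open_overlap[OF c c1]]])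
  then have "open (?y' -` (overlap c1 c \<inter> transition c1 c -` (W \<inter> overlap c c1)))"
    by (rule open_vimage) (intro continuous_intros)
  moreover have "?y' -` (overlap c1 c \<inter> transition c1 c -` (W \<inter> overlap c c1)) = O'"
      by (auto simp: O'_def)
  ultimately have O': "open O'" by simp
  have O0: "0 \<in> O'" using y x W(2) Ty by (simp add: O'_def)
  \<comment> \<open>The components of \<open>V\<close> in the slice chart along the curve
    \<open>?z\<close>, which runs in \<open>P\<close>; they lie in \<open>S\<close> because
    \<open>V\<close> is tangent to \<open>P\<close>.\<close>
  define u where "u t = C'.DT (?z t) (V (?z t))" for t
  have zO: "?z t \<in> overlap c c1" "?y' t \<in> overlap c1 c" "?z t \<in> W" if "t \<in> O'" for t using that
      by (auto simp: O'_def)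
  have uS: "u t \<in> S \<and> C.DT (?y' t) (u t) = V (?z t)" if t: "t \<in> O'" for t
  proof -
    have "?y' t - ?y \<in> S" using s S by (simp add: subspace_scale)
    then obtain q where q: "q \<in> P" "q \<in> cdom c1" "q \<in> cdom c" "?y' t = cmap c1 q"
      by (rule mem_slice[OF p(1,3) zO(2)[OF t]])
    have z: "?z t = cmap c q" unfolding q(4) by (rule transition_cmap[OF c1 q(2)])
    have "V (?z t) \<in> tangent_change c1 c q ` S"
      using W(4)[OF q(1,3)] zO(3)[OF t] tangent_space_eq[OF q(1,3,2)] by (simp add: z)
    then obtain s' where s': "s' \<in> S" "V (?z t) = tangent_change c1 c q s'" by blast
    have "V (cmap c q) = tangent_change c1 c q s'" using s'(2) z by simp
    then have "u t = s'"
      unfolding u_def z using tangent_change_inverse[OF c1 c q(2,3)] by (simp add: tangent_change_def)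
    then show ?thesis using s' q(4) by (simp add: tangent_change_def)
  qed
  have at0: "at 0 within O' = at (0::real)" by (rule at_within_open[OF O0 O'])
  have "(u has_derivative (\<lambda>h. h *\<^sub>R C'.D2T ?x ?v (V ?x) + C'.DT ?x (h *\<^sub>R frechet_derivative V (at ?x)
      ?v))) (at 0 within O')"
  proof -
    have F: "((\<lambda>t. C'.DT (?z t) w) has_derivative (\<lambda>h. h *\<^sub>R C'.D2T ?x ?v w)) (at 0 within O')" for w
      using vector_derivative_diff_chain_within[of ?z ?v 0 UNIV "\<lambda>x. C'.DT x w" "\<lambda>h. C'.D2T ?x h w"]
        dz has_derivative_at_withinI[OF C'.DT_has_derivative[OF x]]
      by (simp add: comp_def Ty at0 has_vector_derivative_def)
    have "((\<lambda>t. C'.DT (?z t) (V (?z t))) has_derivative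
        (\<lambda>h. h *\<^sub>R C'.D2T ?x ?v (V (?z 0)) + C'.DT (?z 0) (h *\<^sub>R frechet_derivative V (at ?x) ?v))) (at
            0 within O')"
    proof (rule has_derivative_linear_apply[OF O0 _ F])
      show "linear (C'.DT (?z t))" if "t \<in> O'" for t by (rule C'.linear_DT[OF zO(1)[OF that]])
      show "linear (\<lambda>w. h *\<^sub>R C'.D2T ?x ?v w)" for h
        by (rule linear_compose_scale_right[OF C'.linear_D2T(2)[OF x]])
      show "((\<lambda>t. V (?z t)) has_derivative (\<lambda>h. h *\<^sub>R frechet_derivative V (at ?x) ?v)) (at 0 within O')"
        using dV by (simp add: has_vector_derivative_def at0)
    qed
    then show ?thesis by (simp add: u_def[abs_def] Ty)
  qed
  moreover have "h *\<^sub>R C'.D2T ?x ?v (V ?x) + C'.DT ?x (h *\<^sub>R frechet_derivative V (at ?x) ?v)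
      = h *\<^sub>R (C'.D2T ?x ?v (V ?x) + C'.DT ?x (frechet_derivative V (at ?x) ?v))" for h
    by (simp add: linear_cmul[OF C'.linear_DT[OF x]] algebra_simps)
  \<comment> \<open>Existence of the derivative and its membership in \<open>S\<close> are all that
    is retained; the formula is dropped.\<close>
  ultimately obtain u' where u': "(u has_vector_derivative u') (at 0)"
    unfolding has_vector_derivative_def at0 by auto
  have u'S: "u' \<in> S"
  proof (rule vector_derivative_in_subspace[OF u' S])
    have "\<forall>\<^sub>F t in nhds 0. t \<in> O'" by (rule eventually_nhds_in_open[OF O' O0])
    then show "\<forall>\<^sub>F t in nhds 0. u t - u 0 \<in> S"
      by eventually_elim (use uS O0 S in \<open>auto intro: subspace_diff\<close>)
  qed
  have u0: "u 0 = tangent_change c c1 p (V ?x)" by (simp add: u_def Ty tangent_change_def)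
  have "((\<lambda>t. C.DT (?y' t) (u t)) has_derivative
      (\<lambda>h. h *\<^sub>R C.D2T ?y s (u 0) + C.DT (?y' 0) (h *\<^sub>R u'))) (at 0 within O')"
  proof (rule has_derivative_linear_apply[OF O0, where F = "\<lambda>t. C.DT (?y' t)"
      and F' = "\<lambda>w h. h *\<^sub>R C.D2T ?y s w"])
    show "linear (C.DT (?y' t))" if "t \<in> O'" for t by (rule C.linear_DT[OF zO(2)[OF that]])
    show "((\<lambda>t. C.DT (?y' t) w) has_derivative (\<lambda>h. h *\<^sub>R C.D2T ?y s w)) (at 0 within O')" for w
      using vector_derivative_diff_chain_within[of ?y' s 0 UNIV "\<lambda>x. C.DT x w" "\<lambda>h. C.D2T ?y h w"]
        dy has_derivative_at_withinI[OF C.DT_has_derivative[OF y]]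
      by (simp add: comp_def at0 has_vector_derivative_def)
    show "linear (\<lambda>w. h *\<^sub>R C.D2T ?y s w)" for h
      by (rule linear_compose_scale_right[OF C.linear_D2T(2)[OF y]])
    show "(u has_derivative (\<lambda>h. h *\<^sub>R u')) (at 0 within O')" using u'
        by (simp add: has_vector_derivative_def at0)
  qed
  then have "((\<lambda>t. C.DT (?y' t) (u t)) has_vector_derivative (C.D2T ?y s (u 0) + C.DT ?y u')) (at 0)"
    by (simp add: has_vector_derivative_def at0 linear_cmul[OF C.linear_DT[OF y]] algebra_simps)
  then have "((\<lambda>t. V (?z t)) has_vector_derivative (C.D2T ?y s (u 0) + C.DT ?y u')) (at 0)"
    by (rule has_vector_derivative_transform_within_open[OF _ O' O0]) (use uS in blast)
  \<comment> \<open>The derivative of \<open>V\<close> along the curve is computed a second time,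
    now by pushing \<open>u\<close> forward from the slice chart; \<open>D2T\<close> appears and is
    matched below with the inhomogeneous term of \<open>christoffel_change\<close>.\<close>
  then have DV: "frechet_derivative V (at ?x) ?v = C.D2T ?y s (u 0) + C.DT ?y u'"
    using vector_derivative_unique_at[OF dV] by blast
  have Vx: "V ?x = C.DT ?y (u 0)" using uS[OF O0] Ty by simp
  have "nabla (g c) (\<lambda>_. ?v) V ?x = C.DT ?y u' + (C.D2T ?y s (u 0) + christoffel (g c) ?x (C.DT ?y s)
      (C.DT ?y (u 0)))"
    unfolding nabla_def DV Vx by (simp add: tangent_change_def)
  also have "C.D2T ?y s (u 0) + christoffel (g c) ?x (C.DT ?y s) (C.DT ?y (u 0)) = C.DT ?y (christoffel
      (g c1) ?y s (u 0))"
    using C.christoffel_change[OF y, where u = s and v = "u 0"] by (simp add: Ty)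
  finally have "g c ?x (nabla (g c) (\<lambda>_. ?v) V ?x) N
      = g c ?x (C.DT ?y u') N + g c ?x (C.DT ?y (christoffel (g c1) ?y s (u 0))) N"
    by (simp add: C.M'.G_simps[OF xc])
  moreover have "g c ?x (C.DT ?y u') N = 0"
    using N[of "C.DT ?y u'"] u'S C.M'.G_sym[OF xc] by (simp add: T_eq tangent_change_def)
  ultimately show ?thesis by (simp add: u0 tangent_change_def)
qed

end

section \<open>Second fundamental form and the Lagrangian of a submanifold\<close>

context slice begin

context
  fixes N :: 'a
  assumes N: "\<And>u. u \<in> T \<Longrightarrow> g c (cmap c p) N u = 0"
    and nondeg: "nondegenerate_on T (g c (cmap c p))"
begin

text \<open>The second fundamental form in the direction \<open>N\<close>, by the formula found in
  \<open>nabla_normal\<close>. It is written for all vectors of the model space, so that it is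
  bilinear without restriction; its symmetry is that of the Christoffel map.\<close>

definition second_form :: "'a \<Rightarrow> 'a \<Rightarrow> real" where
  "second_form v u = g c (cmap c p) (tangent_change c1 c p
     (christoffel (g c1) (cmap c1 p) (tangent_change c c1 p v) (tangent_change c c1 p u))) N"

lemma x_in: "cmap c p \<in> cimg c" and y_in: "cmap c1 p \<in> cimg c1"
  using p by auto

lemma bilinear_gp: "bilinear (g c (cmap c p))"
  by (rule metric_patch.G_bilin[OF metric_patch_chart[OF c] x_in])

lemma gp_sym: "g c (cmap c p) u v = g c (cmap c p) v u"
  by (rule metric_patch.G_sym[OF metric_patch_chart[OF c] x_in])

lemmas gp_simps = metric_patch.G_simps[OF metric_patch_chart[OF c] x_in]

lemma bilinear_second_form: "bilinear second_form"
proof -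
  note 1 = linear_tangent_change[OF c c1 p(2,3)] and 2 = linear_tangent_change[OF c1 c p(3,2)]
  note b = metric_patch.bilinear_christoffel[OF metric_patch_chart[OF c1] y_in]
  show ?thesis
    unfolding bilinear_def second_form_def
    by (intro conjI allI linearI)
      (simp_all add: linear_add[OF 1] linear_cmul[OF 1] linear_add[OF 2] linear_cmul[OF 2]
        bilinear_ladd[OF b] bilinear_radd[OF b] bilinear_lmul[OF b] bilinear_rmul[OF b] gp_simps)
qed

lemma second_form_sym: "second_form u v = second_form v u"
  unfolding second_form_def
  by (simp add: metric_patch.christoffel_sym[OF metric_patch_chart[OF c1] y_in, of
      "tangent_change c c1 p u" "tangent_change c c1 p v"])

lemma second_form_nabla:
  assumes V: "tangent_field_near c P p V" and v: "v \<in> T"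
  shows "g c (cmap c p) (nabla (g c) (\<lambda>_. v) V (cmap c p)) N = second_form v (V (cmap c p))"
proof -
  obtain s where s: "s \<in> S" "v = tangent_change c1 c p s" using v T_eq by blast
  have "tangent_change c c1 p v = s" unfolding s(2) by (rule tangent_change_inverse[OF c1 c p(3,2)])
  then show ?thesis
    using nabla_normal[OF V s(1) N] by (simp add: second_form_def s(2))
qed

text \<open>Nondegeneracy on \<open>T\<close> makes \<open>T\<close> and its
  \<open>g\<close>-orthogonal meet trivially, and by dimension they span; \<open>z1\<close> is the
  \<open>g\<close>-orthogonal projection of \<open>z\<close>.\<close>

lemma nondegenerate_project:
  obtains z1 where "z1 \<in> T" "\<And>u. u \<in> T \<Longrightarrow> g c (cmap c p) z1 u = g c (cmap c p) z u"
proof -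
  let ?T' = "{x\<in>UNIV. \<forall>y\<in>T. g c (cmap c p) x y = 0}"
  have T': "subspace ?T'" by (rule subspace_bilinear_orthogonal[OF bilinear_gp subspace_UNIV])
  have "T \<inter> ?T' \<subseteq> {0}"
    using nondeg unfolding nondegenerate_on_def by auto
  then have int: "T \<inter> ?T' = {0}" using subspace_0[OF subspace_T] subspace_0[OF T'] by blast
  have "dim (UNIV :: 'a set) \<le> dim ?T' + dim T"
    by (rule dim_bilinear_orthogonal_ge[OF bilinear_gp subspace_UNIV subspace_T])
  moreover have "dim T + dim ?T' \<le> dim (UNIV :: 'a set)"
    by (rule dim_sum_le_if_Int_trivial[OF subspace_T T' subspace_UNIV]) (use int in auto)
  ultimately have "dim T + dim ?T' = DIM('a)" by simp
  then obtain z1 z2 where z: "z1 \<in> T" "z2 \<in> ?T'" "z = z1 + z2"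
    by (rule complementary_subspaces_sum[OF subspace_T T' int])
  have "g c (cmap c p) z1 u = g c (cmap c p) z u" if "u \<in> T" for u
    using z(2) that by (simp add: z(3) gp_simps)
  then show thesis using that z(1) by blast
qed

text \<open>The definite description denotes the projection onto \<open>T\<close> of the vector that
  represents \<open>second_form v\<close>. It is unique because every vector of \<open>T\<close> is
  the value of a tangent field and \<open>g\<close> is nondegenerate on \<open>T\<close>.\<close>

lemma shape_operator:
  assumes v: "v \<in> T" and u: "u \<in> T"
  shows "g c (cmap c p) (shape_operator g c P p N v) u = second_form v u"
proof -
  have "linear (second_form v)" using bilinear_second_form by (simp add: bilinear_def)
  then obtain z where z: "\<And>w. g c (cmap c p) z w = second_form v w"
    using metric_patch.represent[OF metric_patch_chart[OF c] x_in] by blast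
  obtain z1 where z1: "z1 \<in> T" "\<And>w. w \<in> T \<Longrightarrow> g c (cmap c p) z1 w = g c (cmap c p) z w"
    by (rule nondegenerate_project[of z]) blast
  have VT: "V (cmap c p) \<in> T" if "tangent_field_near c P p V" for V
    using that p unfolding tangent_field_near_def by blast
  have "shape_operator g c P p N v = z1"
    unfolding shape_operator_def
  proof (rule the_equality)
    show "z1 \<in> T \<and> (\<forall>V. tangent_field_near c P p V \<longrightarrow>
        g c (cmap c p) z1 (V (cmap c p)) = g c (cmap c p) (nabla (g c) (\<lambda>_. v) V (cmap c p)) N)"
      using z1 z VT second_form_nabla[OF _ v] by simp
    fix s assume s: "s \<in> T \<and> (\<forall>V. tangent_field_near c P p V \<longrightarrow>
        g c (cmap c p) s (V (cmap c p)) = g c (cmap c p) (nabla (g c) (\<lambda>_. v) V (cmap c p)) N)"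
    have "g c (cmap c p) (s - z1) w = 0" if w: "w \<in> T" for w
    proof -
      obtain V where V: "tangent_field_near c P p V" "V (cmap c p) = w"
          by (rule tangent_field_exists[OF w])
      have "g c (cmap c p) s w = second_form v w" using s V second_form_nabla[OF V(1) v] by metis
      then show ?thesis using z1(2)[OF w] z[of w] by (simp add: gp_simps)
    qed
    moreover have "s - z1 \<in> T" using s z1(1) subspace_T by (simp add: subspace_diff)
    ultimately have "s - z1 = 0" using nondeg unfolding nondegenerate_on_def by blast
    then show "s = z1" by simp
  qed
  then show ?thesis using z1(2)[OF u] z[of u] by simp
qed

lemma submanifold_lagrangian_eq:
  "submanifold_lagrangian g c P p N = {(v, w). v \<in> T \<and> (\<forall>u\<in>T. g c (cmap c p) w u + second_form v u = 0)}"
  unfolding submanifold_lagrangian_def using shape_operator by (auto simp: gp_simps)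

text \<open>Isotropy is the symmetry of the second fundamental form. For the dimension, the subspace
  is the orthogonal of \<open>T \<times> {0}\<close> inside \<open>T \<times> UNIV\<close> for the
  non-symmetric form \<open>?B\<close>, so it has dimension at least \<open>DIM('a)\<close>;
  isotropic subspaces have no more.\<close>

lemma lagrangian_submanifold:
  "lagrangian (symp_form (g c (cmap c p))) (submanifold_lagrangian g c P p N)"
proof -
  interpret symplectic "symp_form (g c (cmap c p))" by (rule symplectic_chart[OF c x_in])
  let ?L = "submanifold_lagrangian g c P p N"
  let ?B = "\<lambda>z z'. g c (cmap c p) (snd z) (fst z') + second_form (fst z) (fst z')"
  note sf = bilinear_ladd[OF bilinear_second_form] bilinear_radd[OF bilinear_second_form]
    bilinear_lmul[OF bilinear_second_form] bilinear_rmul[OF bilinear_second_form]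
  have B: "bilinear ?B"
    unfolding bilinear_def by (intro conjI allI linearI) (simp_all add: sf gp_simps algebra_simps)
  have sTU: "subspace (T \<times> (UNIV :: 'a set))" by (rule subspace_Times[OF subspace_T subspace_UNIV])
  have sT0: "subspace (T \<times> {0 :: 'a})" by (rule subspace_Times[OF subspace_T subspace_single_0])
  have L: "?L = {z \<in> T \<times> UNIV. \<forall>z'\<in>T \<times> {0}. ?B z z' = 0}"
    unfolding submanifold_lagrangian_eq by auto
  have sub: "subspace ?L" by (subst L) (rule subspace_bilinear_orthogonal[OF B sTU])
  have "dim (T \<times> (UNIV :: 'a set)) \<le> dim ?L + dim (T \<times> {0 :: 'a})"
    by (subst L) (rule dim_bilinear_orthogonal_ge[OF B sTU sT0])
  then have ge: "DIM('a) \<le> dim ?L"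
    by (simp add: dim_Times[OF subspace_T subspace_UNIV] dim_Times[OF subspace_T subspace_single_0])
  have iso: "symp_form (g c (cmap c p)) z z' = 0" if "z \<in> ?L" "z' \<in> ?L" for z z'
  proof -
    obtain v w v' w' where z: "z = (v, w)" "z' = (v', w')" by (metis surj_pair)
    have "g c (cmap c p) w v' + second_form v v' = 0" "g c (cmap c p) w' v + second_form v' v = 0"
      using that unfolding z submanifold_lagrangian_eq by auto
    then show ?thesis
      using second_form_sym[of v v'] gp_sym[of v' w] gp_sym[of v w'] by (simp add: z symp_form_def)
  qed
  have "2 * dim ?L \<le> DIM('a \<times> 'a)" by (rule dim_isotropic_le[OF sub iso])
  then have "2 * dim ?L = DIM('a \<times> 'a)" using ge by simp
  then show ?thesis using sub iso by (simp add: lagrangian_def)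
qed

text \<open>The intersection contains the product of \<open>{0}\<close> with the
  \<open>g\<close>-orthogonal of \<open>T\<close>, whose dimension is at least
  \<open>DIM('a) - dim T\<close>.\<close>

lemma dim_initial_Int_submanifold:
  "DIM('a) \<le> dim ((initial_lagrangian :: ('a \<times> 'a) set) \<inter> submanifold_lagrangian g c P p N) + dim T"
proof -
  let ?T' = "{x\<in>UNIV. \<forall>y\<in>T. g c (cmap c p) x y = 0}"
  have T': "subspace ?T'" by (rule subspace_bilinear_orthogonal[OF bilinear_gp subspace_UNIV])
  have "{0} \<times> ?T' \<subseteq> initial_lagrangian \<inter> submanifold_lagrangian g c P p N"
    unfolding submanifold_lagrangian_eq initial_lagrangian_def
    using subspace_0[OF subspace_T] bilinear_lzero[OF bilinear_second_form] by auto
  then have "dim ({0 :: 'a} \<times> ?T') \<le> dim (initial_lagrangian \<inter> submanifold_lagrangian g c P p N)"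
    by (rule dim_subset)
  moreover have "dim ({0 :: 'a} \<times> ?T') = dim ?T'"
    unfolding dim_Times[OF subspace_single_0 T'] by simp
  moreover have "dim (UNIV :: 'a set) \<le> dim ?T' + dim T"
    by (rule dim_bilinear_orthogonal_ge[OF bilinear_gp subspace_UNIV subspace_T])
  ultimately show ?thesis by simp
qed

end

end

context semi_riem begin

lemma lagrangian_initial:
  assumes "c \<in> A" "x \<in> cimg c"
  shows "lagrangian (symp_form (g c x)) (initial_lagrangian :: ('a \<times> 'a) set)"
    and "dim (initial_lagrangian :: ('a \<times> 'a) set) = DIM('a)"
proof -
  note s = metric_patch.G_simps(9,10)[OF metric_patch_chart[OF assms(1)] assms(2)]
  show d: "dim (initial_lagrangian :: ('a \<times> 'a) set) = DIM('a)"
    by (simp add: initial_lagrangian_def dim_Times[OF subspace_single_0 subspace_UNIV])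
  have "subspace (initial_lagrangian :: ('a \<times> 'a) set)"
    unfolding initial_lagrangian_def by (rule subspace_Times[OF subspace_single_0 subspace_UNIV])
  then show "lagrangian (symp_form (g c x)) (initial_lagrangian :: ('a \<times> 'a) set)"
    unfolding lagrangian_def using d by (auto simp: initial_lagrangian_def symp_form_def s)
qed

end

theorem proposition4p3:
  fixes M :: "'m::{t2_space, second_countable_topology} set"
    and A :: "('m, 'a::euclidean_space) chart set"
    and g :: "('m, 'a) chart \<Rightarrow> 'a local_metric"
    and \<gamma> :: "real \<Rightarrow> 'm" and a b \<alpha> \<beta> :: real
    and P :: "'m set" and k :: nat
    and c :: "('m, 'a) chart"
    and \<mu> :: "('a \<times> 'a) set \<Rightarrow> real \<Rightarrow> real \<Rightarrow> (real \<Rightarrow> ('a \<times> 'a) set) \<Rightarrow> int"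
  assumes "semi_riemannian_manifold M A g"
    and "a < b" and "geodesic M A g a b \<gamma>"
    and "submanifold M A P k" and "connected P" and "\<gamma> a \<in> P"
    and "c \<in> A" and "\<gamma> a \<in> cdom c"
    and "\<forall>v\<in>tangent_space c P (\<gamma> a). g c (cmap c (\<gamma> a)) (velocity a b \<gamma> c a) v = 0"
    and "nondegenerate_on (tangent_space c P (\<gamma> a)) (g c (cmap c (\<gamma> a)))"
    and "\<forall>L. lagrangian (symp_form (g c (cmap c (\<gamma> a)))) L \<longrightarrow>
             is_maslov_index (symp_form (g c (cmap c (\<gamma> a)))) L (\<mu> L)"
    and "a \<le> \<alpha>" and "\<alpha> \<le> \<beta>" and "\<beta> \<le> b"
  shows "\<bar>\<mu> initial_lagrangian \<alpha> \<beta> (geodesic_lagrangian A g a b \<gamma> c)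
          - \<mu> (submanifold_lagrangian g c P (\<gamma> a) (velocity a b \<gamma> c a)) \<alpha> \<beta>
              (geodesic_lagrangian A g a b \<gamma> c)\<bar> \<le> int k"
proof -
  interpret geodesic_setting M A g a b \<gamma>
    by unfold_locales (use assms in simp_all)
  note c = \<open>c \<in> A\<close> and pc = \<open>\<gamma> a \<in> cdom c\<close> and pP = \<open>\<gamma> a \<in> P\<close>
  \<comment> \<open>The dimension \<open>k\<close> enters through the direction space of a slice
    chart at the initial point.\<close>
  obtain c1 S where c1: "c1 \<in> A" "\<gamma> a \<in> cdom c1" and sub: "subspace S" and dim_S: "dim S = k"
    and sl: "cmap c1 ` (P \<inter> cdom c1) = cimg c1 \<inter> (\<lambda>s. cmap c1 (\<gamma> a) + s) ` S"
    using \<open>submanifold M A P k\<close> pP unfolding submanifold_def by blast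
  interpret slice M A g P "\<gamma> a" c c1 S
    by unfold_locales (use pP pc c1 c sub sl in simp_all)
  let ?\<omega> = "symp_form (g c (cmap c (\<gamma> a)))" and ?N = "velocity a b \<gamma> c a"
  let ?L0 = "initial_lagrangian :: ('a \<times> 'a) set" and ?L1 = "submanifold_lagrangian g c P (\<gamma> a) ?N"
  have x: "cmap c (\<gamma> a) \<in> cimg c" using pc by simp
  interpret V: symplectic ?\<omega> by (rule symplectic_chart[OF c x])
  have N: "g c (cmap c (\<gamma> a)) ?N u = 0" if "u \<in> T" for u using assms(9) that by blast
  note L0 = lagrangian_initial[OF c x] and L1 = lagrangian_submanifold[OF N assms(10)]
  have "lag_continuous_on ?\<omega> {\<alpha>..\<beta>} (geodesic_lagrangian A g a b \<gamma> c)"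
    by (rule lag_continuous_on_subset[OF geodesic_lagrangian_continuous[OF c pc]]) (use assms(12-14) in
        auto)
  then have "\<bar>\<mu> ?L0 \<alpha> \<beta> (geodesic_lagrangian A g a b \<gamma> c) - \<mu> ?L1 \<alpha> \<beta> (geodesic_lagrangian A g a b \<gamma> c)\<bar>
      \<le> int (dim ?L0) - int (dim (?L0 \<inter> ?L1))"
    using assms(11) L0(1) L1 by (intro V.maslov_difference_bound \<open>\<alpha> \<le> \<beta>\<close>) blast+
  \<comment> \<open>\<open>initial_lagrangian\<close> has dimension \<open>DIM('a)\<close> and
    shares at least \<open>DIM('a) - dim T\<close> dimensions with the other Lagrangian, where
    \<open>dim T = dim S = k\<close>.\<close>
  also have "\<dots> \<le> int k"
    using dim_initial_Int_submanifold[OF N assms(10)] dim_T dim_S L0(2) by simp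
  finally show ?thesis .
qed

end
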